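(* Let $\mathbf{x}$ be a mixed multiplicity system of $M$ of the type $\mathbf{k}\in\mathbb{N}^d$. Then $$e(M;\mathbf{k})\le\ell_A\big[(M/\mathbf{x}M)_{\mathbf{n}}\big]$$ for all large $\mathbf{n}$, and equality holds if $\mathbf{x}$ is an $S_{++}$-filter-regular sequence with respect to $M$.
   Context: $\mathbb{N}$ denotes the nonnegative integers and $d\ge 1$ is an integer. $(A,\mathfrak{m})$ is an Artinian local ring with infinite residue field; $S=\bigoplus_{\mathbf{n}\in\mathbb{N}^d}S_{\mathbf{n}}$ is a finitely generated standard $\mathbb{N}^d$-graded (commutative) algebra over $A$, i.e. $S$ is generated over $A$ by elements of total degree $1$; $M=\bigoplus_{\mathbf{n}\in\mathbb{N}^d}M_{\mathbf{n}}$ is a finitely generated $\mathbb{N}^d$-graded $S$-module. On $\mathbb{N}^d$, $\le$ is componentwise, and $\mathbf{h}>\mathbf{k}$ means $\mathbf{h}\ge\mathbf{k}$ and $\mathbf{h}\ne\mathbf{k}$. "For all large $\mathbf{n}$" means for all $\mathbf{n}$ with every component sufficiently large. Let $\mathbf{e}_i$ be the $i$-th unit vector of $\mathbb{N}^d$, $S_i=S_{\mathbf{e}_i}$, and $S_{++}=\bigoplus_{\mathbf{n}\ge(1,\ldots,1)}S_{\mathbf{n}}$. $\mathrm{Proj}\,S$ is the set of homogeneous prime ideals of $S$ not containing $S_{++}$; $\mathrm{Supp}_{++}M=\{P\in\mathrm{Proj}\,S: M_P\ne0\}$; its dimension is the supremum of lengths of chains of primes in it, with $\dim\emptyset=-\infty$.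 Mixed multiplicities: $\ell_A$ denotes length. For all large $\mathbf{n}$, $\ell_A[M_{\mathbf{n}}]$ equals a polynomial $P_M(\mathbf{n})$ (the Hilbert polynomial), written uniquely as $P_M(\mathbf{n})=\sum_{\mathbf{k}\in\mathbb{N}^d}e(M;\mathbf{k})\binom{\mathbf{n}+\mathbf{k}}{\mathbf{k}}$ with $e(M;\mathbf{k})\in\mathbb{Z}$, where $\binom{\mathbf{n}+\mathbf{k}}{\mathbf{k}}=\prod_{i=1}^d\binom{n_i+k_i}{k_i}$. The mixed multiplicity (of maximal degree) of $M$ of the type $\mathbf{k}$ is defined if $e(M;\mathbf{h})=0$ for all $\mathbf{h}>\mathbf{k}$, and is then the number $e(M;\mathbf{k})$. A sequence of elements of $\bigcup_{j=1}^dS_j$ consisting of $k_1$ elements of $S_1$, ..., $k_d$ elements of $S_d$ (in any order) is said to be of the type $\mathbf{k}=(k_1,\ldots,k_d)$. A sequence $\mathbf{x}$ of the type $\mathbf{k}$ is a mixed multiplicity system of $M$ of the type $\mathbf{k}$ if $\dim\mathrm{Supp}_{++}(M/\mathbf{x}M)\le0$. A homogeneous element $a\in S$ is $S_{++}$-filter-regular with respect to $M$ if $(0_M:a)_{\mathbf{n}}=0$ for all large $\mathbf{n}$, where $0_M:a=\{m\in M: am=0\}$; a sequence $x_1,\ldots,x_t$ of homogeneous elements is an $S_{++}$-filter-regular sequence with respect to $M$ if each $x_i$ is $S_{++}$-filter-regular with respect to $M/(x_1,\ldots,x_{i-1})M$. *)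

theory Defs
  imports "HOL-Library.Extended_Real" "HOL-Algebra.QuotRing"
    "HOL-Algebra.Generated_Rings" "HOL-Algebra.Module"
begin

(* Multidegrees are functions 'd => nat with 'd a finite (hence nonempty) type, so that
   the number d >= 1 of gradings is CARD('d).  The order <= on functions is componentwise. *)

definition deg_add :: "('d \<Rightarrow> nat) \<Rightarrow> ('d \<Rightarrow> nat) \<Rightarrow> 'd \<Rightarrow> nat" where
  "deg_add m n = (\<lambda>i. m i + n i)"

definition unit_deg :: "'d \<Rightarrow> 'd \<Rightarrow> nat" where
  "unit_deg i = (\<lambda>j. if j = i then 1 else 0)"

definition for_all_large :: "(('d \<Rightarrow> nat) \<Rightarrow> bool) \<Rightarrow> bool" where
  "for_all_large Q \<longleftrightarrow> (\<exists>N::nat. \<forall>n. (\<forall>i. N \<le> n i) \<longrightarrow> Q n)"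

definition chain_lengths :: "'a set set \<Rightarrow> nat set" where
  "chain_lengths X = {n. \<exists>C. (\<forall>i\<le>n. C i \<in> X) \<and> (\<forall>i<n. C i \<subset> C (Suc i))}"


section \<open>Rings and modules\<close>

definition artinian_ring :: "('a, 'x) ring_scheme \<Rightarrow> bool" where
  "artinian_ring A \<longleftrightarrow> cring A \<and>
     (\<forall>I. (\<forall>n::nat. ideal (I n) A \<and> I (Suc n) \<subseteq> I n) \<longrightarrow> (\<exists>N. \<forall>n\<ge>N. I n = I N))"

definition local_ring :: "('a, 'x) ring_scheme \<Rightarrow> 'a set \<Rightarrow> bool" where
  "local_ring A \<mm> \<longleftrightarrow> cring A \<and> maximalideal \<mm> A \<and> (\<forall>I. maximalideal I A \<longrightarrow> I = \<mm>)"

definition submodule_gen ::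
    "('s, 'x) ring_scheme \<Rightarrow> ('s, 'm, 'y) module_scheme \<Rightarrow> 'm set \<Rightarrow> 'm set" where
  "submodule_gen S M X = \<Inter>{N. submodule N S M \<and> X \<subseteq> N}"

definition fg_module :: "('s, 'x) ring_scheme \<Rightarrow> ('s, 'm, 'y) module_scheme \<Rightarrow> bool" where
  "fg_module S M \<longleftrightarrow> (\<exists>X. finite X \<and> X \<subseteq> carrier M \<and> carrier M = submodule_gen S M X)"

(* The record type of modules extends that of rings; the fields mult and one carry no
   meaning for a module that is not an algebra and are left undefined here and below. *)
definition quot_module :: "('s, 'm, 'y) module_scheme \<Rightarrow> 'm set \<Rightarrow> ('s, 'm set) module" where
  "quot_module M N =
     \<lparr>carrier = a_rcosets\<^bsub>M\<^esub> N, mult = undefined, one = undefined, zero = N, add = set_add M,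
      smult = (\<lambda>r C. \<Union>c\<in>C. N +>\<^bsub>M\<^esub> (r \<odot>\<^bsub>M\<^esub> c))\<rparr>"

definition module_length ::
    "('a, 'x) ring_scheme \<Rightarrow> ('a, 'm, 'y) module_scheme \<Rightarrow> enat" where
  "module_length R M = (SUP n\<in>chain_lengths {N. submodule N R M}. enat n)"

text \<open>Localization of a module at a prime ideal, as a set of equivalence classes of fractions
  \<open>m/s\<close> represented by pairs \<open>(m, s)\<close>.\<close>

definition loc_rel ::
    "('s, 'x) ring_scheme \<Rightarrow> 's set \<Rightarrow> ('s, 'm, 'y) module_scheme \<Rightarrow> (('m \<times> 's) \<times> ('m \<times> 's)) set" where
  "loc_rel S P M = {((m, s), (m', s')).
     m \<in> carrier M \<and> m' \<in> carrier M \<and> s \<in> carrier S - P \<and> s' \<in> carrier S - P \<and>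
     (\<exists>u \<in> carrier S - P. u \<odot>\<^bsub>M\<^esub> (s' \<odot>\<^bsub>M\<^esub> m) = u \<odot>\<^bsub>M\<^esub> (s \<odot>\<^bsub>M\<^esub> m'))}"

definition localization ::
    "('s, 'x) ring_scheme \<Rightarrow> 's set \<Rightarrow> ('s, 'm, 'y) module_scheme \<Rightarrow> ('m \<times> 's) set set" where
  "localization S P M = (carrier M \<times> (carrier S - P)) // loc_rel S P M"

definition loc_zero ::
    "('s, 'x) ring_scheme \<Rightarrow> 's set \<Rightarrow> ('s, 'm, 'y) module_scheme \<Rightarrow> ('m \<times> 's) set" where
  "loc_zero S P M = loc_rel S P M `` {(\<zero>\<^bsub>M\<^esub>, \<one>\<^bsub>S\<^esub>)}"


section \<open>Multigraded algebras and modules\<close>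

text \<open>\<open>f\<close> is the family of homogeneous components of \<open>x\<close> with respect to the family \<open>G\<close>.\<close>

definition is_decomp ::
    "('m, 'y) ring_scheme \<Rightarrow> ('i \<Rightarrow> 'm set) \<Rightarrow> ('i \<Rightarrow> 'm) \<Rightarrow> 'm \<Rightarrow> bool" where
  "is_decomp M G f x \<longleftrightarrow> (\<forall>n. f n \<in> G n) \<and> finite {n. f n \<noteq> \<zero>\<^bsub>M\<^esub>} \<and>
     x = finsum M f {n. f n \<noteq> \<zero>\<^bsub>M\<^esub>}"

definition internal_direct_sum :: "('m, 'y) ring_scheme \<Rightarrow> ('i \<Rightarrow> 'm set) \<Rightarrow> bool" where
  "internal_direct_sum M G \<longleftrightarrow> (\<forall>n. subgroup (G n) (add_monoid M)) \<and>
     (\<forall>x \<in> carrier M. \<exists>!f. is_decomp M G f x)"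

definition graded_algebra ::
    "('a, 'x) ring_scheme \<Rightarrow> ('a, 's, 'y) module_scheme \<Rightarrow> (('d::finite \<Rightarrow> nat) \<Rightarrow> 's set) \<Rightarrow> bool" where
  "graded_algebra A S Sg \<longleftrightarrow> algebra A S \<and> internal_direct_sum S Sg \<and>
     (\<forall>n. submodule (Sg n) A S) \<and> \<one>\<^bsub>S\<^esub> \<in> Sg (\<lambda>_. 0) \<and>
     (\<forall>m n. \<forall>x\<in>Sg m. \<forall>y\<in>Sg n. x \<otimes>\<^bsub>S\<^esub> y \<in> Sg (deg_add m n))"

definition algebra_gen ::
    "('a, 'x) ring_scheme \<Rightarrow> ('a, 's, 'y) module_scheme \<Rightarrow> 's set \<Rightarrow> 's set" where
  "algebra_gen A S X = generate_ring S ({a \<odot>\<^bsub>S\<^esub> \<one>\<^bsub>S\<^esub> | a. a \<in> carrier A} \<union> X)"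

definition fg_standard_graded_algebra ::
    "('a, 'x) ring_scheme \<Rightarrow> ('a, 's, 'y) module_scheme \<Rightarrow> (('d::finite \<Rightarrow> nat) \<Rightarrow> 's set) \<Rightarrow> bool" where
  "fg_standard_graded_algebra A S Sg \<longleftrightarrow> graded_algebra A S Sg \<and>
     (\<exists>X. finite X \<and> X \<subseteq> carrier S \<and> carrier S = algebra_gen A S X) \<and>
     carrier S = algebra_gen A S (\<Union>i. Sg (unit_deg i))"

definition graded_module ::
    "('s, 'x) ring_scheme \<Rightarrow> (('d::finite \<Rightarrow> nat) \<Rightarrow> 's set) \<Rightarrow>
     ('s, 'm, 'y) module_scheme \<Rightarrow> (('d \<Rightarrow> nat) \<Rightarrow> 'm set) \<Rightarrow> bool" where
  "graded_module S Sg M Mg \<longleftrightarrow> module S M \<and> internal_direct_sum M Mg \<and>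
     (\<forall>k n. \<forall>s\<in>Sg k. \<forall>m\<in>Mg n. s \<odot>\<^bsub>M\<^esub> m \<in> Mg (deg_add k n))"

definition quot_grading ::
    "('s, 'm, 'y) module_scheme \<Rightarrow> 'm set \<Rightarrow> ('i \<Rightarrow> 'm set) \<Rightarrow> 'i \<Rightarrow> 'm set set" where
  "quot_grading M N Mg n = (\<lambda>m. N +>\<^bsub>M\<^esub> m) ` Mg n"

text \<open>A graded piece \<open>X\<close> of the \<open>S\<close>-module \<open>M\<close>, as an \<open>A\<close>-module via \<open>a \<mapsto> a \<cdot> 1\<^sub>S\<close>.\<close>

definition graded_piece ::
    "('a, 's, 'x) module_scheme \<Rightarrow> ('s, 'm, 'y) module_scheme \<Rightarrow> 'm set \<Rightarrow> ('a, 'm) module" where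
  "graded_piece S M X =
     \<lparr>carrier = X, mult = undefined, one = undefined, zero = \<zero>\<^bsub>M\<^esub>, add = add M,
      smult = (\<lambda>a m. (a \<odot>\<^bsub>S\<^esub> \<one>\<^bsub>S\<^esub>) \<odot>\<^bsub>M\<^esub> m)\<rparr>"

definition piece_length ::
    "('a, 'w) ring_scheme \<Rightarrow> ('a, 's, 'x) module_scheme \<Rightarrow> ('s, 'm, 'y) module_scheme \<Rightarrow>
     'm set \<Rightarrow> enat" where
  "piece_length A S M X = module_length A (graded_piece S M X)"


section \<open>Projective spectrum and support\<close>

definition irrelevant_ideal ::
    "('s, 'x) ring_scheme \<Rightarrow> (('d \<Rightarrow> nat) \<Rightarrow> 's set) \<Rightarrow> 's set" where
  "irrelevant_ideal S Sg =
     {x. \<exists>f. is_decomp S Sg f x \<and> (\<forall>n. f n \<noteq> \<zero>\<^bsub>S\<^esub> \<longrightarrow> (\<lambda>_. 1) \<le> n)}"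

definition homogeneous_ideal ::
    "('s, 'x) ring_scheme \<Rightarrow> (('d \<Rightarrow> nat) \<Rightarrow> 's set) \<Rightarrow> 's set \<Rightarrow> bool" where
  "homogeneous_ideal S Sg I \<longleftrightarrow> ideal I S \<and> I = genideal S (I \<inter> (\<Union>n. Sg n))"

definition Proj :: "('s, 'x) ring_scheme \<Rightarrow> (('d \<Rightarrow> nat) \<Rightarrow> 's set) \<Rightarrow> 's set set" where
  "Proj S Sg = {P. primeideal P S \<and> homogeneous_ideal S Sg P \<and> \<not> irrelevant_ideal S Sg \<subseteq> P}"

definition Supp_pp ::
    "('s, 'x) ring_scheme \<Rightarrow> (('d \<Rightarrow> nat) \<Rightarrow> 's set) \<Rightarrow> ('s, 'm, 'y) module_scheme \<Rightarrow> 's set set" where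
  "Supp_pp S Sg M = {P \<in> Proj S Sg. localization S P M \<noteq> {loc_zero S P M}}"

(* The supremum of the empty set in ereal is -\<infinity>. *)
definition chain_dim :: "'s set set \<Rightarrow> ereal" where
  "chain_dim X = (SUP n\<in>chain_lengths X. ereal (real n))"


section \<open>Mixed multiplicities, mixed multiplicity systems, filter-regular sequences\<close>

definition hilbert_coeff ::
    "('a, 'w) ring_scheme \<Rightarrow> ('a, 's, 'x) module_scheme \<Rightarrow> ('s, 'm, 'y) module_scheme \<Rightarrow>
     (('d::finite \<Rightarrow> nat) \<Rightarrow> 'm set) \<Rightarrow> ('d \<Rightarrow> nat) \<Rightarrow> int" where
  "hilbert_coeff A S M Mg =
     (THE e. finite {k. e k \<noteq> 0} \<and>
        for_all_large (\<lambda>n. ereal_of_enat (piece_length A S M (Mg n)) =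
          ereal (of_int (\<Sum>k | e k \<noteq> 0. e k * int (\<Prod>i\<in>UNIV. (n i + k i) choose k i)))))"

text \<open>The elements \<open>is ! t\<close> assign to each member of the sequence the piece \<open>S\<^sub>i\<close> it is taken
  from; this matters only for the zero element, which lies in every \<open>S\<^sub>i\<close>.\<close>

definition of_type :: "(('d \<Rightarrow> nat) \<Rightarrow> 's set) \<Rightarrow> 's list \<Rightarrow> ('d \<Rightarrow> nat) \<Rightarrow> bool" where
  "of_type Sg xs k \<longleftrightarrow>
     (\<exists>is. list_all2 (\<lambda>x i. x \<in> Sg (unit_deg i)) xs is \<and> (\<forall>i. count_list is i = k i))"

definition seq_submodule ::
    "('s, 'x) ring_scheme \<Rightarrow> ('s, 'm, 'y) module_scheme \<Rightarrow> 's list \<Rightarrow> 'm set" where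
  "seq_submodule S M xs = submodule_gen S M {x \<odot>\<^bsub>M\<^esub> m | x m. x \<in> set xs \<and> m \<in> carrier M}"

definition quot_seq ::
    "('s, 'x) ring_scheme \<Rightarrow> ('s, 'm, 'y) module_scheme \<Rightarrow> 's list \<Rightarrow> ('s, 'm set) module" where
  "quot_seq S M xs = quot_module M (seq_submodule S M xs)"

definition quot_seq_grading ::
    "('s, 'x) ring_scheme \<Rightarrow> ('s, 'm, 'y) module_scheme \<Rightarrow> ('i \<Rightarrow> 'm set) \<Rightarrow> 's list \<Rightarrow>
     'i \<Rightarrow> 'm set set" where
  "quot_seq_grading S M Mg xs = quot_grading M (seq_submodule S M xs) Mg"

definition mixed_mult_system ::
    "('s, 'x) ring_scheme \<Rightarrow> (('d \<Rightarrow> nat) \<Rightarrow> 's set) \<Rightarrow> ('s, 'm, 'y) module_scheme \<Rightarrow>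
     's list \<Rightarrow> ('d \<Rightarrow> nat) \<Rightarrow> bool" where
  "mixed_mult_system S Sg M xs k \<longleftrightarrow>
     of_type Sg xs k \<and> chain_dim (Supp_pp S Sg (quot_seq S M xs)) \<le> 0"

definition filter_regular ::
    "(('d \<Rightarrow> nat) \<Rightarrow> 's set) \<Rightarrow> ('s, 'm, 'y) module_scheme \<Rightarrow> (('d \<Rightarrow> nat) \<Rightarrow> 'm set) \<Rightarrow>
     's \<Rightarrow> bool" where
  "filter_regular Sg M Mg a \<longleftrightarrow> a \<in> (\<Union>n. Sg n) \<and>
     for_all_large (\<lambda>n. {m \<in> carrier M. a \<odot>\<^bsub>M\<^esub> m = \<zero>\<^bsub>M\<^esub>} \<inter> Mg n = {\<zero>\<^bsub>M\<^esub>})"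

definition filter_regular_seq ::
    "('s, 'x) ring_scheme \<Rightarrow> (('d \<Rightarrow> nat) \<Rightarrow> 's set) \<Rightarrow> ('s, 'm, 'y) module_scheme \<Rightarrow>
     (('d \<Rightarrow> nat) \<Rightarrow> 'm set) \<Rightarrow> 's list \<Rightarrow> bool" where
  "filter_regular_seq S Sg M Mg xs \<longleftrightarrow>
     (\<forall>i<length xs. filter_regular Sg (quot_seq S M (take i xs))
        (quot_seq_grading S M Mg (take i xs)) (xs ! i))"

end

theory Submission
  imports Defs
begin

text \<open>Let \<open>e(M; k)\<close> be the coefficients of the Hilbert polynomial of \<open>M\<close> in the basis of products of
  binomial coefficients.  In this basis the backward difference in the direction \<open>i\<close> only shifts the
  coefficients by \<open>e\<^sub>i\<close>.  For \<open>x\<close> in \<open>S\<^sub>i\<close>, the exact sequence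
  \<open>0 \<rightarrow> (0 : x) \<rightarrow> M \<rightarrow> M \<rightarrow> M / x M \<rightarrow> 0\<close> given by multiplication by \<open>x\<close> therefore expresses
  \<open>e(M; k) - e(M / x M; k - e\<^sub>i)\<close> by coefficients of \<open>(0 : x)\<close>.  If \<open>x\<close> is the first element of a mixed
  multiplicity system, then the remaining elements form such a system not only for \<open>M / x M\<close> but also
  for \<open>(0 : x)\<close>, since \<open>x\<close> annihilates it.  So one needs to know, for a module with a mixed multiplicity
  system of type \<open>h\<close>, that its coefficients beyond \<open>h\<close> vanish and the one at \<open>h\<close> is nonnegative
  (\<open>maximal_coeff_nonneg\<close>).  Then the difference is \<open>- e((0 : x); k - e\<^sub>i) \<le> 0\<close>, and it is zero if \<open>x\<close> is
  filter-regular.  Induction on the length of the system (\<open>mixed_multiplicity_le\<close>) ends at a module whose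
  support has dimension at most zero, and its Hilbert polynomial is constant
  (\<open>zero_dim_imp_constant\<close>), hence equal to the length of the large graded pieces.

  All general facts about Hilbert polynomials are obtained from one induction, \<open>devissage\<close>: a statement
  compatible with extensions need only be shown for a cyclic module \<open>S / P\<close> up to a shift, where \<open>P\<close> is a
  homogeneous prime, and there it may be assumed for all modules \<open>K / N\<close> with a larger submodule \<open>N\<close>.  On such a
  module a homogeneous element acts as zero or injectively.  If \<open>P\<close> does not contain \<open>S\<^sub>+\<^sub>+\<close>, each \<open>S\<^sub>i\<close> has
  an element outside \<open>P\<close>, so that all backward differences of the Hilbert function are themselves
  Hilbert functions of modules for which the statement is already known.  If \<open>P\<close> contains \<open>S\<^sub>+\<^sub>+\<close>, the large
  graded pieces vanish.  This gives the existence of Hilbert polynomials, the nonnegativity above and the case of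
  dimension zero.

  Every module that occurs is a quotient \<open>K / N\<close> of graded submodules of the given \<open>M\<close>.  It is represented by the
  pair \<open>(N, K)\<close>, and lengths are lengths of intervals of submodules of \<open>M\<close>, so that no iterated
  quotients have to be formed.  The finiteness needed for all this is a version of Hilbert's basis
  theorem for groups with commuting operators, together with the fact that an Artinian ring has
  finite length.\<close>


section \<open>Numerical polynomials in several variables\<close>

lemma for_all_large_mono:
  assumes "for_all_large Q" "\<And>n. Q n \<Longrightarrow> R n"
  shows "for_all_large R"
  using assms unfolding for_all_large_def by blast

lemma for_all_large_conj:
  assumes "for_all_large Q" "for_all_large R"
  shows "for_all_large (\<lambda>n. Q n \<and> R n)"
proof -
  obtain N1 N2 where "\<forall>n. (\<forall>i. N1 \<le> n i) \<longrightarrow> Q n" "\<forall>n. (\<forall>i. N2 \<le> n i) \<longrightarrow> R n"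
    using assms unfolding for_all_large_def by blast
  then show ?thesis
    unfolding for_all_large_def by (intro exI[of _ "max N1 N2"]) auto
qed

lemma for_all_large_ge: "for_all_large (\<lambda>n. \<forall>i. a i \<le> n i)" for a :: "'d::finite \<Rightarrow> nat"
  unfolding for_all_large_def
  by (rule exI[of _ "Max (range a)"]) (meson Max_ge finite finite_imageI le_trans rangeI)

lemma for_all_large_True: "for_all_large (\<lambda>n. True)"
  unfolding for_all_large_def by simp

lemma for_all_large_all:
  assumes "\<And>i::'d::finite. for_all_large (Q i)"
  shows "for_all_large (\<lambda>n. \<forall>i. Q i n)"
proof -
  have "for_all_large (\<lambda>n. \<forall>i\<in>I. Q i n)" if "finite I" for I
    using that
  proof (induction I)
    case empty
    show ?case by (simp add: for_all_large_True)
  next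
    case (insert i I)
    show ?case
      by (rule for_all_large_mono[OF for_all_large_conj[OF assms[of i] insert.IH]]) auto
  qed
  from this[of UNIV] show ?thesis by simp
qed

lemma for_all_large_sample:
  assumes "for_all_large Q"
  obtains n where "Q n"
proof -
  obtain N where "\<forall>n. (\<forall>i. N \<le> n i) \<longrightarrow> Q n" using assms unfolding for_all_large_def by blast
  then have "Q (\<lambda>_. N)" by simp
  then show thesis by (rule that)
qed

abbreviation deg_succ :: "'d \<Rightarrow> ('d \<Rightarrow> nat) \<Rightarrow> 'd \<Rightarrow> nat" where
  "deg_succ i n \<equiv> n(i := Suc (n i))"

text \<open>Truncated subtraction lets this differ from the true predecessor for \<open>n i = 0\<close>, which is harmless as only large degrees matter.\<close>

abbreviation deg_pred :: "'d \<Rightarrow> ('d \<Rightarrow> nat) \<Rightarrow> 'd \<Rightarrow> nat" where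
  "deg_pred i n \<equiv> n(i := n i - 1)"

lemma for_all_large_pred:
  assumes "for_all_large Q"
  shows "for_all_large (\<lambda>n. Q (deg_pred i n))"
proof -
  obtain N where N: "\<forall>n. (\<forall>i. N \<le> n i) \<longrightarrow> Q n"
    using assms unfolding for_all_large_def by blast
  show ?thesis
    unfolding for_all_large_def
  proof (intro exI[of _ "Suc N"] allI impI)
    fix n :: "'a \<Rightarrow> nat" assume n: "\<forall>i. Suc N \<le> n i"
    have "\<forall>j. N \<le> deg_pred i n j"
    proof
      fix j show "N \<le> deg_pred i n j" using n[rule_format, of j] by auto
    qed
    then show "Q (deg_pred i n)" using N by blast
  qed
qed

lemma sum_deg_succ: "(\<Sum>j\<in>UNIV. deg_succ i n j) = Suc (\<Sum>j\<in>UNIV. n j)"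
  for n :: "'d::finite \<Rightarrow> nat"
  by (simp add: sum.remove[of UNIV i] )

lemma deg_succ_pred: "n i \<noteq> 0 \<Longrightarrow> deg_succ i (deg_pred i n) = n"
  by (simp add: fun_eq_iff)

definition binom_prod :: "('d::finite \<Rightarrow> nat) \<Rightarrow> ('d \<Rightarrow> nat) \<Rightarrow> nat" where
  "binom_prod n k = (\<Prod>i\<in>UNIV. (n i + k i) choose k i)"

text \<open>A numerical polynomial is handled through its coefficient function \<open>e\<close>.  Since a sum over an infinite
  set is zero by convention, the formula is meaningful only for \<open>e\<close> of finite support.\<close>

definition num_poly :: "(('d::finite \<Rightarrow> nat) \<Rightarrow> int) \<Rightarrow> ('d \<Rightarrow> nat) \<Rightarrow> int" where
  "num_poly e n = (\<Sum>k | e k \<noteq> 0. e k * int (binom_prod n k))"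

definition lower :: "'d \<Rightarrow> (('d \<Rightarrow> nat) \<Rightarrow> int) \<Rightarrow> ('d \<Rightarrow> nat) \<Rightarrow> int" where
  "lower i e = (\<lambda>h. e (deg_succ i h))"

lemma finite_supp_lower:
  assumes "finite {k. e k \<noteq> 0}"
  shows "finite {k. lower i e k \<noteq> 0}"
proof -
  have "inj_on (deg_succ i) X" for X
    by (rule inj_onI) (metis fun_upd_idem_iff fun_upd_upd nat.inject fun_upd_same)
  moreover have "deg_succ i ` {k. lower i e k \<noteq> 0} \<subseteq> {k. e k \<noteq> 0}"
    by (auto simp: lower_def)
  ultimately show ?thesis
    using assms by (meson finite_imageD finite_subset)
qed

lemma num_poly_superset:
  assumes "finite F" "{k. e k \<noteq> 0} \<subseteq> F"
  shows "num_poly e n = (\<Sum>k\<in>F. e k * int (binom_prod n k))"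
  unfolding num_poly_def by (rule sum.mono_neutral_left) (use assms in auto)

lemma finite_supp_add:
  "finite {k. e k \<noteq> (0::int)} \<Longrightarrow> finite {k. g k \<noteq> 0} \<Longrightarrow> finite {k. e k + g k \<noteq> 0}"
  by (rule finite_subset[of _ "{k. e k \<noteq> 0} \<union> {k. g k \<noteq> 0}"]) auto

lemma finite_supp_diff:
  "finite {k. e k \<noteq> (0::int)} \<Longrightarrow> finite {k. g k \<noteq> 0} \<Longrightarrow> finite {k. e k - g k \<noteq> 0}"
  by (rule finite_subset[of _ "{k. e k \<noteq> 0} \<union> {k. g k \<noteq> 0}"]) auto

lemma num_poly_add:
  assumes "finite {k. e k \<noteq> 0}" "finite {k. g k \<noteq> 0}"
  shows "num_poly (\<lambda>k. e k + g k) n = num_poly e n + num_poly g n"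
proof -
  let ?F = "{k. e k \<noteq> 0} \<union> {k. g k \<noteq> 0}"
  have F: "finite ?F" using assms by simp
  show ?thesis
    by (subst (1 2 3) num_poly_superset[OF F]) (auto simp: distrib_right sum.distrib)
qed

lemma num_poly_diff:
  assumes "finite {k. e k \<noteq> 0}" "finite {k. g k \<noteq> 0}"
  shows "num_poly (\<lambda>k. e k - g k) n = num_poly e n - num_poly g n"
proof -
  let ?F = "{k. e k \<noteq> 0} \<union> {k. g k \<noteq> 0}"
  have F: "finite ?F" using assms by simp
  show ?thesis
    by (subst (1 2 3) num_poly_superset[OF F]) (auto simp: left_diff_distrib sum_subtractf)
qed

lemma binom_prod_backward:
  assumes "n i \<noteq> 0"
  shows "int (binom_prod n k) - int (binom_prod (deg_pred i n) k) =
    (if k i = 0 then 0 else int (binom_prod n (deg_pred i k)))"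
proof -
  define R where "R = (\<Prod>j\<in>UNIV - {i}. (n j + k j) choose k j)"
  have split: "binom_prod a b = ((a i + b i) choose b i) * (\<Prod>j\<in>UNIV - {i}. (a j + b j) choose b j)"
    for a b :: "'a \<Rightarrow> nat"
    unfolding binom_prod_def by (rule prod.remove) auto
  have 1: "binom_prod n k = ((n i + k i) choose k i) * R"
    by (simp add: split R_def)
  have 2: "binom_prod (deg_pred i n) k = ((n i - 1 + k i) choose k i) * R"
    unfolding split R_def by simp
  have 3: "binom_prod n (deg_pred i k) = ((n i + (k i - 1)) choose (k i - 1)) * R"
    unfolding split R_def by simp
  obtain a where a: "n i = Suc a" using assms not0_implies_Suc by blast
  show ?thesis
  proof (cases "k i")
    case 0
    then show ?thesis unfolding 1 2 by simp
  next
    case (Suc b)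
    have "((n i + k i) choose k i) = ((n i - 1 + k i) choose k i) + ((n i + (k i - 1)) choose (k i - 1))"
      using a Suc by simp
    then show ?thesis using Suc unfolding 1 2 3
      by (simp add: algebra_simps)
  qed
qed

text \<open>In the basis \<open>binom_prod n k\<close> the backward difference in the direction \<open>i\<close> merely shifts
  the coefficients; this is why the coefficients, and not those of the monomials, are the right
  numbers to look at.\<close>

lemma num_poly_backward:
  assumes fin: "finite {k. e k \<noteq> 0}" and n: "n i \<noteq> 0"
  shows "num_poly e n - num_poly e (deg_pred i n) = num_poly (lower i e) n"
proof -
  have "num_poly e n - num_poly e (deg_pred i n) =
      (\<Sum>k | e k \<noteq> 0. e k * (int (binom_prod n k) - int (binom_prod (deg_pred i n) k)))"
    unfolding num_poly_def by (simp add: sum_subtractf[symmetric] right_diff_distrib)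
  also have "\<dots> = (\<Sum>k | e k \<noteq> 0. if k i = 0 then 0 else e k * int (binom_prod n (deg_pred i k)))"
    by (rule sum.cong[OF refl], subst binom_prod_backward[where n=n and i=i, OF n]) simp
  also have "\<dots> = (\<Sum>k | e k \<noteq> 0 \<and> k i \<noteq> 0. e k * int (binom_prod n (deg_pred i k)))"
    by (rule sum.mono_neutral_cong_right) (use fin in auto)
  also have "\<dots> = (\<Sum>k | lower i e k \<noteq> 0. lower i e k * int (binom_prod n k))"
    by (rule sum.reindex_bij_witness[of _ "deg_succ i" "deg_pred i"])
      (auto simp: lower_def deg_succ_pred)
  finally show ?thesis by (simp add: num_poly_def)
qed

definition ev_poly :: "(('d::finite \<Rightarrow> nat) \<Rightarrow> int) \<Rightarrow> (('d \<Rightarrow> nat) \<Rightarrow> int) \<Rightarrow> bool" where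
  "ev_poly f e \<longleftrightarrow> finite {k. e k \<noteq> 0} \<and> for_all_large (\<lambda>n. f n = num_poly e n)"

lemma ev_poly_cong:
  assumes "ev_poly f e" "for_all_large (\<lambda>n. g n = f n)"
  shows "ev_poly g e"
  using assms(1) for_all_large_mono[OF for_all_large_conj[OF assms(2)], of "\<lambda>n. f n = num_poly e n"]
  unfolding ev_poly_def by auto

lemma ev_poly_add:
  assumes "ev_poly f e" "ev_poly g h"
  shows "ev_poly (\<lambda>n. f n + g n) (\<lambda>k. e k + h k)"
  unfolding ev_poly_def
proof
  show "finite {k. e k + h k \<noteq> 0}"
    using assms by (simp only: ev_poly_def finite_supp_add)
  have "for_all_large (\<lambda>n. f n = num_poly e n \<and> g n = num_poly h n)"
    using assms by (intro for_all_large_conj) (simp_all add: ev_poly_def)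
  then show "for_all_large (\<lambda>n. f n + g n = num_poly (\<lambda>k. e k + h k) n)"
    by (rule for_all_large_mono) (use assms in \<open>simp add: num_poly_add ev_poly_def\<close>)
qed

lemma ev_poly_diff:
  assumes "ev_poly f e" "ev_poly g h"
  shows "ev_poly (\<lambda>n. f n - g n) (\<lambda>k. e k - h k)"
  unfolding ev_poly_def
proof
  show "finite {k. e k - h k \<noteq> 0}"
    using assms by (simp only: ev_poly_def finite_supp_diff)
  have "for_all_large (\<lambda>n. f n = num_poly e n \<and> g n = num_poly h n)"
    using assms by (intro for_all_large_conj) (simp_all add: ev_poly_def)
  then show "for_all_large (\<lambda>n. f n - g n = num_poly (\<lambda>k. e k - h k) n)"
    by (rule for_all_large_mono) (use assms in \<open>simp add: num_poly_diff ev_poly_def\<close>)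
qed

lemma ev_poly_backward:
  assumes "ev_poly f e"
  shows "ev_poly (\<lambda>n. f n - f (deg_pred i n)) (lower i e)"
  unfolding ev_poly_def
proof
  show "finite {k. lower i e k \<noteq> 0}"
    using assms by (simp add: ev_poly_def finite_supp_lower)
  have "for_all_large (\<lambda>n. f n = num_poly e n)" using assms by (simp add: ev_poly_def)
  from for_all_large_conj[OF this for_all_large_conj[OF for_all_large_pred[OF this, of i]
        for_all_large_ge[of "\<lambda>_. 1"]]]
  show "for_all_large (\<lambda>n. f n - f (deg_pred i n) = num_poly (lower i e) n)"
  proof (rule for_all_large_mono)
    fix n assume n: "f n = num_poly e n \<and> f (deg_pred i n) = num_poly e (deg_pred i n) \<and> (\<forall>i. 1 \<le> n i)"
    then have "n i \<noteq> 0" by (metis not_one_le_zero)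
    then show "f n - f (deg_pred i n) = num_poly (lower i e) n"
      using n assms num_poly_backward[where e=e and n=n and i=i] by (simp add: ev_poly_def)
  qed
qed

lemma ev_poly_pred:
  assumes "ev_poly f e"
  shows "ev_poly (\<lambda>n. f (deg_pred i n)) (\<lambda>k. e k - lower i e k)"
  using ev_poly_diff[OF assms ev_poly_backward[OF assms, of i]] by simp

lemma ev_poly_const:
  assumes "for_all_large (\<lambda>n. f n = c)"
  shows "ev_poly f (\<lambda>k. if k = (\<lambda>_. 0) then c else 0)"
  unfolding ev_poly_def
proof
  show "finite {k::'a \<Rightarrow> nat. (if k = (\<lambda>_. 0) then c else 0) \<noteq> 0}"
    by (rule finite_subset[of _ "{\<lambda>_. 0}"]) auto
  have "num_poly (\<lambda>k. if k = (\<lambda>_. 0) then c else 0) n = c" for n :: "'a \<Rightarrow> nat"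
    by (subst num_poly_superset[of "{\<lambda>_. 0}"]) (auto simp: binom_prod_def)
  then show "for_all_large (\<lambda>n. f n = num_poly (\<lambda>k. if k = (\<lambda>_. 0) then c else 0) n)"
    using assms by simp
qed

text \<open>Taking backward differences \<open>k\<^sub>i\<close> times in each direction \<open>i\<close> turns the coefficient at a maximal \<open>k\<close> into
  the constant value of the polynomial.\<close>

lemma ev_poly_zero_top_coeff:
  assumes "ev_poly (\<lambda>_. 0) e" "\<And>h. k < h \<Longrightarrow> e h = 0"
  shows "e k = 0"
  using assms
proof (induction "\<Sum>j\<in>UNIV. k j" arbitrary: e k)
  case 0
  then have k: "k = (\<lambda>_. 0)" by auto
  have "e h = 0" if "h \<noteq> k" for h
    using that "0.prems"(2) unfolding k by (simp add: less_fun_def le_fun_def fun_eq_iff)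
  then have "{h. e h \<noteq> 0} \<subseteq> {k}" by auto
  then have "num_poly e n = e k" for n
    by (subst num_poly_superset[of "{k}"]) (auto simp: k binom_prod_def)
  then show ?case
    using "0.prems"(1) for_all_large_sample[of "\<lambda>n::'a \<Rightarrow> nat. 0 = num_poly e n"]
    unfolding ev_poly_def by metis
next
  case (Suc m)
  then obtain i where i: "k i \<noteq> 0"
    by (metis (mono_tags, lifting) nat.distinct(1) sum.neutral)
  have "ev_poly (\<lambda>_. 0) (lower i e)"
    using ev_poly_backward[OF Suc.prems(1), of i] by simp
  moreover have "lower i e h = 0" if "deg_pred i k < h" for h
  proof -
    have "k < deg_succ i h"
      using that i by (auto simp: less_fun_def le_fun_def split: if_splits)
    then show ?thesis using Suc.prems(2) by (simp add: lower_def)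
  qed
  moreover have "m = (\<Sum>j\<in>UNIV. deg_pred i k j)"
    using Suc.hyps(2) sum_deg_succ[where i=i and n="deg_pred i k"]
    by (simp only: deg_succ_pred[where n=k and i=i, OF i] nat.inject)
  ultimately have "lower i e (deg_pred i k) = 0"
    using Suc.hyps(1) by blast
  then show ?case using deg_succ_pred[where n=k and i=i, OF i] by (simp add: lower_def)
qed

lemma sum_deg_strict_mono: "k < h \<Longrightarrow> (\<Sum>j\<in>UNIV. k j) < (\<Sum>j\<in>UNIV. h j)"
  for k :: "'d::finite \<Rightarrow> nat"
  by (rule sum_strict_mono_ex1) (auto simp: less_fun_def le_fun_def not_le)

lemma ev_poly_zero:
  assumes "ev_poly (\<lambda>_. 0) e"
  shows "e = (\<lambda>_. 0)"
proof (rule ccontr)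
  assume "e \<noteq> (\<lambda>_. 0)"
  then have ne: "{k. e k \<noteq> 0} \<noteq> {}" by auto
  have fin: "finite {k. e k \<noteq> 0}" using assms by (simp add: ev_poly_def)
  obtain k where k: "e k \<noteq> 0" "\<And>h. e h \<noteq> 0 \<Longrightarrow> (\<Sum>j\<in>UNIV. h j) \<le> (\<Sum>j\<in>UNIV. k j)"
  proof -
    have "Max ((\<lambda>h. \<Sum>j\<in>UNIV. h j) ` {k. e k \<noteq> 0}) \<in> (\<lambda>h. \<Sum>j\<in>UNIV. h j) ` {k. e k \<noteq> 0}"
      using fin ne by (intro Max_in) auto
    then obtain k where "e k \<noteq> 0" "(\<Sum>j\<in>UNIV. k j) = Max ((\<lambda>h. \<Sum>j\<in>UNIV. h j) ` {k. e k \<noteq> 0})"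
      by auto
    then show ?thesis using that fin by (metis (mono_tags, lifting) Max_ge finite_imageI imageI mem_Collect_eq)
  qed
  have "e h = 0" if "k < h" for h
    using k(2)[of h] sum_deg_strict_mono[OF that] by auto
  then show False using ev_poly_zero_top_coeff[OF assms] k(1) by blast
qed

lemma ev_poly_unique:
  assumes "ev_poly f e" "ev_poly f g"
  shows "e = g"
proof -
  have "(\<lambda>k. e k - g k) = (\<lambda>_. 0)"
    using ev_poly_zero ev_poly_diff[OF assms] by simp
  then show ?thesis by (simp add: fun_eq_iff)
qed

text \<open>Lowering the coordinates one by one leads from any large degree to the corner \<open>(N, \<dots>, N)\<close>.\<close>

lemma for_all_large_constant:
  fixes f :: "('d::finite \<Rightarrow> nat) \<Rightarrow> int"
  assumes "\<And>i. for_all_large (\<lambda>n. f n = f (deg_pred i n))"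
  obtains c where "for_all_large (\<lambda>n. f n = c)"
proof -
  have "for_all_large (\<lambda>n. \<forall>i. f n = f (deg_pred i n))"
    using assms by (rule for_all_large_all)
  then obtain N where N: "\<And>n i. (\<forall>j. N \<le> n j) \<Longrightarrow> f n = f (deg_pred i n)"
    unfolding for_all_large_def by metis
  have "f n = f (\<lambda>_. N)" if "\<forall>j. N \<le> n j" for n
    using that
  proof (induction "\<Sum>j\<in>UNIV. n j" arbitrary: n rule: less_induct)
    case less
    show ?case
    proof (cases "n = (\<lambda>_. N)")
      case False
      then obtain i where "N \<noteq> n i" by fastforce
      with less.prems have i: "N < n i" by (simp add: le_neq_implies_less)
      have "deg_pred i n < n" using i by (auto simp: less_fun_def le_fun_def)
      moreover have "\<forall>j. N \<le> deg_pred i n j" using less.prems i by auto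
      ultimately have "f (deg_pred i n) = f (\<lambda>_. N)"
        using less.hyps sum_deg_strict_mono by blast
      then show ?thesis using N[OF less.prems, of i] by simp
    qed simp
  qed
  then have "for_all_large (\<lambda>n. f n = f (\<lambda>_. N))"
    unfolding for_all_large_def by blast
  then show thesis by (rule that)
qed

text \<open>The coefficients of the differences fit together, because backward differences in two directions
  commute and the coefficients of a polynomial are unique.  What they leave undetermined is
  an additive constant.\<close>

lemma ev_poly_integrate:
  fixes f :: "('d::finite \<Rightarrow> nat) \<Rightarrow> int"
  assumes "\<And>i. \<exists>g. ev_poly (\<lambda>n. f n - f (deg_pred i n)) g"
  shows "\<exists>e. ev_poly f e"
proof -
  define g where "g i = (SOME e. ev_poly (\<lambda>n. f n - f (deg_pred i n)) e)" for i
  have g: "ev_poly (\<lambda>n. f n - f (deg_pred i n)) (g i)" for i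
    unfolding g_def using assms[of i] by (rule someI_ex)
  have compat: "lower j (g i) = lower i (g j)" for i j
  proof (cases "i = j")
    case False
    then have "deg_pred i (deg_pred j n) = deg_pred j (deg_pred i n)" for n :: "'d \<Rightarrow> nat"
      by (auto simp: fun_eq_iff)
    then have "(f n - f (deg_pred j n)) - (f (deg_pred i n) - f (deg_pred j (deg_pred i n))) =
        (f n - f (deg_pred i n)) - (f (deg_pred j n) - f (deg_pred i (deg_pred j n)))" for n
      by simp
    with ev_poly_backward[OF g[of j], of i]
    have "ev_poly (\<lambda>n. (f n - f (deg_pred i n)) - (f (deg_pred j n) - f (deg_pred i (deg_pred j n))))
        (lower i (g j))"
      by (simp only:)
    with ev_poly_backward[OF g[of i], of j] show ?thesis by (rule ev_poly_unique)
  qed simp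
  \<comment> \<open>A coefficient \<open>e k\<close> with \<open>k i \<noteq> 0\<close> must be that of the difference in the direction \<open>i\<close>; by \<open>compat\<close> the
    choice of \<open>i\<close> does not matter.\<close>
  define e where "e k = (if k = (\<lambda>_. 0) then 0 else let i = (SOME i. k i \<noteq> 0) in g i (deg_pred i k))" for k
  have e: "lower i e = g i" for i
  proof
    fix h
    define j where "j = (SOME j. deg_succ i h j \<noteq> 0)"
    have "deg_succ i h i \<noteq> 0" by simp
    then have j: "deg_succ i h j \<noteq> 0" unfolding j_def by (rule someI)
    have "lower i e h = g j (deg_pred j (deg_succ i h))"
      unfolding lower_def e_def j_def Let_def by (auto simp: fun_eq_iff)
    also have "\<dots> = g i h"
    proof (cases "i = j")
      case False
      with j have hj: "h j \<noteq> 0" by simp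
      have "deg_pred j (deg_succ i h) = deg_succ i (deg_pred j h)"
        using False by (auto simp: fun_eq_iff)
      then have "g j (deg_pred j (deg_succ i h)) = lower j (g i) (deg_pred j h)"
        using compat[of j i] by (simp add: lower_def)
      then show ?thesis using deg_succ_pred[where n=h and i=j, OF hj] by (simp add: lower_def)
    qed simp
    finally show "lower i e h = g i h" .
  qed
  have fin: "finite {k. e k \<noteq> 0}"
  proof (rule finite_subset)
    show "{k. e k \<noteq> 0} \<subseteq> (\<Union>i. deg_succ i ` {k. g i k \<noteq> 0})"
    proof
      fix k assume k: "k \<in> {k. e k \<noteq> 0}"
      then have "k \<noteq> (\<lambda>_. 0)" by (auto simp: e_def)
      then obtain i where i: "k i \<noteq> 0" by (auto simp: fun_eq_iff)
      have "e k = g i (deg_pred i k)"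
        using e[of i] deg_succ_pred[of k i, OF i] unfolding lower_def by metis
      then show "k \<in> (\<Union>i. deg_succ i ` {k. g i k \<noteq> 0})"
        using k deg_succ_pred[of k i, OF i] by (metis (mono_tags, lifting) UN_I UNIV_I image_eqI mem_Collect_eq)
    qed
    show "finite (\<Union>i. deg_succ i ` {k. g i k \<noteq> 0})"
      using g by (auto simp: ev_poly_def)
  qed
  define r where "r n = f n - num_poly e n" for n
  have "for_all_large (\<lambda>n. r n = r (deg_pred i n))" for i
  proof -
    have "for_all_large (\<lambda>n. f n - f (deg_pred i n) = num_poly (g i) n)"
      using g[of i] by (simp add: ev_poly_def)
    from for_all_large_conj[OF this for_all_large_ge[of "\<lambda>_. 1"]]
    show ?thesis
    proof (rule for_all_large_mono)
      fix n assume n: "f n - f (deg_pred i n) = num_poly (g i) n \<and> (\<forall>i. 1 \<le> n i)"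
      then have "n i \<noteq> 0" by (metis not_one_le_zero)
      from num_poly_backward[where e=e and n=n and i=i, OF fin this] n e[of i] show "r n = r (deg_pred i n)"
        by (simp add: r_def)
    qed
  qed
  then obtain c where "for_all_large (\<lambda>n. r n = c)" using for_all_large_constant by blast
  from ev_poly_const[OF this] have r: "ev_poly r (\<lambda>k. if k = (\<lambda>_. 0) then c else 0)" .
  have "ev_poly (num_poly e) e" using fin by (simp add: ev_poly_def for_all_large_True)
  from ev_poly_add[OF r this] show ?thesis by (auto simp: r_def)
qed


section \<open>Abelian groups with operators and their lengths\<close>

lemma chain_lengths_mono: "X \<subseteq> Y \<Longrightarrow> chain_lengths X \<subseteq> chain_lengths Y"
  unfolding chain_lengths_def by blast

lemma chain_lengthsE:
  assumes "n \<in> chain_lengths X"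
  obtains C where "\<forall>i\<le>n. C i \<in> X" "\<forall>i<n. C i \<subset> C (Suc i)"
  using assms unfolding chain_lengths_def by auto

lemma chain_lengths_image_subset:
  assumes "\<And>W. W \<in> X \<Longrightarrow> \<phi> W \<in> Y" "\<And>V W. V \<in> X \<Longrightarrow> W \<in> X \<Longrightarrow> V \<subset> W \<Longrightarrow> \<phi> V \<subset> \<phi> W"
  shows "chain_lengths X \<subseteq> chain_lengths Y"
proof
  fix n assume "n \<in> chain_lengths X"
  then obtain C where C: "\<forall>i\<le>n. C i \<in> X" "\<forall>i<n. C i \<subset> C (Suc i)"
    unfolding chain_lengths_def by blast
  have "\<forall>i\<le>n. \<phi> (C i) \<in> Y" using C(1) assms(1) by blast
  moreover have "\<forall>i<n. \<phi> (C i) \<subset> \<phi> (C (Suc i))"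
  proof (intro allI impI)
    fix i assume "i < n"
    then show "\<phi> (C i) \<subset> \<phi> (C (Suc i))" using C assms(2)[of "C i" "C (Suc i)"] by simp
  qed
  ultimately show "n \<in> chain_lengths Y"
    unfolding chain_lengths_def by (intro CollectI exI[of _ "\<lambda>i. \<phi> (C i)"]) blast
qed

text \<open>Submodules over \<open>A\<close>, submodules over \<open>S\<close> and ideals are all subgroups stable under a set of additive
  maps.  Treating them in this generality gives one notion of length and one chain condition for all of them, and allows
  operators to be adjoined one at a time.\<close>

locale op_group = abelian_group G for G (structure) +
  fixes \<Theta> :: "('a \<Rightarrow> 'a) set"
  assumes op_closed: "\<theta> \<in> \<Theta> \<Longrightarrow> x \<in> carrier G \<Longrightarrow> \<theta> x \<in> carrier G"
    and op_add: "\<theta> \<in> \<Theta> \<Longrightarrow> x \<in> carrier G \<Longrightarrow> y \<in> carrier G \<Longrightarrow> \<theta> (x \<oplus> y) = \<theta> x \<oplus> \<theta> y"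
begin

definition opsub :: "'a set \<Rightarrow> bool" where
  "opsub U \<longleftrightarrow> U \<subseteq> carrier G \<and> \<zero> \<in> U \<and> (\<forall>x\<in>U. \<forall>y\<in>U. x \<oplus> y \<in> U) \<and> (\<forall>x\<in>U. \<ominus> x \<in> U) \<and>
     (\<forall>\<theta>\<in>\<Theta>. \<forall>x\<in>U. \<theta> x \<in> U)"

lemma opsubI:
  assumes "U \<subseteq> carrier G" "\<zero> \<in> U" "\<And>x y. x \<in> U \<Longrightarrow> y \<in> U \<Longrightarrow> x \<oplus> y \<in> U"
    "\<And>x. x \<in> U \<Longrightarrow> \<ominus> x \<in> U" "\<And>\<theta> x. \<theta> \<in> \<Theta> \<Longrightarrow> x \<in> U \<Longrightarrow> \<theta> x \<in> U"
  shows "opsub U"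
  using assms unfolding opsub_def by blast

lemma opsubD:
  assumes "opsub U"
  shows "x \<in> U \<Longrightarrow> x \<in> carrier G" "\<zero> \<in> U" "x \<in> U \<Longrightarrow> y \<in> U \<Longrightarrow> x \<oplus> y \<in> U"
    "x \<in> U \<Longrightarrow> \<ominus> x \<in> U" "\<theta> \<in> \<Theta> \<Longrightarrow> x \<in> U \<Longrightarrow> \<theta> x \<in> U"
    "x \<in> U \<Longrightarrow> y \<in> U \<Longrightarrow> x \<ominus> y \<in> U"
  using assms unfolding opsub_def minus_eq by blast+

lemma op_zero: "\<theta> \<in> \<Theta> \<Longrightarrow> \<theta> \<zero> = \<zero>"
  by (metis add.r_cancel_one' op_add op_closed r_zero zero_closed)

lemma opsub_carrier: "opsub (carrier G)"
  by (rule opsubI) (auto simp: op_closed)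

lemma opsub_zero: "opsub {\<zero>}"
  by (rule opsubI) (auto simp: op_zero)

lemma opsub_Int: "opsub U \<Longrightarrow> opsub V \<Longrightarrow> opsub (U \<inter> V)"
  unfolding opsub_def by blast

definition ssum :: "'a set \<Rightarrow> 'a set \<Rightarrow> 'a set" where
  "ssum U V = {u \<oplus> v | u v. u \<in> U \<and> v \<in> V}"

lemma ssumI: "u \<in> U \<Longrightarrow> v \<in> V \<Longrightarrow> u \<oplus> v \<in> ssum U V"
  unfolding ssum_def by blast

lemma opsub_ssum:
  assumes "opsub U" "opsub V"
  shows "opsub (ssum U V)"
proof (rule opsubI)
  note U = opsubD[OF assms(1)] and V = opsubD[OF assms(2)]
  show "ssum U V \<subseteq> carrier G" using U(1) V(1) by (auto simp: ssum_def)
  show "\<zero> \<in> ssum U V" using ssumI[OF U(2) V(2)] by simp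
  fix x assume "x \<in> ssum U V"
  then obtain u v where x: "u \<in> U" "v \<in> V" "x = u \<oplus> v" by (auto simp: ssum_def)
  show "\<ominus> x \<in> ssum U V"
    using ssumI[OF U(4)[OF x(1)] V(4)[OF x(2)]] x U(1) V(1) by (simp add: minus_add)
  show "\<theta> x \<in> ssum U V" if "\<theta> \<in> \<Theta>" for \<theta>
    using ssumI[OF U(5)[OF that x(1)] V(5)[OF that x(2)]] x U(1) V(1) that by (simp add: op_add)
  fix y assume "y \<in> ssum U V"
  then obtain u' v' where y: "u' \<in> U" "v' \<in> V" "y = u' \<oplus> v'" by (auto simp: ssum_def)
  have "x \<oplus> y = (u \<oplus> u') \<oplus> (v \<oplus> v')"
    using x y U(1) V(1) by (simp add: a_ac)
  then show "x \<oplus> y \<in> ssum U V"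
    using ssumI[OF U(3)[OF x(1) y(1)] V(3)[OF x(2) y(2)]] by simp
qed

lemma ssum_upper1: "opsub U \<Longrightarrow> opsub V \<Longrightarrow> U \<subseteq> ssum U V"
  using ssumI[of _ U \<zero> V] opsubD(1,2) by fastforce

lemma ssum_upper2: "opsub U \<Longrightarrow> opsub V \<Longrightarrow> V \<subseteq> ssum U V"
  using ssumI[of \<zero> U _ V] opsubD(1,2) by fastforce

lemma ssum_least: "opsub W \<Longrightarrow> U \<subseteq> W \<Longrightarrow> V \<subseteq> W \<Longrightarrow> ssum U V \<subseteq> W"
  unfolding ssum_def using opsubD(3)[of W] by blast

text \<open>The modular law, in the form in which it detects strict inclusions.\<close>

lemma opsub_modular:
  assumes "opsub X" "opsub Y" "opsub V" "X \<subseteq> Y" "X \<inter> V = Y \<inter> V" "ssum X V = ssum Y V"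
  shows "X = Y"
proof
  show "Y \<subseteq> X"
  proof
    fix y assume y: "y \<in> Y"
    then have "y \<in> ssum X V"
      using ssum_upper1[OF assms(2,3)] assms(6) by blast
    then obtain x v where xv: "x \<in> X" "v \<in> V" "y = x \<oplus> v" by (auto simp: ssum_def)
    have c: "x \<in> carrier G" "v \<in> carrier G" using xv opsubD(1) assms(1,3) by blast+
    have "v = y \<ominus> x" using xv c by (simp add: minus_eq a_ac r_neg)
    then have "v \<in> Y" using opsubD(6)[OF assms(2) y] xv(1) assms(4) by blast
    then have "v \<in> X" using xv(2) assms(5) by blast
    then show "y \<in> X" using opsubD(3)[OF assms(1)] xv by blast
  qed
qed (rule assms(4))

definition ival :: "'a set \<Rightarrow> 'a set \<Rightarrow> 'a set set" where
  "ival U V = {W. opsub W \<and> U \<subseteq> W \<and> W \<subseteq> V}"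

definition len :: "'a set \<Rightarrow> 'a set \<Rightarrow> enat" where
  "len U V = (SUP n\<in>chain_lengths (ival U V). enat n)"

lemma chain_le_len: "n \<in> chain_lengths (ival U V) \<Longrightarrow> enat n \<le> len U V"
  unfolding len_def by (rule SUP_upper)

lemma len_mono:
  assumes "chain_lengths (ival U V) \<subseteq> chain_lengths (ival U' V')"
  shows "len U V \<le> len U' V'"
  unfolding len_def using assms by (rule SUP_subset_mono) simp

lemma len_chain:
  assumes "opsub U" "U \<subseteq> V" "enat m \<le> len U V"
  shows "m \<in> chain_lengths (ival U V)"
proof -
  have down: "m \<in> chain_lengths X" if le: "n \<in> chain_lengths X" "m \<le> n" for m n and X :: "'a set set"
  proof -
    obtain C where "\<forall>i\<le>n. C i \<in> X" "\<forall>i<n. C i \<subset> C (Suc i)"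
      using le(1) by (rule chain_lengthsE)
    with le(2) have "\<forall>i\<le>m. C i \<in> X" "\<forall>i<m. C i \<subset> C (Suc i)" by auto
    then show ?thesis unfolding chain_lengths_def by blast
  qed
  show ?thesis
  proof (rule ccontr)
    assume *: "m \<notin> chain_lengths (ival U V)"
    then have lt: "n < m" if "n \<in> chain_lengths (ival U V)" for n
      using down[OF that, of m] by (meson not_less)
    have "0 \<in> chain_lengths (ival U V)"
      using assms unfolding chain_lengths_def ival_def by auto
    then have m: "0 < m" using lt by blast
    have "len U V \<le> enat (m - 1)"
      unfolding len_def proof (rule SUP_least)
      fix n assume "n \<in> chain_lengths (ival U V)"
      from lt[OF this] show "enat n \<le> enat (m - 1)" by simp
    qed
    with assms(3) have "enat m \<le> enat (m - 1)" by (rule order_trans)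
    then show False using m by simp
  qed
qed

text \<open>Intersecting a chain with a subgroup, or adding a subgroup to it, may produce repetitions, so chains with
  repetitions have to be counted too.\<close>

lemma strict_steps_le_len:
  assumes "\<forall>i\<le>n. D i \<in> ival U V" "\<forall>i<n. D i \<subseteq> D (Suc i)"
  shows "enat (card {i. i < n \<and> D i \<noteq> D (Suc i)}) \<le> len U V"
proof -
  have "card {i. i < n \<and> D i \<noteq> D (Suc i)} \<in> chain_lengths (ival U (D n))"
    using assms
  proof (induction n)
    case 0
    then have "D 0 \<in> ival U (D 0)" by (auto simp: ival_def)
    then show ?case unfolding chain_lengths_def by auto
  next
    case (Suc n)
    let ?S = "\<lambda>n. {i. i < n \<and> D i \<noteq> D (Suc i)}"
    have IH: "card (?S n) \<in> chain_lengths (ival U (D n))" using Suc by auto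
    have sub: "D n \<subseteq> D (Suc n)" using Suc.prems by auto
    have fin: "finite (?S n)" by auto
    show ?case
    proof (cases "D n = D (Suc n)")
      case True
      then have "?S (Suc n) = ?S n" using less_Suc_eq by auto
      then show ?thesis using IH True by simp
    next
      case False
      then have "?S (Suc n) = insert n (?S n)" using less_Suc_eq by auto
      then have c: "card (?S (Suc n)) = Suc (card (?S n))" using fin by simp
      obtain C where C: "\<forall>i\<le>card (?S n). C i \<in> ival U (D n)" "\<forall>i<card (?S n). C i \<subset> C (Suc i)"
        using IH unfolding chain_lengths_def by blast
      define C' where "C' i = (if i \<le> card (?S n) then C i else D (Suc n))" for i
      have "D (Suc n) \<in> ival U (D (Suc n))" using Suc.prems(1) by (auto simp: ival_def)
      moreover have "ival U (D n) \<subseteq> ival U (D (Suc n))" using sub by (auto simp: ival_def)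
      ultimately have "\<forall>i\<le>Suc (card (?S n)). C' i \<in> ival U (D (Suc n))"
        using C(1) by (auto simp: C'_def)
      moreover have "\<forall>i<Suc (card (?S n)). C' i \<subset> C' (Suc i)"
      proof (intro allI impI)
        fix i assume i: "i < Suc (card (?S n))"
        show "C' i \<subset> C' (Suc i)"
        proof (cases "i = card (?S n)")
          case True
          have "C i \<subseteq> D n" using C(1) True by (auto simp: ival_def)
          then show ?thesis using True sub False by (auto simp: C'_def)
        next
          case False
          then show ?thesis using C(2) i by (auto simp: C'_def)
        qed
      qed
      ultimately show ?thesis unfolding c chain_lengths_def by blast
    qed
  qed
  moreover have "ival U (D n) \<subseteq> ival U V"
    using assms(1)[rule_format, of n] by (auto simp: ival_def)
  ultimately show ?thesis
    using chain_le_len chain_lengths_mono by blast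
qed

text \<open>Chains in the two parts can be concatenated.  Conversely, by the modular law, every strict step of a chain from \<open>U\<close> to \<open>W\<close> remains
  strict after intersecting with \<open>V\<close> or after adding \<open>V\<close>.\<close>

lemma len_additive:
  assumes U: "opsub U" and V: "opsub V" and W: "opsub W" and UV: "U \<subseteq> V" and VW: "V \<subseteq> W"
  shows "len U W = len U V + len V W"
proof (rule antisym)
  show "len U W \<le> len U V + len V W"
    unfolding len_def[of U W]
  proof (rule SUP_least)
    fix n assume "n \<in> chain_lengths (ival U W)"
    then obtain C where C: "\<forall>i\<le>n. C i \<in> ival U W" "\<forall>i<n. C i \<subset> C (Suc i)"
      unfolding chain_lengths_def by blast
    let ?D = "\<lambda>i. C i \<inter> V" and ?E = "\<lambda>i. ssum (C i) V"
    have D: "\<forall>i\<le>n. ?D i \<in> ival U V" "\<forall>i<n. ?D i \<subseteq> ?D (Suc i)"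
      using C V UV by (auto simp: ival_def opsub_Int)
    have E1: "\<forall>i\<le>n. ?E i \<in> ival V W"
      using C(1) V VW ssum_upper2 ssum_least[OF W] by (auto simp: ival_def opsub_ssum)
    have E2: "\<forall>i<n. ?E i \<subseteq> ?E (Suc i)"
      using C(2) by (auto simp: ssum_def)
    have "{i. i < n} \<subseteq> {i. i < n \<and> ?D i \<noteq> ?D (Suc i)} \<union> {i. i < n \<and> ?E i \<noteq> ?E (Suc i)}"
      using opsub_modular[OF _ _ V] C by (auto simp: ival_def)
        (metis less_imp_le_nat less_irrefl psubset_imp_subset Suc_leI)
    then have "card {i. i < n} \<le> card ({i. i < n \<and> ?D i \<noteq> ?D (Suc i)} \<union> {i. i < n \<and> ?E i \<noteq> ?E (Suc i)})"
      by (intro card_mono) auto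
    also have "\<dots> \<le> card {i. i < n \<and> ?D i \<noteq> ?D (Suc i)} + card {i. i < n \<and> ?E i \<noteq> ?E (Suc i)}"
      by (rule card_Un_le)
    finally have "enat n \<le> enat (card {i. i < n \<and> ?D i \<noteq> ?D (Suc i)}) + enat (card {i. i < n \<and> ?E i \<noteq> ?E (Suc i)})"
      by simp
    also have "\<dots> \<le> len U V + len V W"
      by (intro add_mono strict_steps_le_len D E1 E2)
    finally show "enat n \<le> len U V + len V W" .
  qed
next
  have conc: "m + n \<in> chain_lengths (ival U W)"
    if m: "m \<in> chain_lengths (ival U V)" and n: "n \<in> chain_lengths (ival V W)" for m n
  proof -
    obtain C where C: "\<forall>i\<le>m. C i \<in> ival U V" "\<forall>i<m. C i \<subset> C (Suc i)"
      using m unfolding chain_lengths_def by blast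
    obtain D where D: "\<forall>i\<le>n. D i \<in> ival V W" "\<forall>i<n. D i \<subset> D (Suc i)"
      using n unfolding chain_lengths_def by blast
    define E where "E i = (if i < m then C i else D (i - m))" for i
    have "ival U V \<subseteq> ival U W" "ival V W \<subseteq> ival U W" using UV VW by (auto simp: ival_def)
    then have "\<forall>i\<le>m+n. E i \<in> ival U W"
      using C(1) D(1) by (auto simp: E_def subset_iff)
    moreover have "\<forall>i<m+n. E i \<subset> E (Suc i)"
    proof (intro allI impI)
      fix i assume i: "i < m + n"
      consider "Suc i < m" | "Suc i = m" | "m \<le> i" by linarith
      then show "E i \<subset> E (Suc i)"
      proof cases
        case 2
        have "C i \<subset> C m" using C(2) 2 by auto
        moreover have "C m \<subseteq> V" "V \<subseteq> D 0" using C(1) D(1) by (auto simp: ival_def)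
        ultimately show ?thesis using 2 by (auto simp: E_def)
      next
        case 3
        then show ?thesis using D(2) i by (auto simp: E_def Suc_diff_le)
      qed (use C(2) in \<open>auto simp: E_def\<close>)
    qed
    ultimately show ?thesis unfolding chain_lengths_def by blast
  qed
  show "len U V + len V W \<le> len U W"
  proof (cases "len U V = \<infinity> \<or> len V W = \<infinity>")
    case True
    have "enat k \<le> len U W" for k
    proof -
      have 0: "0 \<in> chain_lengths (ival U V)" "0 \<in> chain_lengths (ival V W)"
        using U V UV VW unfolding chain_lengths_def ival_def by auto
      from True have "k \<in> chain_lengths (ival U V) \<or> k \<in> chain_lengths (ival V W)"
        using len_chain[OF U UV, of k] len_chain[OF V VW, of k] by auto
      then have "k \<in> chain_lengths (ival U W)"
        using conc[OF _ 0(2), of k] conc[OF 0(1), of k] by auto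
      then show ?thesis by (rule chain_le_len)
    qed
    then have "len U W = \<infinity>" by (metis enat_ile enat_ord_simps(1) not_enat_eq not_less_eq_eq order_refl)
    then show ?thesis by simp
  next
    case False
    then obtain a b where ab: "len U V = enat a" "len V W = enat b" by auto
    have "a + b \<in> chain_lengths (ival U W)"
      using len_chain[OF U UV, of a] len_chain[OF V VW, of b] ab by (intro conc) auto
    then show ?thesis using chain_le_len ab by fastforce
  qed
qed

lemma len_self: "len U U = 0"
proof -
  have "n = 0" if n: "n \<in> chain_lengths (ival U U)" for n
  proof (rule ccontr)
    assume "n \<noteq> 0"
    then have "0 < n" by simp
    obtain C where C: "\<forall>i\<le>n. C i \<in> ival U U" "\<forall>i<n. C i \<subset> C (Suc i)"
      using n by (rule chain_lengthsE)
    have "C 0 \<in> ival U U" "C (Suc 0) \<in> ival U U" using C(1) \<open>0 < n\<close> by auto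
    moreover have "C 0 \<subset> C (Suc 0)" using C(2) \<open>0 < n\<close> by blast
    ultimately show False by (auto simp: ival_def)
  qed
  then have "len U U \<le> 0" unfolding len_def by (intro SUP_least) (auto simp: zero_enat_def)
  then show ?thesis by simp
qed

lemma len_eq_0:
  assumes "opsub U" "opsub V" "U \<subseteq> V" "len U V = 0"
  shows "U = V"
proof (rule ccontr)
  assume "U \<noteq> V"
  then have "1 \<in> chain_lengths (ival U V)"
    using assms unfolding chain_lengths_def ival_def
    by (intro CollectI exI[of _ "\<lambda>i. if i = 0 then U else V"]) auto
  then show False using chain_le_len[of 1 U V] assms(4) by (simp add: zero_enat_def)
qed

text \<open>The isomorphism \<open>V / (V \<inter> f\<^sup>-\<^sup>1 U) \<cong> (U + f V) / U\<close> induced by an operator homomorphism \<open>f\<close>.\<close>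

lemma len_image:
  assumes U: "opsub U" and V: "opsub V"
    and fc: "\<And>x. x \<in> V \<Longrightarrow> f x \<in> carrier G"
    and fa: "\<And>x y. x \<in> V \<Longrightarrow> y \<in> V \<Longrightarrow> f (x \<oplus> y) = f x \<oplus> f y"
    and fo: "\<And>\<theta> x. \<theta> \<in> \<Theta> \<Longrightarrow> x \<in> V \<Longrightarrow> f (\<theta> x) = \<theta> (f x)"
  shows "opsub {x \<in> V. f x \<in> U}" "opsub (ssum U (f ` V))"
    "len {x \<in> V. f x \<in> U} V = len U (ssum U (f ` V))"
proof -
  have f0: "f \<zero> = \<zero>"
    using fa[of \<zero> \<zero>] fc[of \<zero>] opsubD(2)[OF V] by (metis add.r_cancel_one' r_zero zero_closed)
  have fm: "f (\<ominus> x) = \<ominus> f x" if "x \<in> V" for x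
  proof -
    have "f (\<ominus> x) \<oplus> f x = \<zero>"
      using fa[of "\<ominus> x" x] opsubD(1,4)[OF V that] that f0 by (simp add: l_neg)
    then show ?thesis
      using fc[OF that] fc[OF opsubD(4)[OF V that]] by (simp add: minus_equality)
  qed
  have pre: "opsub {x \<in> V. f x \<in> W}" if W: "opsub W" for W
    using opsubD[OF W] opsubD[OF V] f0 fm fa fo by (intro opsubI) auto
  have im: "opsub (f ` W)" if W: "opsub W" "W \<subseteq> V" for W
  proof (rule opsubI)
    show "\<zero> \<in> f ` W" using f0 opsubD(2)[OF W(1)] by (metis imageI)
    fix x assume "x \<in> f ` W"
    then obtain u where u: "u \<in> W" "x = f u" by blast
    show "\<ominus> x \<in> f ` W" using fm[of u] u W opsubD(4)[OF W(1)] by (metis image_eqI subsetD)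
    show "\<theta> x \<in> f ` W" if "\<theta> \<in> \<Theta>" for \<theta>
      using fo[of \<theta> u] u W opsubD(5)[OF W(1)] that by (metis image_eqI subsetD)
    fix y assume "y \<in> f ` W"
    then obtain v where v: "v \<in> W" "y = f v" by blast
    show "x \<oplus> y \<in> f ` W"
      using fa[of u v] u v W opsubD(3)[OF W(1)] by (metis image_eqI subsetD)
  qed (use W fc in auto)
  show K: "opsub {x \<in> V. f x \<in> U}" by (rule pre[OF U])
  have imV: "opsub (f ` V)" by (rule im[OF V]) simp
  show "opsub (ssum U (f ` V))" by (rule opsub_ssum[OF U imV])
  show "len {x \<in> V. f x \<in> U} V = len U (ssum U (f ` V))"
  proof (rule antisym)
    show "len {x \<in> V. f x \<in> U} V \<le> len U (ssum U (f ` V))"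
    proof (rule len_mono, rule chain_lengths_image_subset[where \<phi> = "\<lambda>W. ssum U (f ` W)"])
      fix W assume W: "W \<in> ival {x \<in> V. f x \<in> U} V"
      then have W': "opsub W" "W \<subseteq> V" by (auto simp: ival_def)
      have "ssum U (f ` W) \<subseteq> ssum U (f ` V)" using W'(2) by (auto simp: ssum_def)
      then show "ssum U (f ` W) \<in> ival U (ssum U (f ` V))"
        using ssum_upper1[OF U im[OF W']] opsub_ssum[OF U im[OF W']] by (auto simp: ival_def)
    next
      fix X Y assume X: "X \<in> ival {x \<in> V. f x \<in> U} V" and Y: "Y \<in> ival {x \<in> V. f x \<in> U} V" and XY: "X \<subset> Y"
      have "ssum U (f ` X) \<subseteq> ssum U (f ` Y)" using XY by (auto simp: ssum_def)
      moreover have "Y \<subseteq> X" if eq: "ssum U (f ` X) = ssum U (f ` Y)"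
      proof
        fix y assume y: "y \<in> Y"
        have "f y \<in> ssum U (f ` X)"
          using ssum_upper2[OF U im] Y y unfolding eq by (auto simp: ival_def)
        then obtain u x where ux: "u \<in> U" "x \<in> X" "f y = u \<oplus> f x"
          by (auto simp: ssum_def)
        have xV: "x \<in> V" "y \<in> V" using X Y ux(2) y by (auto simp: ival_def)
        have "y \<ominus> x \<in> V" using opsubD(6)[OF V xV(2,1)] .
        moreover have "f (y \<ominus> x) = u"
          using fa[OF xV(2) opsubD(4)[OF V xV(1)]] fm[OF xV(1)] ux fc[OF xV(1)] opsubD(1)[OF U ux(1)]
          by (simp add: minus_eq a_assoc r_neg)
        ultimately have "y \<ominus> x \<in> X" using X ux(1) by (auto simp: ival_def)
        then have "y \<ominus> x \<oplus> x \<in> X" using X ux(2) opsubD(3) by (auto simp: ival_def)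
        moreover have "y \<ominus> x \<oplus> x = y"
          using xV opsubD(1)[OF V] by (simp add: minus_eq a_assoc l_neg)
        ultimately show "y \<in> X" by simp
      qed
      ultimately show "ssum U (f ` X) \<subset> ssum U (f ` Y)" using XY by blast
    qed
    show "len U (ssum U (f ` V)) \<le> len {x \<in> V. f x \<in> U} V"
    proof (rule len_mono, rule chain_lengths_image_subset[where \<phi> = "\<lambda>W. {x \<in> V. f x \<in> W}"])
      fix W assume "W \<in> ival U (ssum U (f ` V))"
      then show "{x \<in> V. f x \<in> W} \<in> ival {x \<in> V. f x \<in> U} V"
        using pre by (auto simp: ival_def)
    next
      fix X Y assume X: "X \<in> ival U (ssum U (f ` V))" and Y: "Y \<in> ival U (ssum U (f ` V))" and XY: "X \<subset> Y"
      have "Y \<subseteq> X" if eq: "{x \<in> V. f x \<in> X} = {x \<in> V. f x \<in> Y}"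
      proof
        fix y assume y: "y \<in> Y"
        then obtain u x where ux: "u \<in> U" "x \<in> V" "y = u \<oplus> f x"
          using Y by (auto simp: ival_def ssum_def)
        have uX: "u \<in> X" "u \<in> Y" using X Y ux(1) by (auto simp: ival_def)
        have "y \<ominus> u \<in> Y" using opsubD(6) y uX Y by (auto simp: ival_def)
        moreover have "y \<ominus> u = f x"
          using ux fc[OF ux(2)] opsubD(1)[OF U ux(1)] by (simp add: minus_eq a_comm[of u] a_assoc r_neg)
        ultimately have "x \<in> {x \<in> V. f x \<in> Y}" using ux by simp
        then have "f x \<in> X" using eq by blast
        then show "y \<in> X" using ux uX X opsubD(3) by (auto simp: ival_def)
      qed
      then show "{x \<in> V. f x \<in> X} \<subset> {x \<in> V. f x \<in> Y}" using XY by blast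
    qed
  qed
qed

lemma len_ssum:
  assumes "opsub U" "opsub V"
  shows "len (U \<inter> V) V = len U (ssum U V)"
proof -
  have "{x \<in> V. x \<in> U} = U \<inter> V" by auto
  then show ?thesis
    using len_image(3)[OF assms, of "\<lambda>x. x"] opsubD(1)[OF assms(2)] by simp
qed

lemma len_finite_mono:
  assumes "opsub U" "opsub V" "opsub W" "opsub X" "U \<subseteq> V" "V \<subseteq> W" "W \<subseteq> X" "len U X \<noteq> \<infinity>"
  shows "len V W \<noteq> \<infinity>"
  using assms len_additive[of U V X] len_additive[of V W X] by (auto simp: plus_eq_infty_iff_enat)

end


section \<open>Chain conditions\<close>

lemma enat_add_eq_infty_iff: "a + b = \<infinity> \<longleftrightarrow> a = \<infinity> \<or> b = \<infinity>" for a b :: enat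
  by (cases a; cases b) auto

context op_group
begin

definition acc_below :: "'a set \<Rightarrow> bool" where
  "acc_below V \<longleftrightarrow> (\<forall>N. (\<forall>t::nat. opsub (N t) \<and> N t \<subseteq> V \<and> N t \<subseteq> N (Suc t)) \<longrightarrow>
     (\<exists>t0. \<forall>t\<ge>t0. N t = N t0))"

lemma acc_belowD:
  assumes "acc_below V" "\<And>t::nat. opsub (N t)" "\<And>t. N t \<subseteq> V" "\<And>t. N t \<subseteq> N (Suc t)"
  obtains t0 where "\<And>t. t \<ge> t0 \<Longrightarrow> N t = N t0"
  using assms unfolding acc_below_def by blast

lemma finite_len_imp_acc:
  assumes V: "opsub V" and fin: "len {\<zero>} V \<noteq> \<infinity>"
  shows "acc_below V"
  unfolding acc_below_def
proof (intro allI impI)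
  fix N assume N: "\<forall>t::nat. opsub (N t) \<and> N t \<subseteq> V \<and> N t \<subseteq> N (Suc t)"
  have z: "{\<zero>} \<subseteq> N t" for t using N opsubD(2) by blast
  have le: "N s \<subseteq> N t" if "s \<le> t" for s t
    using that by (rule lift_Suc_mono_le[rotated]) (use N in blast)
  define l where "l t = the_enat (len {\<zero>} (N t))" for t
  have l: "len {\<zero>} (N t) = enat (l t)" for t
  proof -
    have "len {\<zero>} (N t) \<noteq> \<infinity>"
      using N fin by (intro len_finite_mono[OF opsub_zero opsub_zero _ V _ z]) auto
    then show ?thesis unfolding l_def by (cases "len {\<zero>} (N t)") auto
  qed
  obtain b where b: "len {\<zero>} V = enat b" using fin by auto
  have "l t \<le> b" for t
    using len_additive[OF opsub_zero _ V z, of t] N l b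
    by (metis enat_ord_simps(1) le_iff_add)
  then obtain t0 where t0: "\<And>t. l t \<le> l t0"
    using ex_has_greatest_nat[of "\<lambda>_. True" 0 l "Suc b"] by (auto simp: less_Suc_eq_le)
  have "N t = N t0" if t: "t0 \<le> t" for t
  proof -
    have "len {\<zero>} (N t) = len {\<zero>} (N t0) + len (N t0) (N t)"
      using N by (intro len_additive opsub_zero z le t) auto
    then have "enat (l t) = enat (l t0) + len (N t0) (N t)" using l by simp
    moreover have "l t \<le> l t0" by (rule t0)
    ultimately have "len (N t0) (N t) = 0" by (cases "len (N t0) (N t)") (auto simp: zero_enat_def)
    then show ?thesis using len_eq_0[of "N t0" "N t"] N le[OF t] by auto
  qed
  then show "\<exists>t0. \<forall>t\<ge>t0. N t = N t0" by blast
qed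

text \<open>Hilbert's basis theorem for one additional operator \<open>y\<close>.  An element of the subgroup
  generated by all \<open>y\<^sup>k M\<^sub>0\<close> is a polynomial in \<open>y\<close> with coefficients in \<open>M\<^sub>0\<close>; the possible leading
  coefficients in degree \<open>k\<close> of the members of a subgroup \<open>N\<close> form a subgroup of \<open>M\<^sub>0\<close> which
  increases with \<open>N\<close> and with \<open>k\<close>, and two comparable subgroups with the same leading
  coefficients in all degrees are equal.\<close>

lemma hilbert_basis_step:
  assumes M0: "opsub M0" and acc: "acc_below M0"
    and yc: "\<And>x. x \<in> carrier G \<Longrightarrow> y x \<in> carrier G"
    and ya: "\<And>x z. x \<in> carrier G \<Longrightarrow> z \<in> carrier G \<Longrightarrow> y (x \<oplus> z) = y x \<oplus> y z"
    and yo: "\<And>\<theta> x. \<theta> \<in> \<Theta> \<Longrightarrow> x \<in> carrier G \<Longrightarrow> y (\<theta> x) = \<theta> (y x)"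
  obtains V where "M0 \<subseteq> V" "op_group.opsub G (insert y \<Theta>) V" "op_group.acc_below G (insert y \<Theta>) V"
proof -
  interpret Y: op_group G "insert y \<Theta>"
    by unfold_locales (use yc ya op_closed op_add in auto)
  have sub: "opsub W" if "Y.opsub W" for W
    using that unfolding opsub_def Y.opsub_def by blast
  have pc: "(y ^^ k) x \<in> carrier G" if "x \<in> carrier G" for k x
    using that by (induction k) (auto simp: yc)
  have pa: "(y ^^ k) (x \<oplus> z) = (y ^^ k) x \<oplus> (y ^^ k) z" if "x \<in> carrier G" "z \<in> carrier G" for k x z
    using that by (induction k) (auto simp: ya pc)
  have po: "(y ^^ k) (\<theta> x) = \<theta> ((y ^^ k) x)" if "\<theta> \<in> \<Theta>" "x \<in> carrier G" for k \<theta> x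
    using that by (induction k) (auto simp: yo pc)
  have y0: "y \<zero> = \<zero>" by (rule Y.op_zero) simp
  have p0: "(y ^^ k) \<zero> = \<zero>" for k by (induction k) (auto simp: y0)
  have pm: "(y ^^ k) (\<ominus> x) = \<ominus> (y ^^ k) x" if "x \<in> carrier G" for k x
  proof -
    have "(y ^^ k) (\<ominus> x) \<oplus> (y ^^ k) x = \<zero>"
      using pa[of "\<ominus> x" x k] that p0 by (simp add: l_neg)
    then show ?thesis using that pc by (simp add: minus_equality)
  qed
  note m0 = opsubD[OF M0]
  have im: "opsub ((y ^^ k) ` M0)" for k
  proof (rule opsubI)
    show "\<zero> \<in> (y ^^ k) ` M0" using p0 m0(2) by (metis imageI)
    fix x assume "x \<in> (y ^^ k) ` M0"
    then obtain u where u: "u \<in> M0" "x = (y ^^ k) u" by blast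
    show "\<ominus> x \<in> (y ^^ k) ` M0" using pm u m0 by (metis imageI)
    show "\<theta> x \<in> (y ^^ k) ` M0" if "\<theta> \<in> \<Theta>" for \<theta> using po[OF that, of u k] u m0 that by (metis imageI)
    fix z assume "z \<in> (y ^^ k) ` M0"
    then obtain v where v: "v \<in> M0" "z = (y ^^ k) v" by blast
    show "x \<oplus> z \<in> (y ^^ k) ` M0" using pa u v m0 by (metis imageI)
  qed (use m0 pc in auto)
  define T where "T = rec_nat {\<zero>} (\<lambda>k W. ssum W ((y ^^ k) ` M0))"
  have T0: "T 0 = {\<zero>}" and TS: "\<And>k. T (Suc k) = ssum (T k) ((y ^^ k) ` M0)"
    by (simp_all add: T_def)
  have T: "opsub (T k)" for k
    by (induction k) (simp_all add: T0 TS opsub_zero opsub_ssum im)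
  have Tm: "T k \<subseteq> T (Suc k)" for k
    unfolding TS by (rule ssum_upper1[OF T im])
  have Tle: "T j \<subseteq> T k" if "j \<le> k" for j k
    using that by (rule lift_Suc_mono_le[rotated]) (rule Tm)
  have yT: "y x \<in> T (Suc k)" if "x \<in> T k" for x k
    using that
  proof (induction k arbitrary: x)
    case 0
    then show ?case using y0 opsubD(2)[OF T] by (simp add: T0)
  next
    case (Suc k)
    then obtain s m where s: "s \<in> T k" "m \<in> M0" "x = s \<oplus> (y ^^ k) m"
      unfolding TS ssum_def by blast
    have "s \<in> carrier G" "m \<in> carrier G" using s opsubD(1)[OF T] m0(1) by blast+
    then have "y x = y s \<oplus> (y ^^ Suc k) m" using s(3) ya pc by simp
    moreover have "y s \<in> T (Suc k)" using Suc.IH s(1) .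
    ultimately show ?case unfolding TS[of "Suc k"] using s(2) by (auto intro: ssumI)
  qed
  define V where "V = (\<Union>k. T k)"
  have V: "Y.opsub V"
  proof (rule Y.opsubI)
    show "V \<subseteq> carrier G" using opsubD(1)[OF T] by (auto simp: V_def)
    show "\<zero> \<in> V" using opsubD(2)[OF T] by (auto simp: V_def)
    fix x assume "x \<in> V"
    then obtain k where k: "x \<in> T k" by (auto simp: V_def)
    show "\<ominus> x \<in> V" using opsubD(4)[OF T k] by (auto simp: V_def)
    show "\<theta> x \<in> V" if "\<theta> \<in> insert y \<Theta>" for \<theta>
      using that opsubD(5)[OF T _ k] yT[OF k] by (auto simp: V_def)
    fix z assume "z \<in> V"
    then obtain j where j: "z \<in> T j" by (auto simp: V_def)
    have "x \<in> T (max j k)" "z \<in> T (max j k)" using Tle[of k "max j k"] Tle[of j "max j k"] j k by auto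
    then show "x \<oplus> z \<in> V" using opsubD(3)[OF T] by (auto simp: V_def)
  qed
  have MV: "M0 \<subseteq> V"
  proof -
    have "M0 \<subseteq> T (Suc 0)" using ssum_upper2[OF T im, of 0 0] by (simp add: TS)
    then show ?thesis by (auto simp: V_def)
  qed
  define Ld where "Ld N k = {m \<in> M0. \<exists>s\<in>T k. (y ^^ k) m \<oplus> s \<in> N}" for N k
  have LdI: "m \<in> Ld N k" if "m \<in> M0" "s \<in> T k" "(y ^^ k) m \<oplus> s \<in> N" for m s N k
    using that by (auto simp: Ld_def)
  have Ld: "opsub (Ld N k)" if N: "Y.opsub N" for N k
  proof (rule opsubI)
    show "Ld N k \<subseteq> carrier G" using m0(1) by (auto simp: Ld_def)
    show "\<zero> \<in> Ld N k"
      using LdI[OF m0(2) opsubD(2)[OF T]] p0 Y.opsubD(2)[OF N] by simp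
    fix x assume "x \<in> Ld N k"
    then obtain s where x: "x \<in> M0" "s \<in> T k" "(y ^^ k) x \<oplus> s \<in> N" by (auto simp: Ld_def)
    have c: "x \<in> carrier G" "s \<in> carrier G" "(y ^^ k) x \<in> carrier G" using x opsubD(1)[OF T] m0(1) pc by blast+
    have "(y ^^ k) (\<ominus> x) \<oplus> \<ominus> s = \<ominus> ((y ^^ k) x \<oplus> s)"
      using c by (simp add: pm minus_add)
    then show "\<ominus> x \<in> Ld N k"
      using LdI[OF m0(4)[OF x(1)] opsubD(4)[OF T x(2)]] Y.opsubD(4)[OF N x(3)] by simp
    show "\<theta> x \<in> Ld N k" if th: "\<theta> \<in> \<Theta>" for \<theta>
    proof -
      have "(y ^^ k) (\<theta> x) \<oplus> \<theta> s = \<theta> ((y ^^ k) x \<oplus> s)"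
        using c th by (simp add: po op_add)
      then show ?thesis
        using LdI[OF m0(5)[OF th x(1)] opsubD(5)[OF T th x(2)]] Y.opsubD(5)[OF N _ x(3)] th by simp
    qed
    fix z assume "z \<in> Ld N k"
    then obtain r where z: "z \<in> M0" "r \<in> T k" "(y ^^ k) z \<oplus> r \<in> N" by (auto simp: Ld_def)
    have d: "z \<in> carrier G" "r \<in> carrier G" "(y ^^ k) z \<in> carrier G" using z opsubD(1)[OF T] m0(1) pc by blast+
    have "(y ^^ k) (x \<oplus> z) \<oplus> (s \<oplus> r) = ((y ^^ k) x \<oplus> s) \<oplus> ((y ^^ k) z \<oplus> r)"
      using c d by (simp add: pa a_ac)
    then show "x \<oplus> z \<in> Ld N k"
      using LdI[OF m0(3)[OF x(1) z(1)] opsubD(3)[OF T x(2) z(2)]] Y.opsubD(3)[OF N x(3) z(3)] by simp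
  qed
  have LdS: "Ld N k \<subseteq> Ld N (Suc k)" if N: "Y.opsub N" for N k
  proof
    fix x assume "x \<in> Ld N k"
    then obtain s where x: "x \<in> M0" "s \<in> T k" "(y ^^ k) x \<oplus> s \<in> N" by (auto simp: Ld_def)
    have c: "x \<in> carrier G" "s \<in> carrier G" "(y ^^ k) x \<in> carrier G" using x opsubD(1)[OF T] m0(1) pc by blast+
    have "(y ^^ Suc k) x \<oplus> y s = y ((y ^^ k) x \<oplus> s)" using c by (simp add: ya)
    moreover have "y ((y ^^ k) x \<oplus> s) \<in> N" using Y.opsubD(5)[OF N _ x(3)] by simp
    ultimately show "x \<in> Ld N (Suc k)" using LdI[OF x(1) yT[OF x(2)]] by metis
  qed
  have determined: "N' \<subseteq> N"
    if N: "Y.opsub N" and N': "Y.opsub N'" and NN: "N \<subseteq> N'" and "N' \<subseteq> V" and eq: "\<And>k. Ld N k = Ld N' k" for N N'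
  proof -
    have "x \<in> N" if "x \<in> N'" "x \<in> T k" for x k
      using that
    proof (induction k arbitrary: x)
      case 0
      then show ?case using Y.opsubD(2)[OF N] by (simp add: T0)
    next
      case (Suc k)
      then obtain s m where s: "s \<in> T k" "m \<in> M0" "x = s \<oplus> (y ^^ k) m"
        unfolding TS ssum_def by blast
      have c: "s \<in> carrier G" "m \<in> carrier G" "(y ^^ k) m \<in> carrier G"
        using s opsubD(1)[OF T] m0(1) pc by blast+
      have "(y ^^ k) m \<oplus> s \<in> N'" using Suc.prems s c by (simp add: a_comm)
      then have "m \<in> Ld N k" using LdI[OF s(2,1)] eq by simp
      then obtain r where r: "r \<in> T k" "(y ^^ k) m \<oplus> r \<in> N" by (auto simp: Ld_def)
      have rc: "r \<in> carrier G" using r opsubD(1)[OF T] by blast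
      have e: "x = (s \<ominus> r) \<oplus> ((y ^^ k) m \<oplus> r)"
      proof -
        have "(s \<ominus> r) \<oplus> ((y ^^ k) m \<oplus> r) = s \<oplus> (y ^^ k) m \<oplus> (r \<oplus> \<ominus> r)"
          using c rc unfolding minus_eq by (simp add: a_ac)
        then show ?thesis using s c rc by (simp add: r_neg)
      qed
      have "s \<ominus> r = x \<ominus> ((y ^^ k) m \<oplus> r)"
        using e c rc by (simp add: minus_eq a_assoc r_neg)
      then have "s \<ominus> r \<in> N'" using Y.opsubD(6)[OF N' Suc.prems(1)] r(2) NN by auto
      moreover have "s \<ominus> r \<in> T k" using opsubD(6)[OF T s(1) r(1)] .
      ultimately have "s \<ominus> r \<in> N" by (rule Suc.IH)
      then show ?case using e Y.opsubD(3)[OF N _ r(2)] by simp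
    qed
    then show ?thesis using \<open>N' \<subseteq> V\<close> unfolding V_def by blast
  qed
  have "Y.acc_below V"
    unfolding Y.acc_below_def
  proof (intro allI impI)
    fix N assume N: "\<forall>t::nat. Y.opsub (N t) \<and> N t \<subseteq> V \<and> N t \<subseteq> N (Suc t)"
    have Nle: "N s \<subseteq> N t" if "s \<le> t" for s t
      using that by (rule lift_Suc_mono_le[rotated]) (use N in blast)
    define F where "F t k = Ld (N t) k" for t k
    have Fs: "opsub (F t k)" "F t k \<subseteq> M0" for t k
      using Ld N by (auto simp: F_def Ld_def)
    have F1: "F s k \<subseteq> F t k" if "s \<le> t" for s t k
      using Nle[OF that] by (auto simp: F_def Ld_def)
    have F2: "F t j \<subseteq> F t k" if "j \<le> k" for t j k
      using that by (rule lift_Suc_mono_le[rotated]) (use LdS N in \<open>auto simp: F_def\<close>)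
    have FF: "F s j \<subseteq> F t k" if "s \<le> t" "j \<le> k" for s t j k
      using F1[OF that(1)] F2[OF that(2)] by blast
    \<comment> \<open>The diagonal of the double chain stabilizes at some \<open>t0\<close>, which settles all \<open>k \<ge> t0\<close>; the finitely
      many rows with smaller \<open>k\<close> stabilize one by one.\<close>
    obtain t0 where t0: "\<And>t. t \<ge> t0 \<Longrightarrow> F t t = F t0 t0"
      using acc_belowD[OF acc, of "\<lambda>t. F t t"] Fs FF by (metis le_SucI order_refl)
    have "\<exists>t1. \<forall>t\<ge>t1. F t k = F t1 k" for k
      using acc_belowD[OF acc, of "\<lambda>t. F t k"] Fs FF by (metis le_SucI order_refl)
    then obtain t1 where t1: "\<And>k t. t \<ge> t1 k \<Longrightarrow> F t k = F (t1 k) k" by metis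
    define u where "u = Max (insert t0 (t1 ` {..<t0}))"
    have u: "t0 \<le> u" "\<And>k. k < t0 \<Longrightarrow> t1 k \<le> u" by (auto simp: u_def)
    have stable: "F t k = F u k" if t: "u \<le> t" for t k
    proof (cases "k < t0")
      case True
      then show ?thesis using t1[of k t] t1[of k u] u(2)[OF True] t by auto
    next
      case False
      then have k: "t0 \<le> k" by simp
      have "F s k = F t0 t0" if "t0 \<le> s" for s
      proof
        show "F t0 t0 \<subseteq> F s k" using FF that k by blast
        have "F s k \<subseteq> F (max s k) (max s k)" by (rule FF) auto
        then show "F s k \<subseteq> F t0 t0" using t0[of "max s k"] that by simp
      qed
      then show ?thesis using t u(1) by simp
    qed
    have "N t = N u" if t: "u \<le> t" for t
    proof
      show "N u \<subseteq> N t" by (rule Nle[OF t])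
      show "N t \<subseteq> N u"
      proof (rule determined)
        show "Ld (N u) k = Ld (N t) k" for k using stable[OF t, of k] by (simp add: F_def)
      qed (use N Nle[OF t] in blast)+
    qed
    then show "\<exists>u. \<forall>t\<ge>u. N t = N u" by blast
  qed
  with MV V show thesis by (rule that)
qed

end

lemma hilbert_basis:
  assumes "op_group G \<Theta>" "op_group.opsub G \<Theta> M0" "op_group.acc_below G \<Theta> M0" "finite Y"
    and "\<And>y x. y \<in> Y \<Longrightarrow> x \<in> carrier G \<Longrightarrow> y x \<in> carrier G"
    and "\<And>y x z. y \<in> Y \<Longrightarrow> x \<in> carrier G \<Longrightarrow> z \<in> carrier G \<Longrightarrow> y (x \<oplus>\<^bsub>G\<^esub> z) = y x \<oplus>\<^bsub>G\<^esub> y z"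
    and "\<And>y z x. y \<in> Y \<Longrightarrow> z \<in> Y \<union> \<Theta> \<Longrightarrow> x \<in> carrier G \<Longrightarrow> y (z x) = z (y x)"
  obtains V where "M0 \<subseteq> V" "op_group G (Y \<union> \<Theta>)" "op_group.opsub G (Y \<union> \<Theta>) V"
    "op_group.acc_below G (Y \<union> \<Theta>) V"
proof -
  have "\<exists>V. M0 \<subseteq> V \<and> op_group G (Y \<union> \<Theta>) \<and> op_group.opsub G (Y \<union> \<Theta>) V \<and>
      op_group.acc_below G (Y \<union> \<Theta>) V"
    using assms(4-)
  proof (induction Y)
    case empty
    show ?case using assms(1-3) by auto
  next
    case (insert y Y)
    have "\<exists>V. M0 \<subseteq> V \<and> op_group G (Y \<union> \<Theta>) \<and> op_group.opsub G (Y \<union> \<Theta>) V \<and>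
        op_group.acc_below G (Y \<union> \<Theta>) V"
    proof (rule insert.IH)
      show "y' (z x) = z (y' x)" if "y' \<in> Y" "z \<in> Y \<union> \<Theta>" "x \<in> carrier G" for y' z x
        by (rule insert.prems(3)) (use that in blast)+
    qed (use insert.prems(1,2) in blast)+
    then obtain V where V: "M0 \<subseteq> V" "op_group G (Y \<union> \<Theta>)" "op_group.opsub G (Y \<union> \<Theta>) V"
        "op_group.acc_below G (Y \<union> \<Theta>) V" by blast
    interpret O: op_group G "Y \<union> \<Theta>" by (rule V(2))
    obtain W where W: "V \<subseteq> W" "op_group.opsub G (insert y (Y \<union> \<Theta>)) W"
        "op_group.acc_below G (insert y (Y \<union> \<Theta>)) W"
      using O.hilbert_basis_step[OF V(3,4), of y] insert.prems by auto
    moreover have "op_group G (insert y (Y \<union> \<Theta>))"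
      by unfold_locales (use O.op_closed O.op_add insert.prems in auto)
    ultimately show ?case using V(1) by (intro exI[of _ W]) auto
  qed
  then show thesis using that by blast
qed


section \<open>Artinian rings have finite length\<close>

definition mult_ops :: "('a, 'x) ring_scheme \<Rightarrow> ('a \<Rightarrow> 'a) set" where
  "mult_ops A = (\<lambda>a x. a \<otimes>\<^bsub>A\<^esub> x) ` carrier A"

lemma (in cring) op_group_mult: "op_group R (mult_ops R)"
  by unfold_locales (auto simp: mult_ops_def r_distr)

lemma (in cring) opsub_mult_iff: "op_group.opsub R (mult_ops R) I \<longleftrightarrow> ideal I R"
proof -
  interpret op_group R "mult_ops R" by (rule op_group_mult)
  show ?thesis
  proof
    assume I: "opsub I"
    note i = opsubD[OF I]
    have l: "a \<otimes> x \<in> I" if "a \<in> carrier R" "x \<in> I" for a x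
      using i(5)[of "\<lambda>x. a \<otimes> x" x] that by (auto simp: mult_ops_def)
    have "subgroup I (add_monoid R)"
      using i by unfold_locales (auto simp: a_inv_def)
    then show "ideal I R"
    proof (intro idealI ring_axioms)
      show "a \<otimes> x \<in> I" if "a \<in> I" "x \<in> carrier R" for a x
        using l[OF that(2,1)] m_comm[OF that(2) i(1)[OF that(1)]] by simp
    qed (use l in auto)
  next
    assume "ideal I R"
    then interpret ideal I R .
    show "opsub I"
      using I_l_closed a_subset by (intro opsubI) (auto simp: mult_ops_def)
  qed
qed

text \<open>In an Artinian ring of infinite length there would be an ideal \<open>I\<close> minimal among those of
  infinite length.  By minimality every ring element either annihilates \<open>I\<close> or maps \<open>I\<close> onto
  itself, and in the latter case the descending chain condition makes it invertible on \<open>I\<close>.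
  So \<open>I\<close> is a vector space, and a hyperplane of it has infinite length as well.\<close>

lemma artinian_finite_length:
  fixes A (structure)
  assumes "artinian_ring A"
  shows "op_group.len A (mult_ops A) {\<zero>} (carrier A) \<noteq> \<infinity>"
proof -
  interpret A: cring A using assms by (simp add: artinian_ring_def)
  interpret O: op_group A "mult_ops A" by (rule A.op_group_mult)
  have opm: "a \<otimes> x \<in> U" if "O.opsub U" "a \<in> carrier A" "x \<in> U" for a x U
    using O.opsubD(5)[OF that(1), of "\<lambda>x. a \<otimes> x" x] that by (auto simp: mult_ops_def)
  have opsI: "O.opsub U" if "U \<subseteq> carrier A" "\<zero> \<in> U" "\<And>x y. x \<in> U \<Longrightarrow> y \<in> U \<Longrightarrow> x \<oplus> y \<in> U"
      "\<And>a x. a \<in> carrier A \<Longrightarrow> x \<in> U \<Longrightarrow> a \<otimes> x \<in> U" for U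
  proof (rule O.opsubI)
    fix x assume x: "x \<in> U"
    have "\<ominus> x = (\<ominus> \<one>) \<otimes> x" using x that(1) by (simp add: A.l_minus subset_iff)
    then show "\<ominus> x \<in> U" using that(4)[OF _ x, of "\<ominus> \<one>"] by simp
  qed (use that in \<open>auto simp: mult_ops_def\<close>)
  have dcc: "\<exists>N. \<forall>n\<ge>N. I n = I N" if "\<And>n. O.opsub (I n)" "\<And>n. I (Suc n) \<subseteq> I n" for I :: "nat \<Rightarrow> 'a set"
    using assms that unfolding artinian_ring_def A.opsub_mult_iff by blast
  have wf: "wf {(J, I). O.opsub J \<and> O.opsub I \<and> J \<subset> I}"
    unfolding wf_iff_no_infinite_down_chain
  proof
    assume "\<exists>f. \<forall>i. (f (Suc i), f i) \<in> {(J, I). O.opsub J \<and> O.opsub I \<and> J \<subset> I}"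
    then obtain f :: "nat \<Rightarrow> 'a set"
      where f: "\<forall>i. (f (Suc i), f i) \<in> {(J, I). O.opsub J \<and> O.opsub I \<and> J \<subset> I}" ..
    then have f: "O.opsub (f i)" "f (Suc i) \<subset> f i" for i by auto
    obtain N where "\<forall>n\<ge>N. f n = f N" using dcc[of f, OF f(1) psubset_imp_subset[OF f(2)]] ..
    then have "f (Suc N) = f N" by (meson le_SucI order_refl)
    then show False using f(2)[of N] by blast
  qed
  show ?thesis
  proof
    assume "O.len {\<zero>} (carrier A) = \<infinity>"
    then have "carrier A \<in> {I. O.opsub I \<and> O.len {\<zero>} I = \<infinity>}" using O.opsub_carrier by simp
    then have "\<exists>I\<in>{I. O.opsub I \<and> O.len {\<zero>} I = \<infinity>}.
        \<forall>J. (J, I) \<in> {(J, I). O.opsub J \<and> O.opsub I \<and> J \<subset> I} \<longrightarrow>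
            J \<notin> {I. O.opsub I \<and> O.len {\<zero>} I = \<infinity>}"
      using wf unfolding wf_eq_minimal by (metis (no_types, lifting))
    then obtain I where I: "O.opsub I" "O.len {\<zero>} I = \<infinity>"
      and min: "\<forall>J. O.opsub J \<longrightarrow> J \<subset> I \<longrightarrow> O.len {\<zero>} J \<noteq> \<infinity>" by auto
    have min: "O.len {\<zero>} J \<noteq> \<infinity>" if "O.opsub J" "J \<subset> I" for J
      using min that by blast
    have Ic: "I \<subseteq> carrier A" using O.opsubD(1)[OF I(1)] by blast
    have z: "{\<zero>} \<subseteq> U" if "O.opsub U" for U using O.opsubD(2)[OF that] by simp
    \<comment> \<open>If \<open>a\<close> does not annihilate \<open>I\<close>, the kernel of multiplication by \<open>a\<close> is smaller than \<open>I\<close> and so of finite length;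
      hence the image has infinite length and cannot be smaller than \<open>I\<close>.\<close>
    have onto: "\<exists>u\<in>I. x = a \<otimes> u"
      if a: "a \<in> carrier A" and v: "v \<in> I" "a \<otimes> v \<noteq> \<zero>" and x: "x \<in> I" for a v x
    proof -
      let ?K = "{x \<in> I. a \<otimes> x \<in> {\<zero>}}" and ?J = "O.ssum {\<zero>} ((\<lambda>x. a \<otimes> x) ` I)"
      have fo: "a \<otimes> \<theta> x = \<theta> (a \<otimes> x)" if "\<theta> \<in> mult_ops A" "x \<in> I" for \<theta> x
        using that a Ic A.m_lcomm by (auto simp: mult_ops_def)
      have fa: "a \<otimes> (x \<oplus> y) = a \<otimes> x \<oplus> a \<otimes> y" if "x \<in> I" "y \<in> I" for x y
        using that a Ic by (intro A.r_distr) auto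
      have fc: "a \<otimes> x \<in> carrier A" if "x \<in> I" for x using that a Ic by auto
      note li = O.len_image[of "{\<zero>}" I "\<lambda>x. a \<otimes> x", OF O.opsub_zero I(1) fc fa fo]
      have K: "O.opsub ?K" and J: "O.opsub ?J" and KJ: "O.len ?K I = O.len {\<zero>} ?J"
        by (rule li; assumption)+
      have "?K \<subset> I" using v by auto
      then have "O.len {\<zero>} ?K \<noteq> \<infinity>" using min[OF K] by blast
      moreover have "O.len {\<zero>} I = O.len {\<zero>} ?K + O.len ?K I"
        by (rule O.len_additive[OF O.opsub_zero K I(1) z[OF K]]) auto
      ultimately have "O.len {\<zero>} ?J = \<infinity>"
        unfolding I(2) KJ by (drule_tac sym) (simp only: enat_add_eq_infty_iff simp_thms)
      moreover have "?J \<subseteq> I"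
        using opm[OF I(1) a] z[OF I(1)] by (intro O.ssum_least[OF I(1)]) auto
      ultimately have "?J = I" using min[OF J] by blast
      then obtain u where "u \<in> I" "x = \<zero> \<oplus> a \<otimes> u" using x by (auto simp: O.ssum_def)
      then show ?thesis using fc by auto
    qed
    have inverse: "\<exists>b\<in>carrier A. \<forall>x\<in>I. x = b \<otimes> (a \<otimes> x)"
      if a: "a \<in> carrier A" and v: "v \<in> I" "a \<otimes> v \<noteq> \<zero>" for a v
    proof -
      define J where "J n = {a [^] (n::nat) \<otimes> c | c. c \<in> carrier A}" for n
      have "\<exists>N. \<forall>n\<ge>N. J n = J N"
      proof (rule dcc)
        fix n show "O.opsub (J n)"
        proof (rule opsI)
          show "J n \<subseteq> carrier A" using a by (auto simp: J_def)
          show "\<zero> \<in> J n" using a by (auto simp: J_def intro!: exI[of _ "\<zero>"])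
          fix x y assume "x \<in> J n" "y \<in> J n"
          then obtain c d where "c \<in> carrier A" "d \<in> carrier A" "x = a [^] n \<otimes> c" "y = a [^] n \<otimes> d"
            by (auto simp: J_def)
          then show "x \<oplus> y \<in> J n" using a
            by (auto simp: J_def A.r_distr[symmetric])
        next
          fix b x assume "b \<in> carrier A" "x \<in> J n"
          then obtain c where "c \<in> carrier A" "x = a [^] n \<otimes> c" by (auto simp: J_def)
          then show "b \<otimes> x \<in> J n" using a \<open>b \<in> carrier A\<close>
            by (auto simp: J_def A.m_lcomm intro!: exI[of _ "b \<otimes> c"])
        qed
        show "J (Suc n) \<subseteq> J n"
        proof
          fix x assume "x \<in> J (Suc n)"
          then obtain c where "c \<in> carrier A" "x = a [^] n \<otimes> a \<otimes> c" by (auto simp: J_def)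
          then show "x \<in> J n" using a by (auto simp: J_def A.m_assoc intro!: exI[of _ "a \<otimes> c"])
        qed
      qed
      then obtain N where "J (Suc N) = J N" by (metis le_SucI order_refl)
      moreover have "a [^] N \<in> J N" using a by (auto simp: J_def intro!: exI[of _ "\<one>"])
      ultimately obtain c where c: "c \<in> carrier A" "a [^] N = a [^] N \<otimes> a \<otimes> c"
        by (auto simp: J_def)
      have pow: "\<exists>u\<in>I. x = a [^] (n::nat) \<otimes> u" if "x \<in> I" for n x
        using that
      proof (induction n arbitrary: x)
        case 0
        then show ?case using Ic by (auto intro!: bexI[of _ x])
      next
        case (Suc n)
        then obtain u where u: "u \<in> I" "x = a [^] n \<otimes> u" by blast
        obtain w where "w \<in> I" "u = a \<otimes> w" using onto[OF a v u(1)] by blast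
        then have "w \<in> I" "x = a [^] Suc n \<otimes> w"
          using u a Ic by (auto simp: A.m_assoc subset_iff)
        then show ?case by blast
      qed
      have "x = c \<otimes> (a \<otimes> x)" if x: "x \<in> I" for x
      proof -
        obtain u where u: "u \<in> I" "x = a [^] N \<otimes> u" using pow[OF x] by blast
        have uc: "u \<in> carrier A" using u Ic by auto
        have "x = (a [^] N \<otimes> a \<otimes> c) \<otimes> u" using u c(2) by simp
        also have "\<dots> = c \<otimes> (a \<otimes> (a [^] N \<otimes> u))"
          using a c(1) uc by (simp add: A.m_ac)
        finally show ?thesis using u by simp
      qed
      then show ?thesis using c(1) by blast
    qed
    have "I \<noteq> {\<zero>}" using I(2) O.len_self[of "{\<zero>}"] by auto
    then obtain w where w: "w \<in> I" "w \<noteq> \<zero>" using O.opsubD(2)[OF I(1)] by blast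
    \<comment> \<open>A hyperplane: an ideal inside \<open>I\<close> that is maximal among those avoiding a fixed nonzero element \<open>w\<close>.\<close>
    have "\<exists>W\<in>{W. O.opsub W \<and> W \<subseteq> I \<and> w \<notin> W}. \<forall>X\<in>{W. O.opsub W \<and> W \<subseteq> I \<and> w \<notin> W}. W \<subseteq> X \<longrightarrow> X = W"
    proof (rule subset_Zorn_nonempty)
      show "{W. O.opsub W \<and> W \<subseteq> I \<and> w \<notin> W} \<noteq> {}"
        using O.opsub_zero z[OF I(1)] w(2) by blast
      fix \<C> assume "\<C> \<noteq> {}" and C: "subset.chain {W. O.opsub W \<and> W \<subseteq> I \<and> w \<notin> W} \<C>"
      then obtain X where X: "X \<in> \<C>" by blast
      have Cs: "O.opsub Y" "Y \<subseteq> I" "w \<notin> Y" if "Y \<in> \<C>" for Y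
        using C that by (auto simp: subset.chain_def)
      have "O.opsub (\<Union>\<C>)"
      proof (rule opsI)
        show "\<Union>\<C> \<subseteq> carrier A" using Cs(2) Ic by blast
        show "\<zero> \<in> \<Union>\<C>" using X Cs(1) O.opsubD(2) by blast
        fix x y assume "x \<in> \<Union>\<C>" "y \<in> \<Union>\<C>"
        then obtain X Y where XY: "X \<in> \<C>" "Y \<in> \<C>" "x \<in> X" "y \<in> Y" by blast
        then have "X \<subseteq> Y \<or> Y \<subseteq> X" using C by (auto simp: subset.chain_def)
        then obtain Y where "Y \<in> \<C>" "x \<in> Y" "y \<in> Y" using XY by blast
        then show "x \<oplus> y \<in> \<Union>\<C>" using O.opsubD(3)[OF Cs(1)] by blast
      next
        fix a x assume "a \<in> carrier A" "x \<in> \<Union>\<C>"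
        then show "a \<otimes> x \<in> \<Union>\<C>" using opm Cs(1) by blast
      qed
      then show "\<Union>\<C> \<in> {W. O.opsub W \<and> W \<subseteq> I \<and> w \<notin> W}" using Cs by blast
    qed
    then obtain W where W: "O.opsub W" "W \<subseteq> I" "w \<notin> W"
      and "\<forall>X\<in>{W. O.opsub W \<and> W \<subseteq> I \<and> w \<notin> W}. W \<subseteq> X \<longrightarrow> X = W" by (elim bexE CollectE conjE)
    then have max: "w \<in> X" if "O.opsub X" "W \<subset> X" "X \<subseteq> I" for X
      using that by (metis (mono_tags, lifting) mem_Collect_eq psubset_eq)
    \<comment> \<open>Every larger ideal contains \<open>w\<close>, and as the ring acts invertibly on \<open>I\<close>, \<open>w\<close> and \<open>W\<close> generate \<open>I\<close>.\<close>
    have top: "X = I" if X: "O.opsub X" "W \<subset> X" "X \<subseteq> I" for X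
    proof
      show "I \<subseteq> X"
      proof
        fix v assume v: "v \<in> I"
        show "v \<in> X"
        proof (cases "v \<in> W")
          case False
          let ?Z = "(\<lambda>a. a \<otimes> v) ` carrier A"
          have vc: "v \<in> carrier A" using v Ic by blast
          have Z: "O.opsub ?Z"
          proof (rule opsI)
            show "\<zero> \<in> ?Z" using vc by (metis A.l_null A.zero_closed imageI)
            show "x \<oplus> y \<in> ?Z" if "x \<in> ?Z" "y \<in> ?Z" for x y
              using that vc by (auto simp: A.l_distr[symmetric])
            show "a \<otimes> x \<in> ?Z" if "a \<in> carrier A" "x \<in> ?Z" for a x
              using that vc by (auto simp: A.m_assoc[symmetric])
          qed (use vc in auto)
          have "v \<in> ?Z" using vc by (metis A.l_one A.one_closed imageI)
          then have "W \<subset> O.ssum W ?Z"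
            using O.ssum_upper1[OF W(1) Z] O.ssum_upper2[OF W(1) Z] False by blast
          moreover have "O.ssum W ?Z \<subseteq> I"
            using W(2) opm[OF I(1) _ v] by (intro O.ssum_least[OF I(1)]) auto
          ultimately have "w \<in> O.ssum W ?Z" using max[OF O.opsub_ssum[OF W(1) Z]] by blast
          then obtain u a where ua: "u \<in> W" "a \<in> carrier A" "w = u \<oplus> a \<otimes> v"
            by (auto simp: O.ssum_def)
          have uc: "u \<in> carrier A" "u \<in> I" using ua W(2) Ic by auto
          have "a \<otimes> v \<noteq> \<zero>" using ua W(3) uc by auto
          from inverse[OF ua(2) v this] obtain b where b: "b \<in> carrier A" "v = b \<otimes> (a \<otimes> v)"
            using v by blast
          have "w \<in> X" using max X by blast
          moreover have "u \<in> X" using ua X by blast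
          ultimately have "w \<ominus> u \<in> X" by (rule O.opsubD(6)[OF X(1)])
          moreover have "w \<ominus> u = a \<otimes> v"
            using ua uc vc by (simp add: A.minus_eq A.a_comm[of u] A.a_assoc A.r_neg)
          ultimately show ?thesis using opm[OF X(1) b(1)] b(2) by metis
        qed (use X in blast)
      qed
    qed (rule X(3))
    have "n \<le> 1" if "n \<in> chain_lengths (O.ival W I)" for n
    proof (rule ccontr)
      assume n: "\<not> n \<le> 1"
      obtain C where C: "\<forall>i\<le>n. C i \<in> O.ival W I" "\<forall>i<n. C i \<subset> C (Suc i)"
        by (rule chain_lengthsE[OF \<open>n \<in> chain_lengths (O.ival W I)\<close>])
      have s: "C 0 \<subset> C 1" "C 1 \<subset> C 2" using C(2)[rule_format, of 0] C(2)[rule_format, of 1] n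
        by (auto simp: numeral_2_eq_2)
      have "C 0 \<in> O.ival W I" "C 1 \<in> O.ival W I" "C 2 \<in> O.ival W I" using C(1) n by auto
      then have "C 1 = I" "C 2 \<subseteq> I" using s top[of "C 1"] by (auto simp: O.ival_def)
      then show False using s by blast
    qed
    then have "O.len W I \<le> enat 1" unfolding O.len_def by (intro SUP_least) simp
    then have "O.len W I \<noteq> \<infinity>" by (auto dest: enat_ile)
    moreover have "O.len {\<zero>} W \<noteq> \<infinity>" using min[OF W(1)] W(2,3) w(1) by blast
    moreover have "O.len {\<zero>} I = O.len {\<zero>} W + O.len W I"
      by (rule O.len_additive[OF O.opsub_zero W(1) I(1) z[OF W(1)] W(2)])
    ultimately show False unfolding I(2) by (drule_tac sym) (simp only: enat_add_eq_infty_iff simp_thms)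
  qed
qed


section \<open>Homogeneous components and homogeneous primes\<close>

definition deg_diff :: "('d \<Rightarrow> nat) \<Rightarrow> ('d \<Rightarrow> nat) \<Rightarrow> 'd \<Rightarrow> nat" where
  "deg_diff m n = (\<lambda>i. m i - n i)"

lemma deg_diff_add [simp]: "deg_diff (deg_add k n) k = n"
  by (simp add: deg_diff_def deg_add_def)

lemma deg_add_diff: "k \<le> c \<Longrightarrow> deg_add k (deg_diff c k) = c"
  by (simp add: deg_diff_def deg_add_def le_fun_def)

lemma deg_le_add [simp]: "k \<le> deg_add k n"
  by (simp add: deg_add_def le_fun_def)

lemma deg_add_cancel [simp]: "deg_add k m = deg_add k n \<longleftrightarrow> m = n"
  by (auto simp: deg_add_def fun_eq_iff)

lemma deg_add_commute: "deg_add m n = deg_add n m"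
  by (simp add: deg_add_def add.commute)

lemma deg_add_assoc: "deg_add (deg_add k m) n = deg_add k (deg_add m n)"
  by (simp add: deg_add_def add.assoc)

lemma deg_add_0 [simp]: "deg_add (\<lambda>_. 0) n = n" "deg_add n (\<lambda>_. 0) = n"
  by (simp_all add: deg_add_def)

lemma (in abelian_group) finsum_mem:
  assumes "\<zero> \<in> H" "\<And>x y. x \<in> H \<Longrightarrow> y \<in> H \<Longrightarrow> x \<oplus> y \<in> H" "H \<subseteq> carrier G" "\<And>i. i \<in> F \<Longrightarrow> f i \<in> H"
  shows "finsum G f F \<in> H"
proof (cases "finite F")
  case True
  then show ?thesis using assms(4)
  proof (induction F)
    case (insert i F)
    then have "f \<in> F \<rightarrow> carrier G" "f i \<in> carrier G" using assms(3) by auto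
    then show ?case using insert assms(2) by simp
  qed (simp add: assms(1))
qed (simp add: finsum_infinite assms(1))

locale graded_group = abelian_group M for M (structure) +
  fixes Mg :: "'i \<Rightarrow> 'a set"
  assumes direct_sum: "internal_direct_sum M Mg"
begin

lemma Mg_subgroup: "subgroup (Mg n) (add_monoid M)"
  using direct_sum by (simp add: internal_direct_sum_def)

lemma Mg_closed:
  shows "x \<in> Mg n \<Longrightarrow> x \<in> carrier M" "\<zero> \<in> Mg n" "x \<in> Mg n \<Longrightarrow> y \<in> Mg n \<Longrightarrow> x \<oplus> y \<in> Mg n"
    "x \<in> Mg n \<Longrightarrow> \<ominus> x \<in> Mg n"
  using subgroup.subset[OF Mg_subgroup, of n] subgroup.one_closed[OF Mg_subgroup, of n]
    subgroup.m_closed[OF Mg_subgroup, of x n y] subgroup.m_inv_closed[OF Mg_subgroup, of x n]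
  by (auto simp: a_inv_def)

text \<open>The value is meaningful only for \<open>x\<close> in the carrier, where the decomposition exists and is unique.\<close>

definition comp :: "'i \<Rightarrow> 'a \<Rightarrow> 'a" where
  "comp n x = (THE f. is_decomp M Mg f x) n"

lemma is_decomp_comp:
  assumes "x \<in> carrier M"
  shows "is_decomp M Mg (\<lambda>n. comp n x) x"
proof -
  have "\<exists>!f. is_decomp M Mg f x" using assms direct_sum by (simp add: internal_direct_sum_def)
  from theI'[OF this] show ?thesis by (simp add: comp_def)
qed

lemma is_decomp_unique:
  assumes "x \<in> carrier M" "is_decomp M Mg f x"
  shows "comp n x = f n"
  using assms is_decomp_comp[OF assms(1)] direct_sum
  unfolding internal_direct_sum_def by (metis (no_types, lifting))

lemma comp_in: "x \<in> carrier M \<Longrightarrow> comp n x \<in> Mg n"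
  using is_decomp_comp by (simp add: is_decomp_def)

lemma comp_carrier: "x \<in> carrier M \<Longrightarrow> comp n x \<in> carrier M"
  using comp_in Mg_closed(1) by blast

lemma finite_comp: "x \<in> carrier M \<Longrightarrow> finite {n. comp n x \<noteq> \<zero>}"
  using is_decomp_comp by (simp add: is_decomp_def)

lemma finsum_comp: "x \<in> carrier M \<Longrightarrow> finsum M (\<lambda>n. comp n x) {n. comp n x \<noteq> \<zero>} = x"
  using is_decomp_comp by (simp add: is_decomp_def)

lemma finsum_supp:
  assumes "finite F" "\<And>n. f n \<in> carrier M" "\<And>n. n \<notin> F \<Longrightarrow> f n = \<zero>"
  shows "finsum M f {n. f n \<noteq> \<zero>} = finsum M f F"
  by (rule add.finprod_mono_neutral_cong_left) (use assms in auto)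

lemma comp_unique:
  assumes "finite F" "\<And>n. f n \<in> Mg n" "\<And>n. n \<notin> F \<Longrightarrow> f n = \<zero>" "x = finsum M f F"
  shows "comp n x = f n"
proof (rule is_decomp_unique)
  have c: "f n \<in> carrier M" for n using assms(2) Mg_closed(1) by blast
  then show "x \<in> carrier M" using assms(4) by auto
  have "finite {n. f n \<noteq> \<zero>}" by (rule finite_subset[OF _ assms(1)]) (use assms(3) in auto)
  then show "is_decomp M Mg f x"
    using assms(2,4) finsum_supp[OF assms(1) c assms(3)] by (simp add: is_decomp_def)
qed

lemma comp_homogeneous: "x \<in> Mg n \<Longrightarrow> comp m x = (if m = n then x else \<zero>)"
  by (rule comp_unique[of "{n}"]) (auto simp: Mg_closed)

lemma comp_zero [simp]: "comp n \<zero> = \<zero>"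
  using comp_homogeneous[OF Mg_closed(2)] by simp

lemma comp_add:
  assumes "x \<in> carrier M" "y \<in> carrier M"
  shows "comp n (x \<oplus> y) = comp n x \<oplus> comp n y"
proof (rule comp_unique)
  let ?F = "{n. comp n x \<noteq> \<zero>} \<union> {n. comp n y \<noteq> \<zero>}"
  show fin: "finite ?F" using finite_comp assms by simp
  show "comp n x \<oplus> comp n y \<in> Mg n" for n using comp_in assms Mg_closed(3) by blast
  show "x \<oplus> y = finsum M (\<lambda>n. comp n x \<oplus> comp n y) ?F"
  proof -
    have F: "finsum M (\<lambda>n. comp n z) ?F = z" if z: "z \<in> carrier M" "{n. comp n z \<noteq> \<zero>} \<subseteq> ?F" for z
    proof -
      have "finsum M (\<lambda>n. comp n z) {n. comp n z \<noteq> \<zero>} = finsum M (\<lambda>n. comp n z) ?F"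
        by (rule finsum_supp[OF fin comp_carrier[OF z(1)]]) (use z(2) in auto)
      then show ?thesis using finsum_comp[OF z(1)] by simp
    qed
    have "finsum M (\<lambda>n. comp n x \<oplus> comp n y) ?F = finsum M (\<lambda>n. comp n x) ?F \<oplus> finsum M (\<lambda>n. comp n y) ?F"
      by (rule finsum_addf) (use comp_carrier assms in auto)
    then show ?thesis using F[OF assms(1)] F[OF assms(2)] by simp
  qed
qed auto

lemma comp_minus:
  assumes "x \<in> carrier M"
  shows "comp n (\<ominus> x) = \<ominus> comp n x"
  using comp_add[of "\<ominus> x" x n] assms comp_carrier by (simp add: l_neg minus_equality)

lemma graded_induct [consumes 1, case_names zero add hom]:
  assumes "x \<in> carrier M" "P \<zero>"
    and "\<And>x y. x \<in> carrier M \<Longrightarrow> y \<in> carrier M \<Longrightarrow> P x \<Longrightarrow> P y \<Longrightarrow> P (x \<oplus> y)"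
    and "\<And>n x. x \<in> Mg n \<Longrightarrow> P x"
  shows "P x"
proof -
  have "finsum M (\<lambda>n. comp n x) {n. comp n x \<noteq> \<zero>} \<in> {x \<in> carrier M. P x}"
  proof (rule finsum_mem)
    fix n show "comp n x \<in> {x \<in> carrier M. P x}"
      using assms(4)[OF comp_in[OF assms(1)]] comp_carrier[OF assms(1)] by simp
  qed (use assms(2,3) in auto)
  then show ?thesis using finsum_comp[OF assms(1)] by simp
qed

lemma mem_if_comps_mem:
  assumes "x \<in> carrier M" "\<zero> \<in> H" "\<And>x y. x \<in> H \<Longrightarrow> y \<in> H \<Longrightarrow> x \<oplus> y \<in> H" "H \<subseteq> carrier M" "\<And>n. comp n x \<in> H"
  shows "x \<in> H"
  using finsum_mem[OF assms(2,3,4), of "{n. comp n x \<noteq> \<zero>}" "\<lambda>n. comp n x"] assms(5)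
    finsum_comp[OF assms(1)] by simp

lemma comp_finsum:
  assumes "finite F" "\<And>i. i \<in> F \<Longrightarrow> f i \<in> carrier M"
  shows "comp n (finsum M f F) = finsum M (\<lambda>i. comp n (f i)) F"
  using assms
proof (induction F)
  case (insert i F)
  then have "f \<in> F \<rightarrow> carrier M" "(\<lambda>i. comp n (f i)) \<in> F \<rightarrow> carrier M" using comp_carrier by auto
  then show ?case using insert comp_carrier by (simp add: comp_add)
qed simp

end

text \<open>This covers multiplication by a homogeneous ring element both on the ring itself and on a graded module.\<close>

lemma comp_shift:
  fixes k :: "'d \<Rightarrow> nat" and M (structure) and Mg :: "('d \<Rightarrow> nat) \<Rightarrow> 'a set"
  assumes idx: "graded_group M Mg"
    and fc: "\<And>x. x \<in> carrier M \<Longrightarrow> f x \<in> carrier M"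
    and fa: "\<And>x y. x \<in> carrier M \<Longrightarrow> y \<in> carrier M \<Longrightarrow> f (x \<oplus> y) = f x \<oplus> f y"
    and fg: "\<And>n x. x \<in> Mg n \<Longrightarrow> f x \<in> Mg (deg_add k n)"
    and x: "x \<in> carrier M"
  shows "graded_group.comp M Mg c (f x) = (if k \<le> c then f (graded_group.comp M Mg (deg_diff c k) x) else \<zero>)"
proof -
  interpret G: graded_group M Mg by (rule idx)
  have f0: "f \<zero> = \<zero>"
    using fa[of \<zero> \<zero>] fc[of \<zero>] by (metis G.add.r_cancel_one' G.r_zero G.zero_closed)
  show ?thesis
    using x
  proof (induction rule: G.graded_induct)
    case zero
    then show ?case using f0 by simp
  next
    case (add x y)
    then show ?case by (simp add: fa fc G.comp_add G.comp_carrier)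
  next
    case (hom n x)
    show ?case
    proof (cases "k \<le> c")
      case True
      have "c = deg_add k n \<longleftrightarrow> deg_diff c k = n" using deg_add_diff[OF True] by (metis deg_diff_add)
      then show ?thesis
        using True f0 by (simp add: G.comp_homogeneous[OF fg[OF hom]] G.comp_homogeneous[OF hom])
    next
      case False
      then have "c \<noteq> deg_add k n" by auto
      then show ?thesis using False by (simp add: G.comp_homogeneous[OF fg[OF hom]])
    qed
  qed
qed

locale graded_ring = cring S + graded_group S Sg
  for S :: "('s, 'x) ring_scheme" (structure) and Sg :: "('d::finite \<Rightarrow> nat) \<Rightarrow> 's set" +
  assumes one_hom: "\<one> \<in> Sg (\<lambda>_. 0)"
    and mult_hom: "x \<in> Sg m \<Longrightarrow> y \<in> Sg n \<Longrightarrow> x \<otimes> y \<in> Sg (deg_add m n)"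
begin

lemma comp_mult_hom:
  assumes "s \<in> Sg k" "x \<in> carrier S"
  shows "comp c (s \<otimes> x) = (if k \<le> c then s \<otimes> comp (deg_diff c k) x else \<zero>)"
  by (rule comp_shift[where Mg = Sg and f = "\<lambda>x. s \<otimes> x"])
    (use assms Mg_closed(1) mult_hom graded_group_axioms in \<open>auto simp: r_distr\<close>)

text \<open>A homogeneous ideal is given by the family of its graded pieces, and \<open>hideal\<close> is the ideal with these
  pieces.\<close>

definition hfamily :: "(('d \<Rightarrow> nat) \<Rightarrow> 's set) \<Rightarrow> bool" where
  "hfamily P \<longleftrightarrow> (\<forall>n. P n \<subseteq> Sg n \<and> \<zero> \<in> P n \<and> (\<forall>x\<in>P n. \<forall>y\<in>P n. x \<oplus> y \<in> P n)) \<and>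
     (\<forall>k n. \<forall>s\<in>Sg k. \<forall>x\<in>P n. s \<otimes> x \<in> P (deg_add k n))"

definition hideal :: "(('d \<Rightarrow> nat) \<Rightarrow> 's set) \<Rightarrow> 's set" where
  "hideal P = {x \<in> carrier S. \<forall>n. comp n x \<in> P n}"

lemma hfamilyD:
  assumes "hfamily P"
  shows "x \<in> P n \<Longrightarrow> x \<in> Sg n" "\<zero> \<in> P n" "x \<in> P n \<Longrightarrow> y \<in> P n \<Longrightarrow> x \<oplus> y \<in> P n"
    "s \<in> Sg k \<Longrightarrow> x \<in> P n \<Longrightarrow> s \<otimes> x \<in> P (deg_add k n)"
  using assms unfolding hfamily_def by blast+

lemma hideal_hom_iff: 
  assumes "hfamily P" "x \<in> Sg n"
  shows "x \<in> hideal P \<longleftrightarrow> x \<in> P n"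
  using assms Mg_closed(1) hfamilyD(2)[OF assms(1)] by (auto simp: hideal_def comp_homogeneous)

lemma ideal_hideal:
  assumes P: "hfamily P"
  shows "ideal (hideal P) S"
proof -
  note p = hfamilyD[OF P]
  have z: "\<zero> \<in> hideal P" using p(2) by (simp add: hideal_def)
  have a: "x \<oplus> y \<in> hideal P" if "x \<in> hideal P" "y \<in> hideal P" for x y
    using that p(3) by (auto simp: hideal_def comp_add)
  have m: "s \<otimes> x \<in> hideal P" if "s \<in> carrier S" "x \<in> hideal P" for s x
    using that(1)
  proof (induction rule: graded_induct)
    case zero
    show ?case using that z by (simp add: hideal_def)
  next
    case (add s t)
    then show ?case using that a by (simp add: hideal_def l_distr)
  next
    case (hom k s)
    have xc: "x \<in> carrier S" using that by (simp add: hideal_def)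
    have "comp c (s \<otimes> x) \<in> P c" for c
    proof (cases "k \<le> c")
      case True
      have "s \<otimes> comp (deg_diff c k) x \<in> P (deg_add k (deg_diff c k))"
        using p(4)[OF hom] that(2) by (simp add: hideal_def)
      then show ?thesis using comp_mult_hom[OF hom xc, of c] True deg_add_diff[OF True] by simp
    qed (simp add: comp_mult_hom[OF hom xc] p(2))
    then show ?case using Mg_closed(1)[OF hom] xc by (simp add: hideal_def)
  qed
  have i: "\<ominus> x \<in> hideal P" if "x \<in> hideal P" for x
  proof -
    have "\<ominus> x = (\<ominus> \<one>) \<otimes> x" using that by (simp add: hideal_def l_minus)
    then show ?thesis using m[OF _ that, of "\<ominus> \<one>"] by simp
  qed
  have "subgroup (hideal P) (add_monoid S)"
    using z a i by unfold_locales (auto simp: hideal_def a_inv_def[symmetric])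
  then show ?thesis
  proof (intro idealI ring_axioms)
    show "a \<otimes> x \<in> hideal P" if "a \<in> hideal P" "x \<in> carrier S" for a x
      using m[OF that(2,1)] m_comm[of a x] that by (simp add: hideal_def)
  qed (use m in auto)
qed

lemma homogeneous_hideal:
  assumes P: "hfamily P"
  shows "homogeneous_ideal S Sg (hideal P)"
  unfolding homogeneous_ideal_def
proof (intro conjI equalityI)
  show I: "ideal (hideal P) S" by (rule ideal_hideal[OF P])
  let ?H = "hideal P \<inter> (\<Union>n. Sg n)"
  have Hc: "?H \<subseteq> carrier S" by (auto simp: hideal_def)
  show "genideal S ?H \<subseteq> hideal P" by (rule genideal_minimal[OF I]) simp
  interpret J: ideal "genideal S ?H" S by (rule genideal_ideal[OF Hc])
  show "hideal P \<subseteq> genideal S ?H"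
  proof
    fix x assume x: "x \<in> hideal P"
    show "x \<in> genideal S ?H"
    proof (rule mem_if_comps_mem)
      show xc: "x \<in> carrier S" using x by (simp add: hideal_def)
      fix n
      have "comp n x \<in> hideal P"
        using hideal_hom_iff[OF P comp_in[OF xc]] x by (simp add: hideal_def)
      then show "comp n x \<in> genideal S ?H"
        using genideal_self[OF Hc] comp_in[OF xc] by blast
    qed (use J.a_subset in auto)
  qed
qed

text \<open>A pair \<open>(m, n)\<close> maximizing the square norm of \<open>m + n\<close> over \<open>F \<times> G\<close> is the only one with its sum: if
  \<open>m + n = m' + n'\<close> with \<open>m \<noteq> m'\<close>, then \<open>m + n'\<close> or \<open>m' + n\<close> would be longer by the parallelogram identity.\<close>

lemma exists_unique_degree_sum:
  fixes F G :: "('d \<Rightarrow> nat) set"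
  assumes "finite F" "finite G" "F \<noteq> {}" "G \<noteq> {}"
  obtains m n where "m \<in> F" "n \<in> G"
    "\<And>m' n'. m' \<in> F \<Longrightarrow> n' \<in> G \<Longrightarrow> deg_add m' n' = deg_add m n \<Longrightarrow> m' = m"
proof -
  define q where "q p = (\<Sum>i\<in>UNIV. (int (fst p i) + int (snd p i))\<^sup>2)" for p :: "('d \<Rightarrow> nat) \<times> ('d \<Rightarrow> nat)"
  have "Max (q ` (F \<times> G)) \<in> q ` (F \<times> G)" using assms by (intro Max_in) auto
  then obtain m n where mn: "m \<in> F" "n \<in> G" "q (m, n) = Max (q ` (F \<times> G))" by auto
  have max: "q (m', n') \<le> q (m, n)" if "m' \<in> F" "n' \<in> G" for m' n'
    unfolding mn(3) using assms that by (intro Max_ge) auto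
  have "m' = m" if *: "m' \<in> F" "n' \<in> G" "deg_add m' n' = deg_add m n" for m' n'
  proof (rule ccontr)
    assume "m' \<noteq> m"
    have eq: "int (m' i) + int (n' i) = int (m i) + int (n i)" for i
      using fun_cong[OF *(3), of i] by (simp add: deg_add_def)
    have "q (m, n') + q (m', n) = (\<Sum>i\<in>UNIV. 2 * (int (m i) + int (n i))\<^sup>2 + 2 * (int (m' i) - int (m i))\<^sup>2)"
      unfolding q_def sum.distrib[symmetric]
    proof (rule sum.cong)
      fix i
      have n': "int (n' i) = int (m i) + int (n i) - int (m' i)" using eq[of i] by simp
      show "(int (fst (m, n') i) + int (snd (m, n') i))\<^sup>2 + (int (fst (m', n) i) + int (snd (m', n) i))\<^sup>2 =
          2 * (int (m i) + int (n i))\<^sup>2 + 2 * (int (m' i) - int (m i))\<^sup>2"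
        by (simp add: n' power2_eq_square algebra_simps)
    qed simp
    also have "\<dots> = 2 * q (m, n) + 2 * (\<Sum>i\<in>UNIV. (int (m' i) - int (m i))\<^sup>2)"
      by (simp add: q_def sum.distrib sum_distrib_left)
    finally have "(\<Sum>i\<in>UNIV. (int (m' i) - int (m i))\<^sup>2) \<le> 0"
      using max[OF mn(1) *(2)] max[OF *(1) mn(2)] by simp
    moreover obtain i where "m' i \<noteq> m i" using \<open>m' \<noteq> m\<close> by blast
    then have "(\<Sum>i\<in>UNIV. (int (m' i) - int (m i))\<^sup>2) > 0" by (intro sum_pos2[of _ i]) auto
    ultimately show False by simp
  qed
  with mn(1,2) show thesis by (rule that)
qed

text \<open>Take the degrees of
  the components of \<open>x\<close> and of \<open>y\<close> outside \<open>P\<close> and a sum of two of them that arises in only one way: modulo \<open>P\<close>, the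
  component of \<open>x y\<close> in this degree is a single product.\<close>

lemma prime_hideal:
  assumes P: "hfamily P" and one: "\<one> \<notin> P (\<lambda>_. 0)"
    and prime: "\<And>k n a b. a \<in> Sg k \<Longrightarrow> b \<in> Sg n \<Longrightarrow> a \<otimes> b \<in> P (deg_add k n) \<Longrightarrow> a \<in> P k \<or> b \<in> P n"
  shows "primeideal (hideal P) S"
proof (rule primeidealI)
  show "ideal (hideal P) S" by (rule ideal_hideal[OF P])
  show "cring S" by (rule cring_axioms)
  show "carrier S \<noteq> hideal P" using one hideal_hom_iff[OF P one_hom] by auto
  note p = hfamilyD[OF P]
  fix x y assume xy: "x \<in> carrier S" "y \<in> carrier S" "x \<otimes> y \<in> hideal P"
  show "x \<in> hideal P \<or> y \<in> hideal P"
  proof (rule ccontr)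
    assume not: "\<not> (x \<in> hideal P \<or> y \<in> hideal P)"
    let ?F = "{n. comp n x \<notin> P n}" and ?G = "{n. comp n y \<notin> P n}"
    have "?F \<noteq> {}" "?G \<noteq> {}" using not xy(1,2) by (auto simp: hideal_def)
    moreover have "?F \<subseteq> {n. comp n x \<noteq> \<zero>}" "?G \<subseteq> {n. comp n y \<noteq> \<zero>}" using p(2) by auto
    then have "finite ?F" "finite ?G" using finite_comp[OF xy(1)] finite_comp[OF xy(2)] finite_subset by auto
    ultimately obtain m n where mn: "m \<in> ?F" "n \<in> ?G"
      and uniq: "\<And>m' n'. m' \<in> ?F \<Longrightarrow> n' \<in> ?G \<Longrightarrow> deg_add m' n' = deg_add m n \<Longrightarrow> m' = m"
      using exists_unique_degree_sum[of ?F ?G] by blast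
    let ?c = "deg_add m n"
    let ?X = "insert m {n. comp n x \<noteq> \<zero>}"
    have finX: "finite ?X" using finite_comp[OF xy(1)] by simp
    have "x = finsum S (\<lambda>a. comp a x) ?X"
      using finsum_supp[OF finX comp_carrier[OF xy(1)]] finsum_comp[OF xy(1)] by auto
    then have "x \<otimes> y = finsum S (\<lambda>a. comp a x \<otimes> y) ?X"
      using finsum_ldistr[OF finX xy(2), of "\<lambda>a. comp a x"] comp_carrier[OF xy(1)] by auto
    then have e: "comp ?c (x \<otimes> y) = finsum S (\<lambda>a. comp ?c (comp a x \<otimes> y)) ?X"
      using comp_finsum[OF finX, of "\<lambda>a. comp a x \<otimes> y"] comp_carrier[OF xy(1)] xy(2) by simp
    have term_eq: "comp ?c (comp a x \<otimes> y) = (if a \<le> ?c then comp a x \<otimes> comp (deg_diff ?c a) y else \<zero>)" for a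
      by (rule comp_mult_hom[OF comp_in[OF xy(1)] xy(2)])
    have other: "comp ?c (comp a x \<otimes> y) \<in> P ?c" if "a \<noteq> m" for a
    proof (cases "a \<le> ?c")
      case True
      let ?b = "deg_diff ?c a"
      have ab: "deg_add a ?b = ?c" by (rule deg_add_diff[OF True])
      have "comp a x \<in> P a \<or> comp ?b y \<in> P ?b" using uniq[of a ?b] ab that by auto
      then have "comp a x \<otimes> comp ?b y \<in> P ?c"
      proof
        assume "comp a x \<in> P a"
        from p(4)[OF comp_in[OF xy(2)] this, of ?b]
        have "comp ?b y \<otimes> comp a x \<in> P ?c" using ab by (simp add: deg_add_commute)
        then show ?thesis using m_comm comp_carrier xy(1,2) by simp
      next
        assume "comp ?b y \<in> P ?b"
        from p(4)[OF comp_in[OF xy(1), of a] this] show ?thesis using ab by simp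
      qed
      then show ?thesis using term_eq True by simp
    qed (simp add: term_eq p(2))
    have Pc: "P ?c \<subseteq> carrier S" using p(1) Mg_closed(1) by blast
    have neg: "\<ominus> z \<in> P ?c" if "z \<in> P ?c" for z
    proof -
      have "\<ominus> \<one> \<in> Sg (\<lambda>_. 0)" by (rule Mg_closed(4)[OF one_hom])
      from p(4)[OF this that] have "(\<ominus> \<one>) \<otimes> z \<in> P ?c" by simp
      then show ?thesis using Pc that by (simp add: l_minus subset_iff)
    qed
    let ?r = "finsum S (\<lambda>a. comp ?c (comp a x \<otimes> y)) (?X - {m})"
    have r: "?r \<in> P ?c" by (rule finsum_mem) (use p(2,3) Pc other in auto)
    have tc: "comp ?c (comp a x \<otimes> y) \<in> carrier S" for a
      using comp_carrier[OF xy(1)] xy(2) by (intro comp_carrier) auto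
    have "comp ?c (x \<otimes> y) = comp ?c (comp m x \<otimes> y) \<oplus> ?r"
      unfolding e using finsum_insert[of "?X - {m}" m "\<lambda>a. comp ?c (comp a x \<otimes> y)"] finX tc
      by (simp add: insert_Diff_if)
    then have "comp ?c (comp m x \<otimes> y) = comp ?c (x \<otimes> y) \<oplus> \<ominus> ?r"
      using r Pc tc[of m] by (auto simp: a_assoc r_neg)
    moreover have "comp ?c (x \<otimes> y) \<in> P ?c" using xy(3) by (simp add: hideal_def)
    ultimately have "comp ?c (comp m x \<otimes> y) \<in> P ?c" using p(3) neg[OF r] by simp
    then have "comp m x \<otimes> comp n y \<in> P ?c" using term_eq[of m] by simp
    then show False using prime[OF comp_in[OF xy(1)] comp_in[OF xy(2)]] mn by blast
  qed
qed

end


section \<open>Standard graded modules over an Artinian ring\<close>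

locale standard_module = S: graded_ring S Sg + M: graded_group M Mg + module S M
  for A :: "('a, 'w) ring_scheme" and S :: "('a, 's, 'x) module_scheme"
    and Sg :: "('d::finite \<Rightarrow> nat) \<Rightarrow> 's set"
    and M :: "('s, 'm, 'y) module_scheme" (structure) and Mg :: "('d \<Rightarrow> nat) \<Rightarrow> 'm set" +
  assumes artinian: "artinian_ring A"
    and standard: "fg_standard_graded_algebra A S Sg"
    and graded: "graded_module S Sg M Mg"
    and fg: "fg_module S M"
begin

lemma smult_hom: "s \<in> Sg k \<Longrightarrow> m \<in> Mg n \<Longrightarrow> s \<odot> m \<in> Mg (deg_add k n)"
  using graded by (simp add: graded_module_def)

lemma comp_smult:
  assumes "s \<in> Sg k" "x \<in> carrier M"
  shows "M.comp c (s \<odot> x) = (if k \<le> c then s \<odot> M.comp (deg_diff c k) x else \<zero>)"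
  by (rule comp_shift[where Mg = Mg and f = "\<lambda>x. s \<odot> x"])
    (use assms S.Mg_closed(1) smult_hom M.graded_group_axioms in \<open>auto simp: smult_r_distr\<close>)

text \<open>The structure map \<open>A \<rightarrow> S\<close>, through which \<open>A\<close> acts on \<open>M\<close>.\<close>

definition sc :: "'a \<Rightarrow> 's" where
  "sc a = a \<odot>\<^bsub>S\<^esub> \<one>\<^bsub>S\<^esub>"

definition A_ops :: "('m \<Rightarrow> 'm) set" where
  "A_ops = (\<lambda>a m. sc a \<odot> m) ` carrier A"

lemma algebra: "algebra A S"
  using standard by (simp add: fg_standard_graded_algebra_def graded_algebra_def)

lemma sc_closed: "a \<in> carrier A \<Longrightarrow> sc a \<in> Sg (\<lambda>_. 0)" "a \<in> carrier A \<Longrightarrow> sc a \<in> carrier S"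
proof -
  interpret AS: algebra A S by (rule algebra)
  have "submodule (Sg (\<lambda>_. 0)) A S"
    using standard by (simp add: fg_standard_graded_algebra_def graded_algebra_def)
  then show "sc a \<in> Sg (\<lambda>_. 0)" if "a \<in> carrier A"
    using AS.submoduleE(4) that S.one_hom by (simp add: sc_def)
  then show "sc a \<in> carrier S" if "a \<in> carrier A"
    using that S.Mg_closed(1) by blast
qed

lemma sc_hom:
  assumes "a \<in> carrier A" "b \<in> carrier A"
  shows "sc (a \<oplus>\<^bsub>A\<^esub> b) = sc a \<oplus>\<^bsub>S\<^esub> sc b" "sc (a \<otimes>\<^bsub>A\<^esub> b) = sc a \<otimes>\<^bsub>S\<^esub> sc b"
proof -
  interpret AS: algebra A S by (rule algebra)
  show "sc (a \<oplus>\<^bsub>A\<^esub> b) = sc a \<oplus>\<^bsub>S\<^esub> sc b" using assms by (simp add: sc_def AS.smult_l_distr)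
  show "sc (a \<otimes>\<^bsub>A\<^esub> b) = sc a \<otimes>\<^bsub>S\<^esub> sc b"
    using assms AS.smult_assoc2[of a "\<one>\<^bsub>S\<^esub>" "b \<odot>\<^bsub>S\<^esub> \<one>\<^bsub>S\<^esub>"] by (simp add: sc_def AS.smult_assoc1)
qed

lemma sc_simps [simp]: "sc \<one>\<^bsub>A\<^esub> = \<one>\<^bsub>S\<^esub>" "sc \<zero>\<^bsub>A\<^esub> = \<zero>\<^bsub>S\<^esub>"
proof -
  interpret AS: algebra A S by (rule algebra)
  show "sc \<one>\<^bsub>A\<^esub> = \<one>\<^bsub>S\<^esub>" "sc \<zero>\<^bsub>A\<^esub> = \<zero>\<^bsub>S\<^esub>" by (simp_all add: sc_def)
qed

sublocale L: op_group M A_ops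
  by unfold_locales (auto simp: A_ops_def sc_closed smult_r_distr)

lemma L_opsub_smult: "L.opsub U \<Longrightarrow> a \<in> carrier A \<Longrightarrow> x \<in> U \<Longrightarrow> sc a \<odot> x \<in> U"
  using L.opsubD(5)[of U "\<lambda>m. sc a \<odot> m" x] by (auto simp: A_ops_def)

lemma neg_smult: "x \<in> carrier M \<Longrightarrow> \<ominus> x = (\<ominus>\<^bsub>S\<^esub> \<one>\<^bsub>S\<^esub>) \<odot> x"
  by (simp add: smult_l_minus)

section \<open>Finiteness\<close>

text \<open>A chain of submodules of \<open>A m\<close> pulls back to a chain of ideals of \<open>A\<close>.\<close>

lemma cyclic_finite_len:
  assumes m: "m \<in> carrier M"
  shows "L.opsub ((\<lambda>a. sc a \<odot> m) ` carrier A)" "L.len {\<zero>} ((\<lambda>a. sc a \<odot> m) ` carrier A) \<noteq> \<infinity>"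
proof -
  interpret A: cring A using artinian by (simp add: artinian_ring_def)
  interpret O: op_group A "mult_ops A" by (rule A.op_group_mult)
  let ?V = "(\<lambda>a. sc a \<odot> m) ` carrier A"
  have add: "sc (a \<oplus>\<^bsub>A\<^esub> b) \<odot> m = sc a \<odot> m \<oplus> sc b \<odot> m" if "a \<in> carrier A" "b \<in> carrier A" for a b
    using that m by (simp add: sc_hom sc_closed smult_l_distr)
  have mult: "sc (a \<otimes>\<^bsub>A\<^esub> b) \<odot> m = sc a \<odot> (sc b \<odot> m)" if "a \<in> carrier A" "b \<in> carrier A" for a b
    using that m by (simp add: sc_hom sc_closed smult_assoc1)
  have zero: "sc \<zero>\<^bsub>A\<^esub> \<odot> m = \<zero>" using m by simp
  have neg: "sc (\<ominus>\<^bsub>A\<^esub> a) \<odot> m = \<ominus> (sc a \<odot> m)" if a: "a \<in> carrier A" for a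
  proof -
    have "sc (\<ominus>\<^bsub>A\<^esub> a) \<odot> m \<oplus> sc a \<odot> m = \<zero>"
      using add[of "\<ominus>\<^bsub>A\<^esub> a" a] a zero by (simp add: A.l_neg)
    then show ?thesis using a m by (simp add: M.minus_equality sc_closed)
  qed
  show V: "L.opsub ?V"
  proof (rule L.opsubI)
    show "?V \<subseteq> carrier M" using m sc_closed by auto
    show "\<zero> \<in> ?V" using zero by (metis A.zero_closed imageI)
    fix x assume "x \<in> ?V"
    then obtain a where a: "a \<in> carrier A" "x = sc a \<odot> m" by blast
    show "\<ominus> x \<in> ?V" using neg[OF a(1)] a by (metis A.a_inv_closed imageI)
    show "\<theta> x \<in> ?V" if "\<theta> \<in> A_ops" for \<theta>
      using that a mult by (auto simp: A_ops_def) (metis A.m_closed imageI)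
    fix y assume "y \<in> ?V"
    then obtain b where b: "b \<in> carrier A" "y = sc b \<odot> m" by blast
    show "x \<oplus> y \<in> ?V" using add[OF a(1) b(1)] a b by (metis A.add.m_closed imageI)
  qed
  have "L.len {\<zero>} ?V \<le> O.len {\<zero>\<^bsub>A\<^esub>} (carrier A)"
    unfolding L.len_def O.len_def
  proof (rule SUP_subset_mono)
    show "chain_lengths (L.ival {\<zero>} ?V) \<subseteq> chain_lengths (O.ival {\<zero>\<^bsub>A\<^esub>} (carrier A))"
    proof (rule chain_lengths_image_subset[where \<phi> = "\<lambda>W. {a \<in> carrier A. sc a \<odot> m \<in> W}"])
      fix W assume "W \<in> L.ival {\<zero>} ?V"
      then have W: "L.opsub W" by (simp add: L.ival_def)
      have "O.opsub {a \<in> carrier A. sc a \<odot> m \<in> W}"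
      proof (rule O.opsubI)
        show "\<theta> a \<in> {a \<in> carrier A. sc a \<odot> m \<in> W}"
          if "\<theta> \<in> mult_ops A" "a \<in> {a \<in> carrier A. sc a \<odot> m \<in> W}" for \<theta> a
          using that mult L_opsub_smult[OF W] by (auto simp: mult_ops_def)
      qed (use add zero neg L.opsubD[OF W] in auto)
      then show "{a \<in> carrier A. sc a \<odot> m \<in> W} \<in> O.ival {\<zero>\<^bsub>A\<^esub>} (carrier A)"
        using L.opsubD(2)[OF W] zero by (auto simp: O.ival_def)
    next
      fix X Y assume XY: "X \<in> L.ival {\<zero>} ?V" "Y \<in> L.ival {\<zero>} ?V" "X \<subset> Y"
      then obtain y where y: "y \<in> Y" "y \<notin> X" by blast
      moreover have "Y \<subseteq> ?V" using XY(2) by (simp add: L.ival_def)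
      ultimately obtain a where "a \<in> carrier A" "y = sc a \<odot> m" by blast
      then have "a \<in> {a \<in> carrier A. sc a \<odot> m \<in> Y}" "a \<notin> {a \<in> carrier A. sc a \<odot> m \<in> X}"
        using y by auto
      then show "{a \<in> carrier A. sc a \<odot> m \<in> X} \<subset> {a \<in> carrier A. sc a \<odot> m \<in> Y}"
        using XY(3) by blast
    qed
  qed simp
  then show "L.len {\<zero>} ?V \<noteq> \<infinity>"
    using artinian_finite_length[OF artinian] by (metis enat_ord_simps(5))
qed

lemma mem_cyclic: "m \<in> carrier M \<Longrightarrow> m \<in> (\<lambda>a. sc a \<odot> m) ` carrier A"
proof -
  interpret A: cring A using artinian by (simp add: artinian_ring_def)
  assume "m \<in> carrier M"
  then have "m = sc \<one>\<^bsub>A\<^esub> \<odot> m" by simp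
  then show ?thesis by (metis A.one_closed imageI)
qed

lemma finite_len_ssum:
  assumes U: "L.opsub U" and V: "L.opsub V" and "L.len {\<zero>} U \<noteq> \<infinity>" "L.len {\<zero>} V \<noteq> \<infinity>"
  shows "L.len {\<zero>} (L.ssum U V) \<noteq> \<infinity>"
proof -
  have "L.len {\<zero>} (L.ssum U V) = L.len {\<zero>} U + L.len U (L.ssum U V)"
    by (rule L.len_additive) (use U V L.opsubD(2)[OF U] in
        \<open>auto simp: L.opsub_zero L.opsub_ssum L.ssum_upper1\<close>)
  moreover have "L.len U (L.ssum U V) = L.len (U \<inter> V) V" using L.len_ssum[OF U V] by simp
  moreover have "L.len (U \<inter> V) V \<noteq> \<infinity>"
    using L.len_finite_mono[OF L.opsub_zero L.opsub_Int[OF U V] V V] assms L.opsubD(2) by auto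
  ultimately show ?thesis using assms(3) by (simp add: enat_add_eq_infty_iff)
qed

lemma finite_span:
  assumes "finite X" "X \<subseteq> carrier M"
  obtains U where "L.opsub U" "X \<subseteq> U" "L.len {\<zero>} U \<noteq> \<infinity>"
proof -
  have "\<exists>U. L.opsub U \<and> X \<subseteq> U \<and> L.len {\<zero>} U \<noteq> \<infinity>"
    using assms
  proof (induction X)
    case empty
    show ?case using L.opsub_zero L.len_self[of "{\<zero>}"] by (intro exI[of _ "{\<zero>}"]) simp
  next
    case (insert x X)
    then obtain U where U: "L.opsub U" "X \<subseteq> U" "L.len {\<zero>} U \<noteq> \<infinity>" by auto
    let ?V = "(\<lambda>a. sc a \<odot> x) ` carrier A"
    have x: "x \<in> carrier M" using insert.prems by simp
    have "x \<in> ?V" "L.opsub ?V" by (rule mem_cyclic[OF x], rule cyclic_finite_len(1)[OF x])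
    then have "insert x X \<subseteq> L.ssum U ?V"
      using L.ssum_upper1[OF U(1), of ?V] L.ssum_upper2[OF U(1), of ?V] U(2) by blast
    then show ?case
      using finite_len_ssum[OF U(1) cyclic_finite_len(1)[OF x] U(3) cyclic_finite_len(2)[OF x]]
        L.opsub_ssum[OF U(1) cyclic_finite_len(1)[OF x]] by blast
  qed
  then show thesis using that by blast
qed

text \<open>\<open>M\<close> is generated by finitely many elements under the action of \<open>A\<close> and of the finitely many
  algebra generators of \<open>S\<close>.  The \<open>A\<close>-span of the module generators has finite length, so Hilbert's basis theorem applies.\<close>

lemma acc_submodules:
  fixes N :: "nat \<Rightarrow> 'm set"
  assumes "\<And>t. submodule (N t) S M" "\<And>t. N t \<subseteq> N (Suc t)"
  obtains t0 where "\<And>t. t \<ge> t0 \<Longrightarrow> N t = N t0"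
proof -
  obtain X where X: "finite X" "X \<subseteq> carrier S" "carrier S = algebra_gen A S X"
    using standard unfolding fg_standard_graded_algebra_def by blast
  obtain B where B: "finite B" "B \<subseteq> carrier M" "carrier M = submodule_gen S M B"
    using fg unfolding fg_module_def by blast
  obtain M0 where M0: "L.opsub M0" "B \<subseteq> M0" "L.len {\<zero>} M0 \<noteq> \<infinity>"
    using finite_span[OF B(1,2)] .
  let ?Y = "(\<lambda>x m. x \<odot> m) ` X"
  have comm: "y (z m) = z (y m)" if yz: "y \<in> ?Y" "z \<in> ?Y \<union> A_ops" "m \<in> carrier M" for y z m
  proof -
    have "\<exists>s\<in>carrier S. y = (\<lambda>m. s \<odot> m)" using yz(1) X(2) by auto
    moreover have "\<exists>t\<in>carrier S. z = (\<lambda>m. t \<odot> m)"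
      using yz(2) X(2) sc_closed(2) by (auto simp: A_ops_def)
    ultimately show ?thesis using yz(3) by (auto simp: smult_assoc1[symmetric] S.m_comm)
  qed
  obtain V where V: "M0 \<subseteq> V" "op_group M (?Y \<union> A_ops)" "op_group.opsub M (?Y \<union> A_ops) V"
      "op_group.acc_below M (?Y \<union> A_ops) V"
    by (rule hilbert_basis[OF L.op_group_axioms M0(1) L.finite_len_imp_acc[OF M0(1,3)], of ?Y])
       (use X comm in \<open>auto simp: smult_r_distr subset_iff\<close>)
  interpret O: op_group M "?Y \<union> A_ops" by (rule V(2))
  note v = O.opsubD[OF V(3)]
  have "s \<odot> x \<in> V" if "s \<in> generate_ring S ({a \<odot>\<^bsub>S\<^esub> \<one>\<^bsub>S\<^esub> |a. a \<in> carrier A} \<union> X)" "x \<in> V" for s x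
    using that
  proof (induction arbitrary: x)
    case one
    then show ?case using v(1) by simp
  next
    case (incl h)
    then consider a where "a \<in> carrier A" "h = sc a" | "h \<in> X" by (auto simp: sc_def)
    then show ?case
      by cases (use v(5)[of "\<lambda>m. h \<odot> m" x] incl.prems in \<open>auto simp: A_ops_def\<close>)
  next
    case (a_inv h)
    have "h \<in> carrier S" using a_inv.hyps X(3) by (simp add: algebra_gen_def)
    then show ?case using a_inv v by (simp add: smult_l_minus)
  next
    case (eng_add s t)
    have "s \<in> carrier S" "t \<in> carrier S" using eng_add.hyps X(3) by (simp_all add: algebra_gen_def)
    then show ?case using eng_add v by (simp add: smult_l_distr)
  next
    case (eng_mult s t)
    have "s \<in> carrier S" "t \<in> carrier S" using eng_mult.hyps X(3) by (simp_all add: algebra_gen_def)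
    then show ?case using eng_mult v by (simp add: smult_assoc1)
  qed
  then have "submodule V S M"
    using v X(3) by (intro submoduleI) (auto simp: algebra_gen_def)
  then have top: "V = carrier M"
    using B(3) M0(2) V(1) v(1) unfolding submodule_gen_def by blast
  have "O.opsub U" if U: "submodule U S M" for U
    using submoduleE[OF U] X(2) sc_closed submodule.axioms(1)[OF U, THEN subgroup.one_closed]
    by (intro O.opsubI) (auto simp: A_ops_def subset_iff)
  then show thesis
    using O.acc_belowD[OF V(4), of N] assms that submoduleE(1) unfolding top by metis
qed

section \<open>The degree-zero part and the ideal of a direction\<close>

text \<open>The elements whose component of degree zero comes from \<open>A\<close> form a subring that contains all generators of
  degree one.\<close>

lemma Sg_0: "s \<in> Sg (\<lambda>_. 0) \<Longrightarrow> \<exists>a\<in>carrier A. s = sc a"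
proof -
  interpret A: cring A using artinian by (simp add: artinian_ring_def)
  interpret AS: algebra A S by (rule algebra)
  have "\<exists>a\<in>carrier A. S.comp (\<lambda>_. 0) x = sc a"
    if "x \<in> generate_ring S ({a \<odot>\<^bsub>S\<^esub> \<one>\<^bsub>S\<^esub> |a. a \<in> carrier A} \<union> (\<Union>i. Sg (unit_deg i)))" for x
    using that
  proof induction
    case one
    then show ?case using S.comp_homogeneous[OF S.one_hom] by (auto intro!: bexI[of _ "\<one>\<^bsub>A\<^esub>"])
  next
    case (incl h)
    then consider a where "a \<in> carrier A" "h = sc a" | i where "h \<in> Sg (unit_deg i)" by (auto simp: sc_def)
    then show ?case
    proof cases
      case 1
      then show ?thesis using S.comp_homogeneous[OF sc_closed(1)] by auto
    next
      case 2
      have "(\<lambda>_. 0) \<noteq> unit_deg i" by (metis unit_deg_def zero_neq_one)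
      then show ?thesis using S.comp_homogeneous[OF 2] by (auto intro!: bexI[of _ "\<zero>\<^bsub>A\<^esub>"])
    qed
  next
    case (a_inv h)
    then obtain a where a: "a \<in> carrier A" "S.comp (\<lambda>_. 0) h = sc a" by blast
    have "h \<in> carrier S" using a_inv.hyps standard by (simp add: fg_standard_graded_algebra_def algebra_gen_def)
    then have "S.comp (\<lambda>_. 0) (\<ominus>\<^bsub>S\<^esub> h) = sc (\<ominus>\<^bsub>A\<^esub> a)"
      using a by (simp add: S.comp_minus sc_def AS.smult_l_minus)
    then show ?case using a(1) by blast
  next
    case (eng_add s t)
    have "s \<in> carrier S" "t \<in> carrier S"
      using eng_add.hyps standard by (simp_all add: fg_standard_graded_algebra_def algebra_gen_def)
    then show ?case using eng_add.IH sc_hom(1) by (auto simp: S.comp_add) (metis A.add.m_closed)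
  next
    case (eng_mult s t)
    have c: "s \<in> carrier S" "t \<in> carrier S"
      using eng_mult.hyps standard by (simp_all add: fg_standard_graded_algebra_def algebra_gen_def)
    have "S.comp (\<lambda>_. 0) (s \<otimes>\<^bsub>S\<^esub> t) = S.comp (\<lambda>_. 0) s \<otimes>\<^bsub>S\<^esub> S.comp (\<lambda>_. 0) t"
      using c(1)
    proof (induction rule: S.graded_induct)
      case zero
      then show ?case using c S.comp_carrier by simp
    next
      case (add x y)
      then show ?case using c S.comp_carrier by (simp add: S.l_distr S.comp_add)
    next
      case (hom n x)
      have "n \<le> (\<lambda>_. 0) \<longleftrightarrow> n = (\<lambda>_. 0)" by (auto simp: le_fun_def)
      moreover have "deg_diff (\<lambda>_. 0) (\<lambda>_. 0) = (\<lambda>_::'d. 0)" by (simp add: deg_diff_def)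
      ultimately show ?case
        using c S.comp_mult_hom[OF hom c(2), of "\<lambda>_. 0"] S.comp_homogeneous[OF hom, of "\<lambda>_. 0"] S.comp_carrier
        by auto
    qed
    then show ?case using eng_mult.IH sc_hom(2) by auto (metis A.m_closed)
  qed
  moreover have "carrier S = generate_ring S ({a \<odot>\<^bsub>S\<^esub> \<one>\<^bsub>S\<^esub> |a. a \<in> carrier A} \<union> (\<Union>i. Sg (unit_deg i)))"
    using standard by (simp add: fg_standard_graded_algebra_def algebra_gen_def)
  moreover assume s: "s \<in> Sg (\<lambda>_. 0)"
  ultimately have "\<exists>a\<in>carrier A. S.comp (\<lambda>_. 0) s = sc a" using S.Mg_closed(1) by metis
  then show ?thesis using S.comp_homogeneous[OF s] by simp
qed

text \<open>The elements all of whose components of degree positive in the direction \<open>i\<close> lie in the ideal \<open>P\<close> form a subring: if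
  \<open>a + b\<close> is positive in this direction, then so is \<open>a\<close> or \<open>b\<close>.  This subring contains the generators of degree one.\<close>

lemma direction_generates:
  assumes P: "S.hfamily P" and i: "Sg (unit_deg i) \<subseteq> P (unit_deg i)" and n: "n i \<noteq> 0"
  shows "Sg n \<subseteq> P n"
proof
  note p = S.hfamilyD[OF P]
  interpret I: ideal "S.hideal P" S by (rule S.ideal_hideal[OF P])
  have cong: "\<forall>c. c i \<noteq> 0 \<longrightarrow> S.comp c x \<in> P c"
    if "x \<in> generate_ring S ({a \<odot>\<^bsub>S\<^esub> \<one>\<^bsub>S\<^esub> |a. a \<in> carrier A} \<union> (\<Union>i. Sg (unit_deg i)))" for x
    using that
  proof induction
    case one
    then show ?case using S.comp_homogeneous[OF S.one_hom] p(2) by auto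
  next
    case (incl h)
    then consider a where "a \<in> carrier A" "h = sc a" | j where "h \<in> Sg (unit_deg j)" by (auto simp: sc_def)
    then show ?case
    proof cases
      case 1
      then show ?thesis using S.comp_homogeneous[OF sc_closed(1)] p(2) by auto
    next
      case 2
      show ?thesis
      proof (intro allI impI)
        fix c :: "'d \<Rightarrow> nat" assume c: "c i \<noteq> 0"
        show "S.comp c h \<in> P c"
        proof (cases "c = unit_deg j")
          case True
          with c have "i = j" by (auto simp: unit_deg_def split: if_splits)
          then show ?thesis using True i 2 S.comp_homogeneous[OF 2, of c] by auto
        qed (simp add: S.comp_homogeneous[OF 2] p(2))
      qed
    qed
  next
    case (a_inv h)
    have "h \<in> carrier S" using a_inv.hyps standard by (simp add: fg_standard_graded_algebra_def algebra_gen_def)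
    moreover have "\<ominus>\<^bsub>S\<^esub> y \<in> P c" if "y \<in> P c" for y c
    proof -
      have y: "y \<in> Sg c" using p(1) that .
      then have "y \<in> S.hideal P" using S.hideal_hom_iff[OF P y] that by simp
      then have "\<ominus>\<^bsub>S\<^esub> y \<in> S.hideal P" by (rule I.a_inv_closed)
      then show ?thesis using S.hideal_hom_iff[OF P S.Mg_closed(4)[OF y]] by simp
    qed
    ultimately show ?case using a_inv.IH by (simp add: S.comp_minus)
  next
    case (eng_add s t)
    have "s \<in> carrier S" "t \<in> carrier S"
      using eng_add.hyps standard by (simp_all add: fg_standard_graded_algebra_def algebra_gen_def)
    then show ?case using eng_add.IH p(3) by (simp add: S.comp_add)
  next
    case (eng_mult s t)
    have c: "s \<in> carrier S" "t \<in> carrier S"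
      using eng_mult.hyps standard by (simp_all add: fg_standard_graded_algebra_def algebra_gen_def)
    have tc: "S.comp b t \<in> P b" if "b i \<noteq> 0" for b using eng_mult.IH(2) that by blast
    let ?Z = "{x \<in> carrier S. \<forall>c. c i \<noteq> 0 \<longrightarrow> S.comp c (x \<otimes>\<^bsub>S\<^esub> t) \<in> P c}"
    have "s \<in> ?Z"
    proof (rule S.mem_if_comps_mem[OF c(1)])
      show "\<zero>\<^bsub>S\<^esub> \<in> ?Z" using c p(2) by simp
      show "x \<oplus>\<^bsub>S\<^esub> y \<in> ?Z" if "x \<in> ?Z" "y \<in> ?Z" for x y
        using that c p(3) by (simp add: S.l_distr S.comp_add)
      show "S.comp n s \<in> ?Z" for n
      proof (intro CollectI conjI allI impI)
        show nc: "S.comp n s \<in> carrier S" by (rule S.comp_carrier[OF c(1)])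
        fix b :: "'d \<Rightarrow> nat" assume b: "b i \<noteq> 0"
        have "S.comp n s \<otimes>\<^bsub>S\<^esub> S.comp (deg_diff b n) t \<in> P b" if nb: "n \<le> b"
        proof (cases "n i = 0")
          case True
          then have "S.comp (deg_diff b n) t \<in> P (deg_diff b n)" using b by (intro tc) (simp add: deg_diff_def)
          from p(4)[OF S.comp_in[OF c(1), of n] this] show ?thesis using deg_add_diff[OF nb] by simp
        next
          case False
          then have "S.comp n s \<in> P n" using eng_mult.IH(1) by blast
          from p(4)[OF S.comp_in[OF c(2), of "deg_diff b n"] this]
          have "S.comp (deg_diff b n) t \<otimes>\<^bsub>S\<^esub> S.comp n s \<in> P b"
            using deg_add_diff[OF nb] by (simp add: deg_add_commute)
          then show ?thesis using S.m_comm S.comp_carrier c by simp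
        qed
        then show "S.comp b (S.comp n s \<otimes>\<^bsub>S\<^esub> t) \<in> P b"
          using S.comp_mult_hom[OF S.comp_in[OF c(1)] c(2), of b n] p(2) by auto
      qed
    qed auto
    then show ?case by blast
  qed
  fix s assume s: "s \<in> Sg n"
  have "carrier S = generate_ring S ({a \<odot>\<^bsub>S\<^esub> \<one>\<^bsub>S\<^esub> |a. a \<in> carrier A} \<union> (\<Union>i. Sg (unit_deg i)))"
    using standard by (simp add: fg_standard_graded_algebra_def algebra_gen_def)
  then have "S.comp n s \<in> P n" using cong[of s] S.Mg_closed(1)[OF s] n by blast
  then show "s \<in> P n" using S.comp_homogeneous[OF s] by simp
qed

end


section \<open>Graded submodules and devissage\<close>

lemma deg_add_left_commute: "deg_add k (deg_add m n) = deg_add m (deg_add k n)"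
  by (simp add: deg_add_def add.left_commute)

lemmas deg_ac = deg_add_assoc deg_add_commute deg_add_left_commute

lemma deg_add_unit: "deg_add (unit_deg i) n = deg_succ i n"
  by (auto simp: deg_add_def unit_deg_def fun_eq_iff)

lemma deg_add_unit_pred: "n i \<noteq> 0 \<Longrightarrow> deg_add (unit_deg i) (deg_pred i n) = n"
  by (auto simp: deg_add_def unit_deg_def fun_eq_iff)

lemma deg_pred_add: "n i \<noteq> 0 \<Longrightarrow> deg_pred i (deg_add k n) = deg_add k (deg_pred i n)"
  by (auto simp: deg_add_def fun_eq_iff)

lemma deg_diff_add_left: "b \<le> n \<Longrightarrow> deg_diff (deg_add k n) b = deg_add k (deg_diff n b)"
  by (auto simp: deg_add_def deg_diff_def fun_eq_iff le_fun_def)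

context standard_module
begin

text \<open>A graded submodule is represented by the family of its pieces.  Inclusion is then the pointwise order, and
  since the lengths only concern pieces, the submodule itself (\<open>tot\<close> below) is needed only to use the chain condition and to compare
  with submodules that are given by generators.\<close>

definition gfam :: "(('d \<Rightarrow> nat) \<Rightarrow> 'm set) \<Rightarrow> bool" where
  "gfam N \<longleftrightarrow> (\<forall>n. N n \<subseteq> Mg n \<and> \<zero> \<in> N n \<and> (\<forall>x\<in>N n. \<forall>y\<in>N n. x \<oplus> y \<in> N n)) \<and>
     (\<forall>k n. \<forall>s\<in>Sg k. \<forall>m\<in>N n. s \<odot> m \<in> N (deg_add k n))"

lemma gfamI:
  assumes "\<And>n. N n \<subseteq> Mg n" "\<And>n. \<zero> \<in> N n" "\<And>n x y. x \<in> N n \<Longrightarrow> y \<in> N n \<Longrightarrow> x \<oplus> y \<in> N n"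
    "\<And>k n s m. s \<in> Sg k \<Longrightarrow> m \<in> N n \<Longrightarrow> s \<odot> m \<in> N (deg_add k n)"
  shows "gfam N"
  using assms unfolding gfam_def by blast

lemma gfamD:
  assumes "gfam N"
  shows "m \<in> N n \<Longrightarrow> m \<in> Mg n" "\<zero> \<in> N n" "x \<in> N n \<Longrightarrow> y \<in> N n \<Longrightarrow> x \<oplus> y \<in> N n"
    "s \<in> Sg k \<Longrightarrow> m \<in> N n \<Longrightarrow> s \<odot> m \<in> N (deg_add k n)" "m \<in> N n \<Longrightarrow> m \<in> carrier M"
  using assms M.Mg_closed(1) unfolding gfam_def by blast+

lemma gfam_neg:
  assumes "gfam N" "x \<in> N n"
  shows "\<ominus> x \<in> N n"
  using gfamD(4)[OF assms(1) S.Mg_closed(4)[OF S.one_hom] assms(2)] neg_smult gfamD(5)[OF assms] by simp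

lemma gfam_opsub: "gfam N \<Longrightarrow> L.opsub (N n)"
  using gfamD[of N] gfam_neg[of N] sc_closed(1)
  by (intro L.opsubI) (auto simp: A_ops_def, metis deg_add_0(1))

lemma gfam_Mg: "gfam Mg"
  by (rule gfamI) (use M.Mg_closed smult_hom in auto)

lemma gfam_zero: "gfam (\<lambda>_. {\<zero>})"
  by (rule gfamI) (use M.Mg_closed S.Mg_closed(1) in auto)

lemma gfam_leD: "N \<le> L \<Longrightarrow> x \<in> N n \<Longrightarrow> x \<in> L n" for N L :: "('d \<Rightarrow> nat) \<Rightarrow> 'm set"
  by (auto simp: le_fun_def)

lemma gfam_le_Mg: "gfam N \<Longrightarrow> N \<le> Mg"
  using gfamD(1) by (auto simp: le_fun_def)

definition tot :: "(('d \<Rightarrow> nat) \<Rightarrow> 'm set) \<Rightarrow> 'm set" where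
  "tot N = {x \<in> carrier M. \<forall>n. M.comp n x \<in> N n}"

lemma tot_hom_iff: "gfam N \<Longrightarrow> x \<in> Mg n \<Longrightarrow> x \<in> tot N \<longleftrightarrow> x \<in> N n"
  using gfamD(2) M.Mg_closed(1) by (auto simp: tot_def M.comp_homogeneous)

lemma submodule_tot:
  assumes N: "gfam N"
  shows "submodule (tot N) S M"
proof -
  note n = gfamD[OF N]
  have m: "s \<odot> x \<in> tot N" if "s \<in> carrier S" "x \<in> tot N" for s x
    using that(1)
  proof (induction rule: S.graded_induct)
    case zero
    show ?case using that n(2) by (simp add: tot_def)
  next
    case (add s t)
    then show ?case using that(2) n(3) by (simp add: tot_def smult_l_distr M.comp_add)
  next
    case (hom k s)
    have xc: "x \<in> carrier M" using that by (simp add: tot_def)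
    have "M.comp c (s \<odot> x) \<in> N c" for c
    proof (cases "k \<le> c")
      case True
      have "s \<odot> M.comp (deg_diff c k) x \<in> N (deg_add k (deg_diff c k))"
        using n(4)[OF hom] that(2) by (simp add: tot_def)
      then show ?thesis using comp_smult[OF hom xc, of c] True deg_add_diff[OF True] by simp
    qed (simp add: comp_smult[OF hom xc] n(2))
    then show ?case using S.Mg_closed(1)[OF hom] xc by (simp add: tot_def)
  qed
  show ?thesis
  proof (rule submoduleI)
    show "\<ominus> x \<in> tot N" if "x \<in> tot N" for x
      using m[OF _ that, of "\<ominus>\<^bsub>S\<^esub> \<one>\<^bsub>S\<^esub>"] neg_smult[of x] that by (simp add: tot_def)
  qed (use m n in \<open>auto simp: tot_def M.comp_add\<close>)
qed

lemma wf_gfam: "wf {(N', N). gfam N' \<and> gfam N \<and> N < N'}"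
  unfolding wf_iff_no_infinite_down_chain
proof
  assume "\<exists>f. \<forall>i. (f (Suc i), f i) \<in> {(N', N). gfam N' \<and> gfam N \<and> N < N'}"
  then obtain f :: "nat \<Rightarrow> ('d \<Rightarrow> nat) \<Rightarrow> 'm set"
    where f: "\<forall>i. (f (Suc i), f i) \<in> {(N', N). gfam N' \<and> gfam N \<and> N < N'}" ..
  then have f: "gfam (f i)" "f i < f (Suc i)" for i by auto
  have "tot (f t) \<subseteq> tot (f (Suc t))" for t
    using f(2)[of t] by (auto simp: tot_def less_fun_def le_fun_def)
  then obtain t0 where "\<And>t. t \<ge> t0 \<Longrightarrow> tot (f t) = tot (f t0)"
    using acc_submodules[of "\<lambda>t. tot (f t)"] submodule_tot[OF f(1)] by blast
  then have "tot (f (Suc t0)) = tot (f t0)" by (meson le_SucI order_refl)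
  moreover have "f t n = tot (f t) \<inter> Mg n" for t n
    using tot_hom_iff[OF f(1)] gfamD(1)[OF f(1)] by blast
  ultimately have "f (Suc t0) = f t0" by (metis ext)
  then show False using f(2)[of t0] by simp
qed

definition fill :: "('d \<Rightarrow> nat) \<Rightarrow> 'm set \<Rightarrow> ('d \<Rightarrow> nat) \<Rightarrow> 'm set" where
  "fill n U = (\<lambda>b. if b = n then U else if n \<le> b then Mg b else {\<zero>})"

text \<open>As \<open>S\<^sub>0\<close> is the image of \<open>A\<close>, every \<open>A\<close>-submodule of a graded piece \<open>M\<^sub>n\<close> is the piece of a graded
  submodule.\<close>

lemma gfam_fill:
  assumes U: "L.opsub U" "U \<subseteq> Mg n"
  shows "gfam (fill n U)"
proof (rule gfamI)
  fix k b s m assume s: "s \<in> Sg k" and m: "m \<in> fill n U b"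
  have m': "m \<in> Mg b" using m U(2) M.Mg_closed(2) by (auto simp: fill_def split: if_splits)
  show "s \<odot> m \<in> fill n U (deg_add k b)"
  proof (cases "n \<le> b")
    case False
    then have "m = \<zero>" using m by (cases "b = n") (auto simp: fill_def)
    then have "s \<odot> m = \<zero>" using S.Mg_closed(1)[OF s] by simp
    then show ?thesis using L.opsubD(2)[OF U(1)] M.Mg_closed(2) by (simp add: fill_def)
  next
    case True
    then have le: "n \<le> deg_add k b" by (auto simp: le_fun_def deg_add_def trans_le_add2)
    show ?thesis
    proof (cases "deg_add k b = n")
      case eq: True
      have "k i = 0 \<and> b i = n i" for i
        using fun_cong[OF eq, of i] le_funD[OF True, of i] by (simp add: deg_add_def)
      then have kb: "k = (\<lambda>_. 0)" "b = n" by auto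
      then obtain a where "a \<in> carrier A" "s = sc a" using Sg_0 s by blast
      then show ?thesis using L_opsub_smult[OF U(1)] m kb eq by (simp add: fill_def)
    next
      case False
      then show ?thesis using smult_hom[OF s m'] le by (simp add: fill_def)
    qed
  qed
qed (use U M.Mg_closed L.opsubD[OF U(1)] in \<open>auto simp: fill_def split: if_splits\<close>)

text \<open>By the ascending chain condition there is a maximal \<open>A\<close>-submodule of finite length in \<open>M\<^sub>n\<close>.  Adding a cyclic
  submodule preserves finite length, so it contains every element.\<close>

lemma finite_len_piece: "L.len {\<zero>} (Mg n) \<noteq> \<infinity>"
proof -
  let ?Q = "{F. \<exists>U. F = fill n U \<and> L.opsub U \<and> U \<subseteq> Mg n \<and> L.len {\<zero>} U \<noteq> \<infinity>}"
  have "fill n {\<zero>} \<in> ?Q"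
    using L.opsub_zero L.len_self[of "{\<zero>}"] M.Mg_closed(2)
    by (intro CollectI exI[of _ "{\<zero>}"]) (auto simp: zero_enat_def)
  then have "\<exists>F\<in>?Q. \<forall>G. (G, F) \<in> {(N', N). gfam N' \<and> gfam N \<and> N < N'} \<longrightarrow> G \<notin> ?Q"
    using wf_gfam unfolding wf_eq_minimal by (metis (no_types, lifting))
  then obtain U where U: "L.opsub U" "U \<subseteq> Mg n" "L.len {\<zero>} U \<noteq> \<infinity>"
    and max: "\<And>G. (G, fill n U) \<in> {(N', N). gfam N' \<and> gfam N \<and> N < N'} \<Longrightarrow> G \<notin> ?Q"
    by auto
  have "Mg n \<subseteq> U"
  proof
    fix m assume m: "m \<in> Mg n"
    have mc: "m \<in> carrier M" using M.Mg_closed(1)[OF m] .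
    let ?V = "(\<lambda>a. sc a \<odot> m) ` carrier A"
    note V = cyclic_finite_len[OF mc]
    have "sc a \<odot> m \<in> Mg n" if "a \<in> carrier A" for a
      using smult_hom[OF sc_closed(1)[OF that] m] by simp
    then have sub: "L.ssum U ?V \<subseteq> Mg n"
      using U(2) by (intro L.ssum_least[OF gfam_opsub[OF gfam_Mg]]) auto
    have W: "L.opsub (L.ssum U ?V)" by (rule L.opsub_ssum[OF U(1) V(1)])
    have in_Q: "fill n (L.ssum U ?V) \<in> ?Q"
      using W sub finite_len_ssum[OF U(1) V(1) U(3) V(2)] by blast
    have mem: "m \<in> L.ssum U ?V"
      using L.ssum_upper2[OF U(1) V(1)] mem_cyclic[OF mc] by blast
    show "m \<in> U"
    proof (rule ccontr)
      assume "m \<notin> U"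
      then have "\<not> fill n (L.ssum U ?V) \<le> fill n U"
        using mem by (auto simp: le_fun_def fill_def intro!: exI[of _ n])
      moreover have "fill n U \<le> fill n (L.ssum U ?V)"
        using L.ssum_upper1[OF U(1) V(1)] by (auto simp: le_fun_def fill_def)
      ultimately have "fill n U < fill n (L.ssum U ?V)" by (simp add: less_fun_def)
      then show False using max[of "fill n (L.ssum U ?V)"] in_Q gfam_fill[OF U(1,2)] gfam_fill[OF W sub] by blast
    qed
  qed
  then show ?thesis using U(2,3) by (metis subset_antisym)
qed

text \<open>The Hilbert function of the module \<open>K / N\<close>.\<close>

definition hilb :: "(('d \<Rightarrow> nat) \<Rightarrow> 'm set) \<Rightarrow> (('d \<Rightarrow> nat) \<Rightarrow> 'm set) \<Rightarrow> ('d \<Rightarrow> nat) \<Rightarrow> int" where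
  "hilb N K n = int (the_enat (L.len (N n) (K n)))"

lemma len_gfam:
  assumes "gfam N" "gfam K" "N \<le> K"
  shows "L.len (N n) (K n) = enat (the_enat (L.len (N n) (K n)))"
proof -
  have "L.len (N n) (K n) \<noteq> \<infinity>"
    using assms finite_len_piece gfamD(2)[OF assms(1)] gfam_le_Mg[OF assms(2)]
    by (intro L.len_finite_mono[of "{\<zero>}" "N n" "K n" "Mg n"])
      (auto simp: gfam_opsub gfam_Mg L.opsub_zero le_fun_def)
  then show ?thesis by (cases "L.len (N n) (K n)") auto
qed

lemma hilb_add:
  assumes "gfam N" "gfam K" "gfam J" "N \<le> K" "K \<le> J"
  shows "hilb N J n = hilb N K n + hilb K J n"
proof -
  have "L.len (N n) (J n) = L.len (N n) (K n) + L.len (K n) (J n)"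
    using assms by (intro L.len_additive gfam_opsub) (auto simp: le_fun_def)
  then show ?thesis
    using len_gfam[OF assms(1,2,4), of n] len_gfam[OF assms(2,3,5), of n]
    unfolding hilb_def by (metis of_nat_add plus_enat_simps(1) the_enat.simps)
qed

lemma hilb_eq_0: "N n = K n \<Longrightarrow> hilb N K n = 0"
  by (simp add: hilb_def L.len_self zero_enat_def)

lemma hilb_self [simp]: "hilb N N = (\<lambda>_. 0)"
  by (simp add: fun_eq_iff hilb_eq_0)

lemma hilb_nonneg: "0 \<le> hilb N K n"
  by (simp add: hilb_def)

text \<open>The graded submodules \<open>(N : x) \<inter> K\<close>, \<open>N + x K\<close> for \<open>x\<close> of degree \<open>e\<^sub>i\<close>, and \<open>N + S m\<close> for \<open>m\<close> of degree \<open>b\<close>.\<close>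

definition colon :: "('d \<Rightarrow> nat) \<Rightarrow> 's \<Rightarrow> (('d \<Rightarrow> nat) \<Rightarrow> 'm set) \<Rightarrow> (('d \<Rightarrow> nat) \<Rightarrow> 'm set) \<Rightarrow> ('d \<Rightarrow> nat) \<Rightarrow> 'm set"
  where "colon k x N K n = {m \<in> K n. x \<odot> m \<in> N (deg_add k n)}"

definition push :: "'d \<Rightarrow> 's \<Rightarrow> (('d \<Rightarrow> nat) \<Rightarrow> 'm set) \<Rightarrow> (('d \<Rightarrow> nat) \<Rightarrow> 'm set) \<Rightarrow> ('d \<Rightarrow> nat) \<Rightarrow> 'm set"
  where "push i x N K n = (if n i = 0 then N n else L.ssum (N n) ((\<lambda>m. x \<odot> m) ` K (deg_pred i n)))"

definition cyc :: "('d \<Rightarrow> nat) \<Rightarrow> 'm \<Rightarrow> (('d \<Rightarrow> nat) \<Rightarrow> 'm set) \<Rightarrow> ('d \<Rightarrow> nat) \<Rightarrow> 'm set"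
  where "cyc b m N n = (if b \<le> n then L.ssum (N n) ((\<lambda>s. s \<odot> m) ` Sg (deg_diff n b)) else N n)"

lemma smult_swap: "s \<in> carrier S \<Longrightarrow> t \<in> carrier S \<Longrightarrow> m \<in> carrier M \<Longrightarrow> s \<odot> (t \<odot> m) = t \<odot> (s \<odot> m)"
  by (simp add: smult_assoc1[symmetric] S.m_comm)

lemma gfam_colon:
  assumes N: "gfam N" and K: "gfam K" and x: "x \<in> Sg k" and le: "N \<le> K"
  shows "gfam (colon k x N K)" "N \<le> colon k x N K" "colon k x N K \<le> K"
proof -
  note n = gfamD[OF N] and l = gfamD[OF K]
  have xc: "x \<in> carrier S" using S.Mg_closed(1)[OF x] .
  show "gfam (colon k x N K)"
  proof (rule gfamI)
    fix j b s m assume s: "s \<in> Sg j" and m: "m \<in> colon k x N K b"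
    have "x \<odot> (s \<odot> m) = s \<odot> (x \<odot> m)"
      using xc S.Mg_closed(1)[OF s] m l(5) by (intro smult_swap) (auto simp: colon_def)
    then show "s \<odot> m \<in> colon k x N K (deg_add j b)"
      using m s n(4)[OF s] l(4)[OF s] by (auto simp: colon_def deg_add_left_commute)
  qed (use n l xc in \<open>auto simp: colon_def smult_r_distr\<close>)
  show "N \<le> colon k x N K" using le n(4)[OF x] by (auto simp: colon_def le_fun_def)
  show "colon k x N K \<le> K" by (auto simp: colon_def le_fun_def)
qed

lemma gfam_push:
  assumes N: "gfam N" and K: "gfam K" and x: "x \<in> Sg (unit_deg i)" and le: "N \<le> K"
  shows "gfam (push i x N K)" "N \<le> push i x N K" "push i x N K \<le> K"
    "m \<in> K n \<Longrightarrow> x \<odot> m \<in> push i x N K (deg_succ i n)"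
proof -
  note n = gfamD[OF N] and l = gfamD[OF K]
  have xc: "x \<in> carrier S" using S.Mg_closed(1)[OF x] .
  have ops: "L.opsub (L.ssum (N n) ((\<lambda>m. x \<odot> m) ` K (deg_pred i n)))" for n
  proof (rule L.len_image(2)[OF gfam_opsub[OF N] gfam_opsub[OF K]])
    show "x \<odot> \<theta> m = \<theta> (x \<odot> m)" if "\<theta> \<in> A_ops" "m \<in> K (deg_pred i n)" for \<theta> m
      using that xc l(5) sc_closed by (auto simp: A_ops_def intro!: smult_swap)
  qed (use xc l(5) in \<open>auto simp: smult_r_distr\<close>)
  have up: "N n \<subseteq> push i x N K n" for n
  proof
    fix u assume u: "u \<in> N n"
    have "u = u \<oplus> x \<odot> \<zero>" using n(5)[OF u] xc by simp
    then show "u \<in> push i x N K n" using u l(2) by (auto simp: push_def L.ssum_def)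
  qed
  then show "N \<le> push i x N K" by (simp add: le_fun_def)
  have down: "push i x N K n \<subseteq> K n" for n
  proof (cases "n i = 0")
    case False
    have "x \<odot> m \<in> K n" if "m \<in> K (deg_pred i n)" for m
      using l(4)[OF x that] deg_add_unit_pred[of n i] False by simp
    then have "L.ssum (N n) ((\<lambda>m. x \<odot> m) ` K (deg_pred i n)) \<subseteq> K n"
      using le by (intro L.ssum_least[OF gfam_opsub[OF K]]) (auto simp: le_fun_def)
    then show ?thesis using False by (simp add: push_def)
  qed (use le in \<open>auto simp: push_def le_fun_def\<close>)
  then show "push i x N K \<le> K" by (simp add: le_fun_def)
  show mem: "x \<odot> m \<in> push i x N K (deg_succ i n)" if m: "m \<in> K n" for m n
  proof -
    have "x \<odot> m = \<zero> \<oplus> x \<odot> m" using l(5)[OF m] xc by simp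
    moreover have "m \<in> K (deg_pred i (deg_succ i n))" using m by simp
    ultimately show ?thesis using n(2) by (force simp: push_def L.ssum_def)
  qed
  show "gfam (push i x N K)"
  proof (rule gfamI)
    show "push i x N K b \<subseteq> Mg b" for b using down[of b] l(1) by blast
    show "\<zero> \<in> push i x N K b" for b using up[of b] n(2) by blast
    show "y \<oplus> z \<in> push i x N K b" if "y \<in> push i x N K b" "z \<in> push i x N K b" for b y z
      using that n(3) L.opsubD(3)[OF ops] by (auto simp: push_def split: if_splits)
    fix k b s m assume s: "s \<in> Sg k" and m: "m \<in> push i x N K b"
    have sc: "s \<in> carrier S" using S.Mg_closed(1)[OF s] .
    show "s \<odot> m \<in> push i x N K (deg_add k b)"
    proof (cases "b i = 0")
      case True
      then have "m \<in> N b" using m by (simp add: push_def)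
      then show ?thesis using n(4)[OF s] up by blast
    next
      case False
      then obtain u v where uv: "u \<in> N b" "v \<in> K (deg_pred i b)" "m = u \<oplus> x \<odot> v"
        using m by (auto simp: push_def L.ssum_def)
      have "s \<odot> m = s \<odot> u \<oplus> x \<odot> (s \<odot> v)"
        using uv n(5) l(5) xc sc smult_swap[OF sc xc l(5)[OF uv(2)]] by (simp add: smult_r_distr)
      moreover have "s \<odot> v \<in> K (deg_pred i (deg_add k b))"
        using l(4)[OF s uv(2)] deg_pred_add[of b i k] False by simp
      moreover have "deg_add k b i \<noteq> 0" using False by (simp add: deg_add_def)
      ultimately show ?thesis
        using n(4)[OF s uv(1)] by (auto simp: push_def L.ssum_def)
    qed
  qed
qed

lemma gfam_cyc:
  assumes N: "gfam N" and m: "m \<in> Mg b"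
  shows "gfam (cyc b m N)" "N \<le> cyc b m N" "m \<in> cyc b m N b"
    "gfam K \<Longrightarrow> N \<le> K \<Longrightarrow> m \<in> K b \<Longrightarrow> cyc b m N \<le> K"
proof -
  note n = gfamD[OF N]
  have mc: "m \<in> carrier M" using M.Mg_closed(1)[OF m] .
  have up: "N n \<subseteq> cyc b m N n" for n
  proof
    fix u assume u: "u \<in> N n"
    have "u = u \<oplus> \<zero>\<^bsub>S\<^esub> \<odot> m" using n(5)[OF u] mc by simp
    then show "u \<in> cyc b m N n" using u S.Mg_closed(2) by (auto simp: cyc_def L.ssum_def)
  qed
  then show "N \<le> cyc b m N" by (simp add: le_fun_def)
  have least: "cyc b m N n \<subseteq> K n" if "gfam K" "N \<le> K" "m \<in> K b" for K n
  proof (cases "b \<le> n")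
    case True
    have "s \<odot> m \<in> K n" if "s \<in> Sg (deg_diff n b)" for s
      using gfamD(4)[OF \<open>gfam K\<close> that \<open>m \<in> K b\<close>] deg_add_diff[OF True] by (simp add: deg_add_commute)
    then have "L.ssum (N n) ((\<lambda>s. s \<odot> m) ` Sg (deg_diff n b)) \<subseteq> K n"
      using that(2) by (intro L.ssum_least[OF gfam_opsub[OF that(1)]]) (auto simp: le_fun_def)
    then show ?thesis using True by (simp add: cyc_def)
  qed (use that(2) in \<open>auto simp: cyc_def le_fun_def\<close>)
  then show "gfam K \<Longrightarrow> N \<le> K \<Longrightarrow> m \<in> K b \<Longrightarrow> cyc b m N \<le> K" by (simp add: le_fun_def)
  have "m = \<zero> \<oplus> \<one>\<^bsub>S\<^esub> \<odot> m" "\<one>\<^bsub>S\<^esub> \<in> Sg (deg_diff b b)"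
    using mc S.one_hom by (simp_all add: deg_diff_def)
  then show "m \<in> cyc b m N b" using n(2) by (force simp: cyc_def L.ssum_def)
  show "gfam (cyc b m N)"
  proof (rule gfamI)
    show "cyc b m N a \<subseteq> Mg a" for a using least[OF gfam_Mg gfam_le_Mg[OF N] m] .
    show "\<zero> \<in> cyc b m N a" for a using up[of a] n(2) by blast
    fix a y z assume y: "y \<in> cyc b m N a" and z: "z \<in> cyc b m N a"
    show "y \<oplus> z \<in> cyc b m N a"
    proof (cases "b \<le> a")
      case True
      then obtain u s v t where e: "u \<in> N a" "s \<in> Sg (deg_diff a b)" "y = u \<oplus> s \<odot> m"
          "v \<in> N a" "t \<in> Sg (deg_diff a b)" "z = v \<oplus> t \<odot> m"
        using y z by (auto simp: cyc_def L.ssum_def)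
      have "y \<oplus> z = (u \<oplus> v) \<oplus> (s \<oplus>\<^bsub>S\<^esub> t) \<odot> m"
        using e n(5) mc S.Mg_closed(1) by (simp add: smult_l_distr M.a_ac)
      then show ?thesis using True n(3)[OF e(1,4)] S.Mg_closed(3)[OF e(2,5)]
        by (auto simp: cyc_def L.ssum_def)
    qed (use y z n(3) in \<open>auto simp: cyc_def\<close>)
  next
    fix k a s y assume s: "s \<in> Sg k" and y: "y \<in> cyc b m N a"
    have sc: "s \<in> carrier S" using S.Mg_closed(1)[OF s] .
    show "s \<odot> y \<in> cyc b m N (deg_add k a)"
    proof (cases "b \<le> a")
      case True
      then obtain u t where e: "u \<in> N a" "t \<in> Sg (deg_diff a b)" "y = u \<oplus> t \<odot> m"
        using y by (auto simp: cyc_def L.ssum_def)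
      have "s \<odot> y = s \<odot> u \<oplus> (s \<otimes>\<^bsub>S\<^esub> t) \<odot> m"
        using e n(5) mc sc S.Mg_closed(1) by (simp add: smult_r_distr smult_assoc1)
      moreover have "s \<otimes>\<^bsub>S\<^esub> t \<in> Sg (deg_diff (deg_add k a) b)"
        using S.mult_hom[OF s e(2)] deg_diff_add_left[OF True, of k] by simp
      moreover have "b \<le> deg_add k a" using True by (auto simp: le_fun_def deg_add_def trans_le_add2)
      ultimately show ?thesis using n(4)[OF s e(1)] by (auto simp: cyc_def L.ssum_def)
    next
      case False
      then have "y \<in> N a" using y by (simp add: cyc_def)
      then show ?thesis using n(4)[OF s] up by blast
    qed
  qed
qed

text \<open>The exact sequence \<open>0 \<rightarrow> (N : x) / N \<rightarrow> K / N \<rightarrow> K / N \<rightarrow> K / (N + x K) \<rightarrow> 0\<close> whose middle map is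
  multiplication by an element \<open>x\<close> of \<open>S\<^sub>i\<close>.\<close>

lemma hilb_exact:
  assumes N: "gfam N" and K: "gfam K" and x: "x \<in> Sg (unit_deg i)" and le: "N \<le> K" and n: "n i \<noteq> 0"
  shows "hilb N K n - hilb N K (deg_pred i n) =
    hilb (push i x N K) K n - hilb N (colon (unit_deg i) x N K) (deg_pred i n)"
proof -
  let ?C = "push i x N K" and ?Q = "colon (unit_deg i) x N K" and ?p = "deg_pred i n"
  note C = gfam_push[OF N K x le] and Q = gfam_colon[OF N K x le]
  have xc: "x \<in> carrier S" using S.Mg_closed(1)[OF x] .
  have "L.len {v \<in> K ?p. x \<odot> v \<in> N n} (K ?p) = L.len (N n) (L.ssum (N n) ((\<lambda>m. x \<odot> m) ` K ?p))"
  proof (rule L.len_image(3)[OF gfam_opsub[OF N] gfam_opsub[OF K]])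
    show "x \<odot> \<theta> m = \<theta> (x \<odot> m)" if "\<theta> \<in> A_ops" "m \<in> K ?p" for \<theta> m
      using that xc gfamD(5)[OF K] sc_closed by (auto simp: A_ops_def intro!: smult_swap)
  qed (use xc gfamD(5)[OF K] in \<open>auto simp: smult_r_distr\<close>)
  moreover have "{v \<in> K ?p. x \<odot> v \<in> N n} = ?Q ?p"
    using deg_add_unit_pred[of n i, OF n] by (simp add: colon_def)
  ultimately have "hilb ?Q K ?p = hilb N ?C n"
    using n by (simp add: hilb_def push_def)
  moreover have "hilb N K n = hilb N ?C n + hilb ?C K n" by (rule hilb_add[OF N C(1) K C(2,3)])
  moreover have "hilb N K ?p = hilb N ?Q ?p + hilb ?Q K ?p" by (rule hilb_add[OF N Q(1) K Q(2,3)])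
  ultimately show ?thesis by simp
qed

text \<open>The homogeneous ideal \<open>(N : m)\<close> for an element \<open>m\<close> of degree \<open>b\<close>.\<close>

definition ann :: "(('d \<Rightarrow> nat) \<Rightarrow> 'm set) \<Rightarrow> ('d \<Rightarrow> nat) \<Rightarrow> 'm \<Rightarrow> ('d \<Rightarrow> nat) \<Rightarrow> 's set" where
  "ann N b m k = {s \<in> Sg k. s \<odot> m \<in> N (deg_add k b)}"

lemma hfamily_ann:
  assumes N: "gfam N" and m: "m \<in> Mg b"
  shows "S.hfamily (ann N b m)"
proof -
  note n = gfamD[OF N]
  have mc: "m \<in> carrier M" using M.Mg_closed(1)[OF m] .
  show ?thesis
    unfolding S.hfamily_def
  proof (intro conjI allI ballI)
    fix k j s x assume s: "s \<in> Sg k" and x: "x \<in> ann N b m j"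
    have "(s \<otimes>\<^bsub>S\<^esub> x) \<odot> m = s \<odot> (x \<odot> m)"
      using s x mc S.Mg_closed(1) by (intro smult_assoc1) (auto simp: ann_def)
    then show "s \<otimes>\<^bsub>S\<^esub> x \<in> ann N b m (deg_add k j)"
      using n(4)[OF s] x S.mult_hom[OF s] by (auto simp: ann_def deg_add_assoc)
  qed (use n mc S.Mg_closed in \<open>auto simp: ann_def smult_l_distr\<close>)
qed

text \<open>The ideal \<open>(N : m)\<close> is prime as far as homogeneous elements can tell.\<close>

definition prime_at :: "(('d \<Rightarrow> nat) \<Rightarrow> 'm set) \<Rightarrow> ('d \<Rightarrow> nat) \<Rightarrow> 'm \<Rightarrow> bool" where
  "prime_at N b m \<longleftrightarrow> m \<in> Mg b \<and> m \<notin> N b \<and> (\<forall>k n. \<forall>a\<in>Sg k. \<forall>c\<in>Sg n.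
     a \<otimes>\<^bsub>S\<^esub> c \<in> ann N b m (deg_add k n) \<longrightarrow> a \<in> ann N b m k \<or> c \<in> ann N b m n)"

text \<open>The usual choice of an associated prime, a maximal annihilator, would need the ascending
  chain condition for ideals.  It is replaced by that for graded submodules of \<open>M\<close>: among the
  multiples \<open>c m\<close> outside \<open>N\<close> take one for which \<open>(N : c)\<close> is maximal.\<close>

lemma exists_prime_at:
  assumes N: "gfam N" and m: "m \<in> Mg b" "m \<notin> N b"
  obtains k c where "c \<in> Sg k" "prime_at N (deg_add k b) (c \<odot> m)"
proof -
  note n = gfamD[OF N]
  have mc: "m \<in> carrier M" using M.Mg_closed(1)[OF m(1)] .
  have NM: "N \<le> Mg" by (rule gfam_le_Mg[OF N])
  let ?Q = "{K. \<exists>k c. c \<in> Sg k \<and> c \<odot> m \<notin> N (deg_add k b) \<and> K = colon k c N Mg}"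
  have "colon (\<lambda>_. 0) \<one>\<^bsub>S\<^esub> N Mg \<in> ?Q" using m mc S.one_hom by (auto intro!: exI[of _ "\<lambda>_. 0"] exI[of _ "\<one>\<^bsub>S\<^esub>"])
  then have "\<exists>F\<in>?Q. \<forall>G. (G, F) \<in> {(N', N). gfam N' \<and> gfam N \<and> N < N'} \<longrightarrow> G \<notin> ?Q"
    using wf_gfam unfolding wf_eq_minimal by (metis (no_types, lifting))
  then obtain k c where c: "c \<in> Sg k" "c \<odot> m \<notin> N (deg_add k b)"
    and max: "\<And>G. (G, colon k c N Mg) \<in> {(N', N). gfam N' \<and> gfam N \<and> N < N'} \<Longrightarrow> G \<notin> ?Q"
    by auto
  have cc: "c \<in> carrier S" using S.Mg_closed(1)[OF c(1)] .
  have "prime_at N (deg_add k b) (c \<odot> m)"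
    unfolding prime_at_def
  proof (intro conjI allI ballI impI)
    show "c \<odot> m \<in> Mg (deg_add k b)" by (rule smult_hom[OF c(1) m(1)])
    show "c \<odot> m \<notin> N (deg_add k b)" by (rule c(2))
    fix p q a d assume a: "a \<in> Sg p" and d: "d \<in> Sg q"
      and ad: "a \<otimes>\<^bsub>S\<^esub> d \<in> ann N (deg_add k b) (c \<odot> m) (deg_add p q)"
    have ac: "a \<in> carrier S" and dc: "d \<in> carrier S" using S.Mg_closed(1) a d by blast+
    show "a \<in> ann N (deg_add k b) (c \<odot> m) p \<or> d \<in> ann N (deg_add k b) (c \<odot> m) q"
    proof (rule disjCI)
      assume "d \<notin> ann N (deg_add k b) (c \<odot> m) q"
      then have "d \<odot> (c \<odot> m) \<notin> N (deg_add q (deg_add k b))" using d by (simp add: ann_def)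
      then have nm: "(d \<otimes>\<^bsub>S\<^esub> c) \<odot> m \<notin> N (deg_add (deg_add q k) b)"
        using dc cc mc by (simp add: smult_assoc1 deg_add_assoc)
      have dcS: "d \<otimes>\<^bsub>S\<^esub> c \<in> Sg (deg_add q k)" by (rule S.mult_hom[OF d c(1)])
      let ?K = "colon k c N Mg" and ?K' = "colon (deg_add q k) (d \<otimes>\<^bsub>S\<^esub> c) N Mg"
      have "?K' \<in> ?Q" using nm dcS by blast
      then have "\<not> ?K < ?K'"
        using max[of ?K'] gfam_colon(1)[OF N gfam_Mg c(1) NM] gfam_colon(1)[OF N gfam_Mg dcS NM] by blast
      moreover have "?K \<le> ?K'"
        unfolding le_fun_def
      proof (intro allI subsetI)
        fix j v assume v: "v \<in> ?K j"
        then have vc: "v \<in> carrier M" using M.Mg_closed(1) by (auto simp: colon_def)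
        have "d \<odot> (c \<odot> v) \<in> N (deg_add q (deg_add k j))" using n(4)[OF d] v by (auto simp: colon_def)
        then show "v \<in> ?K' j" using v vc dc cc by (simp add: colon_def smult_assoc1 deg_add_assoc)
      qed
      ultimately have eq: "?K = ?K'" by (metis order_le_less)
      have am: "a \<odot> m \<in> Mg (deg_add p b)" by (rule smult_hom[OF a m(1)])
      have "(d \<otimes>\<^bsub>S\<^esub> c) \<odot> (a \<odot> m) = (a \<otimes>\<^bsub>S\<^esub> d) \<odot> (c \<odot> m)"
      proof -
        have "(d \<otimes>\<^bsub>S\<^esub> c) \<odot> (a \<odot> m) = ((d \<otimes>\<^bsub>S\<^esub> c) \<otimes>\<^bsub>S\<^esub> a) \<odot> m" using ac dc cc mc by (simp add: smult_assoc1)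
        also have "(d \<otimes>\<^bsub>S\<^esub> c) \<otimes>\<^bsub>S\<^esub> a = (a \<otimes>\<^bsub>S\<^esub> d) \<otimes>\<^bsub>S\<^esub> c" using ac dc cc by (simp add: S.m_ac)
        also have "\<dots> \<odot> m = (a \<otimes>\<^bsub>S\<^esub> d) \<odot> (c \<odot> m)" using ac dc cc mc by (simp add: smult_assoc1)
        finally show ?thesis .
      qed
      moreover have "(a \<otimes>\<^bsub>S\<^esub> d) \<odot> (c \<odot> m) \<in> N (deg_add (deg_add q k) (deg_add p b))"
        using ad by (simp add: ann_def deg_ac)
      ultimately have "a \<odot> m \<in> ?K' (deg_add p b)" using am by (simp add: colon_def)
      then have "c \<odot> (a \<odot> m) \<in> N (deg_add k (deg_add p b))" unfolding eq[symmetric] by (simp add: colon_def)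
      then show "a \<in> ann N (deg_add k b) (c \<odot> m) p"
        using a smult_swap[OF ac cc mc] by (simp add: ann_def deg_add_left_commute)
    qed
  qed
  then show thesis using c(1) that by blast
qed

text \<open>The principle behind all inductions on modules below: a property of the quotients \<open>K / N\<close> that
  is compatible with extensions only has to be checked for the cyclic modules \<open>(N + S m) / N\<close> whose
  annihilator is prime, and there it may be assumed for all quotients by larger submodules.\<close>

lemma devissage [consumes 3, case_names refl trans cyc]:
  assumes "gfam N" "gfam K" "N \<le> K"
    and refl: "\<And>N. gfam N \<Longrightarrow> \<Phi> N N"
    and trans: "\<And>N J K. gfam N \<Longrightarrow> gfam J \<Longrightarrow> gfam K \<Longrightarrow> N \<le> J \<Longrightarrow> J \<le> K \<Longrightarrow> \<Phi> N J \<Longrightarrow> \<Phi> J K \<Longrightarrow> \<Phi> N K"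
    and cyc: "\<And>N b m. gfam N \<Longrightarrow> prime_at N b m \<Longrightarrow>
      (\<And>J K. gfam J \<Longrightarrow> gfam K \<Longrightarrow> N < J \<Longrightarrow> J \<le> K \<Longrightarrow> \<Phi> J K) \<Longrightarrow> \<Phi> N (cyc b m N)"
  shows "\<Phi> N K"
  using assms(1-3)
proof (induction N arbitrary: K rule: wf_induct_rule[OF wf_gfam])
  case (1 N)
  show ?case
  proof (cases "N = K")
    case False
    then obtain b where "\<not> K b \<subseteq> N b" using 1(4) by (auto simp: le_fun_def fun_eq_iff)
    then obtain m where m: "m \<in> K b" "m \<notin> N b" by blast
    have "m \<in> Mg b" using gfamD(1)[OF 1(3) m(1)] .
    then obtain k c where c: "c \<in> Sg k" "prime_at N (deg_add k b) (c \<odot> m)"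
      using exists_prime_at[OF 1(2) _ m(2)] by blast
    let ?b = "deg_add k b" and ?m = "c \<odot> m"
    have mb: "?m \<in> Mg ?b" "?m \<notin> N ?b" using c(2) by (auto simp: prime_at_def)
    note J = gfam_cyc[OF 1(2) mb(1)]
    have "\<not> cyc ?b ?m N \<le> N" using J(3) mb(2) by (auto simp: le_fun_def)
    then have lt: "N < cyc ?b ?m N" using J(2) by (simp add: less_fun_def)
    have le: "cyc ?b ?m N \<le> K" by (rule J(4)[OF 1(3,4) gfamD(4)[OF 1(3) c(1) m(1)]])
    have IH: "\<Phi> J K'" if "gfam J" "gfam K'" "N < J" "J \<le> K'" for J K'
      using 1(1)[of J K'] that 1(2) by blast
    have "\<Phi> N (cyc ?b ?m N)" by (rule cyc[OF 1(2) c(2) IH])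
    moreover have "\<Phi> (cyc ?b ?m N) K" by (rule IH[OF J(1) 1(3) lt le])
    ultimately show ?thesis by (rule trans[OF 1(2) J(1) 1(3) J(2) le])
  qed (use refl 1(2) in auto)
qed

end


section \<open>Hilbert functions of subquotients\<close>

context standard_module
begin

text \<open>For a prime \<open>P\<close> this says that \<open>P\<close> contains the annihilator of \<open>K / N\<close>, hence that \<open>P\<close> lies in its support.  Unlike the
  support, the condition passes trivially from a subquotient to the module.\<close>

definition supp_at :: "(('d \<Rightarrow> nat) \<Rightarrow> 'm set) \<Rightarrow> (('d \<Rightarrow> nat) \<Rightarrow> 'm set) \<Rightarrow> 's set \<Rightarrow> bool" where
  "supp_at N K P \<longleftrightarrow> (\<forall>k. \<forall>s\<in>Sg k. (\<forall>n. \<forall>m\<in>K n. s \<odot> m \<in> N (deg_add k n)) \<longrightarrow> s \<in> P)"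

lemma supp_at_mono:
  assumes "supp_at N' K' P" "N \<le> N'" "K' \<le> K"
  shows "supp_at N K P"
  using assms unfolding supp_at_def le_fun_def by (meson subsetD)

text \<open>The condition that the support of \<open>(K / N) / X (K / N)\<close> has dimension at most zero.  It is stated with \<open>K / N\<close> and \<open>X\<close>
  kept apart, since in this form it passes to all subquotients of \<open>K / N\<close>.\<close>

definition no_chain :: "'s set \<Rightarrow> (('d \<Rightarrow> nat) \<Rightarrow> 'm set) \<Rightarrow> (('d \<Rightarrow> nat) \<Rightarrow> 'm set) \<Rightarrow> bool" where
  "no_chain X N K \<longleftrightarrow> \<not> (\<exists>P\<in>Proj S Sg. \<exists>Q\<in>Proj S Sg. P \<subset> Q \<and> X \<subseteq> P \<and> supp_at N K P)"

lemma no_chain_mono: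
  assumes "no_chain X N K" "N \<le> N'" "K' \<le> K"
  shows "no_chain X N' K'"
  using assms supp_at_mono unfolding no_chain_def by metis

text \<open>Every prime in the support of \<open>K / N\<close> contains the elements that annihilate \<open>K / N\<close>.\<close>

lemma no_chain_killed:
  assumes "no_chain (insert x X) N K" "x \<in> Sg k" "\<And>n m. m \<in> K n \<Longrightarrow> x \<odot> m \<in> N (deg_add k n)"
  shows "no_chain X N K"
  unfolding no_chain_def
proof
  assume "\<exists>P\<in>Proj S Sg. \<exists>Q\<in>Proj S Sg. P \<subset> Q \<and> X \<subseteq> P \<and> supp_at N K P"
  then obtain P Q where P: "P \<in> Proj S Sg" "Q \<in> Proj S Sg" "P \<subset> Q" "X \<subseteq> P" "supp_at N K P" by blast
  have "x \<in> P" using P(5) assms(2,3) unfolding supp_at_def by blast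
  then show False using assms(1) P unfolding no_chain_def by blast
qed

lemma hideal_ann_prime:
  assumes N: "gfam N" and p: "prime_at N b m"
  shows "primeideal (S.hideal (ann N b m)) S" "homogeneous_ideal S Sg (S.hideal (ann N b m))"
proof -
  have m: "m \<in> Mg b" "m \<notin> N b" using p by (auto simp: prime_at_def)
  note P = hfamily_ann[OF N m(1)]
  show "homogeneous_ideal S Sg (S.hideal (ann N b m))" by (rule S.homogeneous_hideal[OF P])
  show "primeideal (S.hideal (ann N b m)) S"
  proof (rule S.prime_hideal[OF P])
    show "\<one>\<^bsub>S\<^esub> \<notin> ann N b m (\<lambda>_. 0)" using m M.Mg_closed(1) by (simp add: ann_def)
    show "a \<in> ann N b m k \<or> c \<in> ann N b m n"
      if "a \<in> Sg k" "c \<in> Sg n" "a \<otimes>\<^bsub>S\<^esub> c \<in> ann N b m (deg_add k n)" for k n a c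
      using p that by (auto simp: prime_at_def)
  qed
qed

lemma irrelevant_subset_hideal:
  assumes P: "S.hfamily P" and sub: "irrelevant_ideal S Sg \<subseteq> S.hideal P" and n: "(\<lambda>_. 1) \<le> n"
  shows "Sg n \<subseteq> P n"
proof
  fix s assume s: "s \<in> Sg n"
  have "is_decomp S Sg (\<lambda>k. S.comp k s) s" by (rule S.is_decomp_comp[OF S.Mg_closed(1)[OF s]])
  moreover have "\<forall>k. S.comp k s \<noteq> \<zero>\<^bsub>S\<^esub> \<longrightarrow> (\<lambda>_. 1) \<le> k" using S.comp_homogeneous[OF s] n by auto
  ultimately have "s \<in> irrelevant_ideal S Sg" unfolding irrelevant_ideal_def by blast
  then show "s \<in> P n" using sub S.hideal_hom_iff[OF P s] by blast
qed

lemma not_irrelevant_subset_hideal: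
  assumes P: "S.hfamily P" and sub: "\<not> irrelevant_ideal S Sg \<subseteq> S.hideal P"
  obtains y where "y \<in> Sg (unit_deg i)" "y \<notin> P (unit_deg i)"
proof -
  have "\<not> Sg (unit_deg i) \<subseteq> P (unit_deg i)"
  proof
    assume i: "Sg (unit_deg i) \<subseteq> P (unit_deg i)"
    obtain x f where x: "is_decomp S Sg f x" "\<forall>n. f n \<noteq> \<zero>\<^bsub>S\<^esub> \<longrightarrow> (\<lambda>_. 1) \<le> n" "x \<notin> S.hideal P"
      using sub unfolding irrelevant_ideal_def by blast
    have fS: "f n \<in> Sg n" for n using x(1) by (simp add: is_decomp_def)
    have xc: "x \<in> carrier S"
      using x(1) fS S.Mg_closed(1) by (auto simp: is_decomp_def intro!: S.finsum_closed)
    then obtain n where n: "f n \<notin> P n"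
      using x(3) S.is_decomp_unique[OF xc x(1)] by (auto simp: S.hideal_def)
    then have "f n \<noteq> \<zero>\<^bsub>S\<^esub>" using S.hfamilyD(2)[OF P] by auto
    then have "1 \<le> n i" using x(2) by (auto simp: le_fun_def)
    then have "n i \<noteq> 0" by simp
    then show False using direction_generates[OF P i] n fS by blast
  qed
  then show thesis using that by blast
qed

lemma cyc_elem:
  assumes "v \<in> cyc b m N n"
  obtains "v \<in> N n" | u s where "b \<le> n" "u \<in> N n" "s \<in> Sg (deg_diff n b)" "v = u \<oplus> s \<odot> m"
  using assms by (auto simp: cyc_def L.ssum_def split: if_splits)

text \<open>A homogeneous element outside the prime \<open>(N : m)\<close> acts injectively on \<open>(N + S m) / N\<close>.\<close>

lemma colon_cyc:
  assumes N: "gfam N" and p: "prime_at N b m" and x: "x \<in> Sg k" "x \<notin> ann N b m k"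
  shows "colon k x N (cyc b m N) = N"
proof (rule antisym)
  have m: "m \<in> Mg b" using p by (simp add: prime_at_def)
  note n = gfamD[OF N]
  have c: "x \<in> carrier S" "m \<in> carrier M" using S.Mg_closed(1) M.Mg_closed(1) x m by blast+
  show "N \<le> colon k x N (cyc b m N)"
    by (rule gfam_colon(2)[OF N gfam_cyc(1)[OF N m] x(1) gfam_cyc(2)[OF N m]])
  show "colon k x N (cyc b m N) \<le> N"
    unfolding le_fun_def
  proof (intro allI subsetI)
    fix n v assume "v \<in> colon k x N (cyc b m N) n"
    then have v: "v \<in> cyc b m N n" "x \<odot> v \<in> N (deg_add k n)" by (auto simp: colon_def)
    from v(1) show "v \<in> N n"
    proof (cases rule: cyc_elem)
      case (2 u s)
      have sc: "s \<in> carrier S" "u \<in> carrier M" using S.Mg_closed(1) 2 n(5) by blast+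
      have "(x \<otimes>\<^bsub>S\<^esub> s) \<odot> m = x \<odot> v \<oplus> \<ominus> (x \<odot> u)"
        using c sc 2(4) by (simp add: smult_r_distr smult_assoc1 M.a_comm[of "x \<odot> u"] M.a_assoc M.r_neg)
      also have "\<dots> \<in> N (deg_add k n)"
        using n(3)[OF v(2) gfam_neg[OF N n(4)[OF x(1) 2(2)]]] .
      finally have "x \<otimes>\<^bsub>S\<^esub> s \<in> ann N b m (deg_add k (deg_diff n b))"
        using S.mult_hom[OF x(1) 2(3)] deg_add_diff[OF 2(1)]
        by (simp add: ann_def deg_add_assoc deg_add_commute[of "deg_diff n b"])
      then have "s \<in> ann N b m (deg_diff n b)"
        using p x 2(3) by (auto simp: prime_at_def)
      then have "s \<odot> m \<in> N n" using deg_add_diff[OF 2(1)] by (simp add: ann_def deg_add_commute)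
      then show ?thesis using n(3)[OF 2(2)] 2(4) by simp
    qed
  qed
qed

lemma killed_cyc:
  assumes N: "gfam N" and m: "m \<in> Mg b" and x: "x \<in> ann N b m k" and v: "v \<in> cyc b m N n"
  shows "x \<odot> v \<in> N (deg_add k n)"
  using v
proof (cases rule: cyc_elem)
  case 1
  then show ?thesis using gfamD(4)[OF N] x by (auto simp: ann_def)
next
  case (2 u s)
  have xS: "x \<in> Sg k" "x \<odot> m \<in> N (deg_add k b)" using x by (auto simp: ann_def)
  have c: "x \<in> carrier S" "s \<in> carrier S" "m \<in> carrier M" "u \<in> carrier M"
    using S.Mg_closed(1) M.Mg_closed(1) xS 2 m gfamD(5)[OF N] by blast+
  have "x \<odot> v = x \<odot> u \<oplus> s \<odot> (x \<odot> m)"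
    using c 2(4) smult_swap[of x s m] by (simp add: smult_r_distr)
  moreover have "s \<odot> (x \<odot> m) \<in> N (deg_add k n)"
    using gfamD(4)[OF N 2(3) xS(2)] deg_add_diff[OF 2(1)]
    by (metis deg_add_commute deg_add_left_commute)
  ultimately show ?thesis using gfamD(3,4)[OF N] xS(1) 2(2) by simp
qed

lemma supp_at_cyc:
  assumes N: "gfam N" and p: "prime_at N b m"
  shows "supp_at N (cyc b m N) (S.hideal (ann N b m))"
  unfolding supp_at_def
proof (intro allI ballI impI)
  fix k s assume s: "s \<in> Sg k" and *: "\<forall>n. \<forall>v\<in>cyc b m N n. s \<odot> v \<in> N (deg_add k n)"
  have m: "m \<in> Mg b" using p by (simp add: prime_at_def)
  have "s \<in> ann N b m k" using * s gfam_cyc(3)[OF N m] by (auto simp: ann_def)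
  then show "s \<in> S.hideal (ann N b m)" using S.hideal_hom_iff[OF hfamily_ann[OF N m] s] by simp
qed

text \<open>Passing from a cyclic quotient with prime annihilator \<open>P\<close> to its quotient by \<open>y\<close>, for \<open>y\<close> outside
  \<open>P\<close>, removes \<open>P\<close> from the support, so that all remaining primes are strictly larger.\<close>

lemma supp_at_push_cyc:
  assumes N: "gfam N" and p: "prime_at N b m" and y: "y \<in> Sg (unit_deg i)" "y \<notin> ann N b m (unit_deg i)"
    and Q: "Q \<in> Proj S Sg" "supp_at (push i y N (cyc b m N)) (cyc b m N) Q"
  shows "S.hideal (ann N b m) \<subset> Q"
proof -
  have m: "m \<in> Mg b" using p by (simp add: prime_at_def)
  note P = hfamily_ann[OF N m] and C = gfam_cyc[OF N m]
  note J = gfam_push[OF N C(1) y(1) C(2)]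
  interpret Q: primeideal Q S using Q(1) by (simp add: Proj_def)
  have PQ: "s \<in> Q" if s: "s \<in> ann N b m k" for s k
  proof -
    have "s \<odot> v \<in> push i y N (cyc b m N) (deg_add k n)" if "v \<in> cyc b m N n" for v n
      using killed_cyc[OF N m s that] gfam_leD[OF J(2)] by blast
    then show ?thesis using Q(2) s unfolding supp_at_def by (auto simp: ann_def)
  qed
  have "S.hideal (ann N b m) \<subseteq> Q"
  proof
    fix s assume s: "s \<in> S.hideal (ann N b m)"
    show "s \<in> Q"
    proof (rule S.mem_if_comps_mem)
      show "S.comp n s \<in> Q" for n using PQ s by (auto simp: S.hideal_def)
    qed (use s Q.a_subset in \<open>auto simp: S.hideal_def\<close>)
  qed
  moreover have "y \<in> Q"
    using Q(2) y(1) J(4) unfolding supp_at_def by (auto simp: deg_add_unit)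
  moreover have "y \<notin> S.hideal (ann N b m)" using S.hideal_hom_iff[OF P y(1)] y(2) by simp
  ultimately show ?thesis by blast
qed

lemma push_cyc_strict:
  assumes N: "gfam N" and p: "prime_at N b m" and y: "y \<in> Sg (unit_deg i)" "y \<notin> ann N b m (unit_deg i)"
  shows "N < push i y N (cyc b m N)"
proof -
  have m: "m \<in> Mg b" using p by (simp add: prime_at_def)
  note C = gfam_cyc[OF N m]
  note J = gfam_push[OF N C(1) y(1) C(2)]
  have "y \<odot> m \<in> push i y N (cyc b m N) (deg_succ i b)" by (rule J(4)[OF C(3)])
  moreover have "y \<odot> m \<notin> N (deg_succ i b)" using y by (auto simp: ann_def deg_add_unit)
  ultimately have "\<not> push i y N (cyc b m N) \<le> N" by (auto simp: le_fun_def)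
  then show ?thesis using J(2) by (simp add: less_fun_def)
qed

text \<open>If the annihilator contains \<open>S\<^sub>+\<^sub>+\<close>, every graded piece of degree at least \<open>b + (1, \<dots>, 1)\<close> vanishes.\<close>

lemma cyc_trivial:
  assumes N: "gfam N" and p: "prime_at N b m" and irr: "irrelevant_ideal S Sg \<subseteq> S.hideal (ann N b m)"
  shows "for_all_large (\<lambda>n. cyc b m N n = N n)"
proof (rule for_all_large_mono[OF for_all_large_ge[of "\<lambda>i. b i + 1"]])
  fix n assume n: "\<forall>i. b i + 1 \<le> n i"
  have m: "m \<in> Mg b" using p by (simp add: prime_at_def)
  have "b i \<le> n i \<and> 1 \<le> n i - b i" for i using n[rule_format, of i] by linarith
  then have le: "b \<le> n" "(\<lambda>_. 1) \<le> deg_diff n b" by (simp_all add: le_fun_def deg_diff_def)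
  have "Sg (deg_diff n b) \<subseteq> ann N b m (deg_diff n b)"
    by (rule irrelevant_subset_hideal[OF hfamily_ann[OF N m] irr le(2)])
  then have "s \<odot> m \<in> N n" if "s \<in> Sg (deg_diff n b)" for s
    using that deg_add_diff[OF le(1)] by (auto simp: ann_def deg_add_commute)
  then have "cyc b m N n \<subseteq> N n"
    using le(1) gfamD(3)[OF N] by (auto simp: cyc_def L.ssum_def)
  then show "cyc b m N n = N n" using gfam_leD[OF gfam_cyc(2)[OF N m]] by blast
qed

lemma hilb_backward_cyc:
  assumes N: "gfam N" and p: "prime_at N b m" and y: "y \<in> Sg (unit_deg i)" "y \<notin> ann N b m (unit_deg i)"
    and n: "n i \<noteq> 0"
  shows "hilb N (cyc b m N) n - hilb N (cyc b m N) (deg_pred i n) = hilb (push i y N (cyc b m N)) (cyc b m N) n"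
proof -
  have m: "m \<in> Mg b" using p by (simp add: prime_at_def)
  note C = gfam_cyc[OF N m]
  show ?thesis
    using hilb_exact[where n = n and i = i, OF N C(1) y(1) C(2) n] colon_cyc[OF N p y] by simp
qed

lemma for_all_large_nonzero: "for_all_large (\<lambda>n::'d \<Rightarrow> nat. n i \<noteq> 0)"
  by (rule for_all_large_mono[OF for_all_large_ge[of "\<lambda>_. 1"]]) (metis not_one_le_zero)

lemma ev_poly_hilb_backward_cyc:
  assumes N: "gfam N" and p: "prime_at N b m" and y: "y \<in> Sg (unit_deg i)" "y \<notin> ann N b m (unit_deg i)"
  shows "for_all_large (\<lambda>n. hilb N (cyc b m N) n - hilb N (cyc b m N) (deg_pred i n) =
           hilb (push i y N (cyc b m N)) (cyc b m N) n)"
  by (rule for_all_large_mono[OF for_all_large_nonzero[of i]]) (rule hilb_backward_cyc[OF N p y])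

text \<open>On a cyclic module with prime annihilator \<open>P\<close>, the backward difference in the direction \<open>i\<close> is the Hilbert
  function of the quotient by an element of \<open>S\<^sub>i\<close> outside \<open>P\<close>, which is eventually polynomial by the
  inductive assumption.\<close>

lemma exists_hilbert_poly:
  assumes "gfam N" "gfam K" "N \<le> K"
  shows "\<exists>e. ev_poly (hilb N K) e"
  using assms
proof (induction rule: devissage)
  case (refl N)
  show ?case using ev_poly_const[of "\<lambda>_. 0" 0] for_all_large_True by auto
next
  case (trans N J K)
  then obtain e g where "ev_poly (hilb N J) e" "ev_poly (hilb J K) g" by blast
  from ev_poly_add[OF this] show ?case
    using hilb_add[OF trans(1-5)] by (metis (no_types, lifting) ext)
next
  case (cyc N b m)
  have m: "m \<in> Mg b" using cyc(2) by (simp add: prime_at_def)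
  note C = gfam_cyc[OF cyc(1) m]
  show ?case
  proof (cases "irrelevant_ideal S Sg \<subseteq> S.hideal (ann N b m)")
    case True
    have "for_all_large (\<lambda>n. hilb N (cyc b m N) n = 0)"
      by (rule for_all_large_mono[OF cyc_trivial[OF cyc(1,2) True]]) (simp add: hilb_eq_0)
    then show ?thesis using ev_poly_const by blast
  next
    case False
    show ?thesis
    proof (rule ev_poly_integrate)
      fix i
      obtain y where y: "y \<in> Sg (unit_deg i)" "y \<notin> ann N b m (unit_deg i)"
        using not_irrelevant_subset_hideal[OF hfamily_ann[OF cyc(1) m] False] .
      note J = gfam_push[OF cyc(1) C(1) y(1) C(2)]
      obtain e where e: "ev_poly (hilb (push i y N (cyc b m N)) (cyc b m N)) e"
        using cyc(3)[OF J(1) C(1) push_cyc_strict[OF cyc(1,2) y] J(3)] by blast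
      show "\<exists>g. ev_poly (\<lambda>n. hilb N (cyc b m N) n - hilb N (cyc b m N) (deg_pred i n)) g"
        using ev_poly_cong[OF e ev_poly_hilb_backward_cyc[OF cyc(1,2) y]] by blast
    qed
  qed
qed

text \<open>The annihilator of a cyclic quotient in a filtration with prime annihilators is in the support unless it contains
  \<open>S\<^sub>+\<^sub>+\<close>.\<close>

lemma empty_support_imp_trivial:
  assumes "gfam N" "gfam K" "N \<le> K" "\<not> (\<exists>P\<in>Proj S Sg. supp_at N K P)"
  shows "for_all_large (\<lambda>n. K n = N n)"
  using assms
proof (induction rule: devissage)
  case (refl N)
  show ?case by (simp add: for_all_large_True)
next
  case (trans N J K)
  have "for_all_large (\<lambda>n. J n = N n)" "for_all_large (\<lambda>n. K n = J n)"
    using trans(6,7) supp_at_mono[OF _ order_refl trans(5)] supp_at_mono[OF _ trans(4) order_refl] trans(8)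
    by blast+
  from for_all_large_conj[OF this] show ?case by (rule for_all_large_mono) simp
next
  case (cyc N b m)
  let ?P = "S.hideal (ann N b m)"
  have "?P \<notin> Proj S Sg" using cyc(4) supp_at_cyc[OF cyc(1,2)] by blast
  then have "irrelevant_ideal S Sg \<subseteq> ?P" using hideal_ann_prime[OF cyc(1,2)] by (simp add: Proj_def)
  then show ?case by (rule cyc_trivial[OF cyc(1,2)])
qed

text \<open>If \<open>K / N\<close> has support of dimension at most zero, then for the cyclic quotients by a prime \<open>P\<close> of
  a filtration, multiplication by an element of \<open>S\<^sub>i\<close> outside \<open>P\<close> is injective, and also surjective in
  large degrees because its cokernel has empty support.  So the lengths do not change.\<close>

lemma zero_dim_imp_constant:
  assumes "gfam N" "gfam K" "N \<le> K" "no_chain {} N K"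
  shows "\<exists>c. for_all_large (\<lambda>n. hilb N K n = c)"
  using assms
proof (induction rule: devissage)
  case (refl N)
  show ?case by (intro exI[of _ 0]) (simp add: for_all_large_True)
next
  case (trans N J K)
  obtain c d where "for_all_large (\<lambda>n. hilb N J n = c)" "for_all_large (\<lambda>n. hilb J K n = d)"
    using trans(6)[OF no_chain_mono[OF trans(8) order_refl trans(5)]]
      trans(7)[OF no_chain_mono[OF trans(8) trans(4) order_refl]] by blast
  from for_all_large_conj[OF this] have "for_all_large (\<lambda>n. hilb N K n = c + d)"
    by (rule for_all_large_mono) (simp add: hilb_add[OF trans(1-5)])
  then show ?case by blast
next
  case (cyc N b m)
  let ?P = "S.hideal (ann N b m)"
  have m: "m \<in> Mg b" using cyc(2) by (simp add: prime_at_def)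
  note C = gfam_cyc[OF cyc(1) m]
  show ?case
  proof (cases "irrelevant_ideal S Sg \<subseteq> ?P")
    case True
    have "for_all_large (\<lambda>n. hilb N (cyc b m N) n = 0)"
      by (rule for_all_large_mono[OF cyc_trivial[OF cyc(1,2) True]]) (simp add: hilb_eq_0)
    then show ?thesis by blast
  next
    case False
    then have P: "?P \<in> Proj S Sg" using hideal_ann_prime[OF cyc(1,2)] by (simp add: Proj_def)
    have "for_all_large (\<lambda>n. hilb N (cyc b m N) n = hilb N (cyc b m N) (deg_pred i n))" for i
    proof -
      obtain y where y: "y \<in> Sg (unit_deg i)" "y \<notin> ann N b m (unit_deg i)"
        using not_irrelevant_subset_hideal[OF hfamily_ann[OF cyc(1) m] False] .
      note J = gfam_push[OF cyc(1) C(1) y(1) C(2)]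
      have "\<not> (\<exists>Q\<in>Proj S Sg. supp_at (push i y N (cyc b m N)) (cyc b m N) Q)"
        using supp_at_push_cyc[OF cyc(1,2) y] cyc(4) P supp_at_cyc[OF cyc(1,2)]
        unfolding no_chain_def by blast
      from empty_support_imp_trivial[OF J(1) C(1) J(3) this]
      have "for_all_large (\<lambda>n. cyc b m N n = push i y N (cyc b m N) n)" .
      from for_all_large_conj[OF this ev_poly_hilb_backward_cyc[OF cyc(1,2) y]]
      show ?thesis
      proof (rule for_all_large_mono)
        fix n assume *: "cyc b m N n = push i y N (cyc b m N) n \<and>
          hilb N (cyc b m N) n - hilb N (cyc b m N) (deg_pred i n) = hilb (push i y N (cyc b m N)) (cyc b m N) n"
        then have "hilb (push i y N (cyc b m N)) (cyc b m N) n = 0" by (intro hilb_eq_0) simp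
        with * show "hilb N (cyc b m N) n = hilb N (cyc b m N) (deg_pred i n)" by simp
      qed
    qed
    then show ?thesis using for_all_large_constant by blast
  qed
qed


section \<open>Mixed multiplicity systems\<close>

text \<open>A sequence is kept together with the directions of its elements, because the element zero lies in every \<open>S\<^sub>i\<close> and
  does not determine its direction; \<open>tdeg\<close> is then the type of the sequence.\<close>

definition tdeg :: "('s \<times> 'd) list \<Rightarrow> 'd \<Rightarrow> nat" where
  "tdeg ps = (\<lambda>i. count_list (map snd ps) i)"

lemma tdeg_Nil [simp]: "tdeg [] = (\<lambda>_. 0)"
  by (simp add: tdeg_def)

lemma tdeg_Cons [simp]: "tdeg ((x, i) # ps) = deg_succ i (tdeg ps)"
  by (auto simp: tdeg_def fun_eq_iff)

definition typed :: "('s \<times> 'd) list \<Rightarrow> bool" where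
  "typed ps \<longleftrightarrow> (\<forall>(x, i)\<in>set ps. x \<in> Sg (unit_deg i))"

lemma deg_succ_less_imp:
  assumes "deg_succ i k < h"
  shows "h i \<noteq> 0" "k < deg_pred i h"
proof -
  have le: "deg_succ i k j \<le> h j" for j using assms by (auto simp: less_fun_def le_fun_def)
  show hi: "h i \<noteq> 0" using le[of i] by simp
  have "k j \<le> deg_pred i h j" for j using le[of j] by auto
  moreover have "k \<noteq> deg_pred i h" using assms deg_succ_pred[of h i, OF hi] by auto
  ultimately show "k < deg_pred i h" by (metis le_fun_def order_le_less)
qed

lemma deg_less_succ: "k < deg_succ i k"
proof -
  have "k \<le> deg_succ i k" by (auto simp: le_fun_def)
  moreover have "k i \<noteq> deg_succ i k i" by simp
  ultimately show ?thesis by (metis order_le_less)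
qed

text \<open>By devissage the module may be taken cyclic with prime annihilator, and then the first element \<open>x\<close> of
  the system acts as zero or injectively.  In the first case the rest of the system is already one
  for the module, and since its type is strictly smaller, the coefficient vanishes by induction; in the second case
  the coefficient is that of the quotient by \<open>x\<close>.\<close>

lemma maximal_coeff_nonneg:
  assumes "gfam N" "gfam K" "N \<le> K" "typed ps" "no_chain (fst ` set ps) N K" "ev_poly (hilb N K) e"
  shows "(\<forall>h. tdeg ps < h \<longrightarrow> e h = 0) \<and> 0 \<le> e (tdeg ps)"
  using assms
proof (induction ps arbitrary: N K e)
  case Nil
  obtain c where c: "for_all_large (\<lambda>n. hilb N K n = c)"
    using zero_dim_imp_constant[OF Nil(1-3)] Nil(5) by auto
  have e: "e = (\<lambda>k. if k = (\<lambda>_. 0) then c else 0)"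
    by (rule ev_poly_unique[OF Nil(6) ev_poly_const[OF c]])
  obtain n where "hilb N K n = c" using for_all_large_sample[OF c] .
  then have "0 \<le> c" using hilb_nonneg[of N K n] by simp
  then show ?case using e by auto
next
  case (Cons p ps)
  obtain x i where p: "p = (x, i)" by (cases p)
  have x: "x \<in> Sg (unit_deg i)" and ps: "typed ps" using Cons.prems(4) by (auto simp: typed_def p)
  let ?k = "tdeg ps"
  have step: "no_chain (insert x (fst ` set ps)) N K \<longrightarrow> (\<forall>e. ev_poly (hilb N K) e \<longrightarrow>
      (\<forall>h. deg_succ i ?k < h \<longrightarrow> e h = 0) \<and> 0 \<le> e (deg_succ i ?k))"
    using Cons.prems(1-3)
  proof (induction rule: devissage)
    case (refl N)
    then show ?case using ev_poly_zero by auto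
  next
    case (trans N J K)
    show ?case
    proof (intro impI allI)
      fix e assume nc: "no_chain (insert x (fst ` set ps)) N K" and e: "ev_poly (hilb N K) e"
      obtain e1 e2 where e12: "ev_poly (hilb N J) e1" "ev_poly (hilb J K) e2"
        using exists_hilbert_poly trans(1-5) by metis
      have "ev_poly (hilb N K) (\<lambda>h. e1 h + e2 h)"
        by (rule ev_poly_cong[OF ev_poly_add[OF e12]]) (simp add: hilb_add[OF trans(1-5)] for_all_large_True)
      then have eq: "e = (\<lambda>h. e1 h + e2 h)" by (rule ev_poly_unique[OF e])
      have "(\<forall>h. deg_succ i ?k < h \<longrightarrow> e1 h = 0) \<and> 0 \<le> e1 (deg_succ i ?k)"
        using trans(6) no_chain_mono[OF nc order_refl trans(5)] e12(1) by blast
      moreover have "(\<forall>h. deg_succ i ?k < h \<longrightarrow> e2 h = 0) \<and> 0 \<le> e2 (deg_succ i ?k)"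
        using trans(7) no_chain_mono[OF nc trans(4) order_refl] e12(2) by blast
      ultimately show "(\<forall>h. deg_succ i ?k < h \<longrightarrow> e h = 0) \<and> 0 \<le> e (deg_succ i ?k)"
        by (simp add: eq)
    qed
  next
    case (cyc N b m)
    have m: "m \<in> Mg b" using cyc(2) by (simp add: prime_at_def)
    note C = gfam_cyc[OF cyc(1) m]
    show ?case
    proof (intro impI allI)
      fix e assume nc: "no_chain (insert x (fst ` set ps)) N (cyc b m N)" and e: "ev_poly (hilb N (cyc b m N)) e"
      show "(\<forall>h. deg_succ i ?k < h \<longrightarrow> e h = 0) \<and> 0 \<le> e (deg_succ i ?k)"
      proof (cases "x \<in> ann N b m (unit_deg i)")
        case True
        have "no_chain (fst ` set ps) N (cyc b m N)"
          by (rule no_chain_killed[OF nc x killed_cyc[OF cyc(1) m True]])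
        then have "\<forall>h. ?k < h \<longrightarrow> e h = 0" using Cons.IH[OF cyc(1) C(1,2) ps _ e] by blast
        then show ?thesis using deg_less_succ[of ?k i] order.strict_trans[OF deg_less_succ[of ?k i]] by auto
      next
        case False
        note J = gfam_push[OF cyc(1) C(1) x C(2)]
        let ?J = "push i x N (cyc b m N)"
        have "ev_poly (hilb ?J (cyc b m N)) (lower i e)"
          by (rule ev_poly_cong[OF ev_poly_backward[OF e]])
            (rule for_all_large_mono[OF ev_poly_hilb_backward_cyc[OF cyc(1,2) x False]], simp)
        moreover have "no_chain (fst ` set ps) ?J (cyc b m N)"
        proof (rule no_chain_killed[OF no_chain_mono[OF nc J(2) order_refl] x])
          show "x \<odot> v \<in> ?J (deg_add (unit_deg i) n)" if "v \<in> cyc b m N n" for v n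
            using J(4)[OF that] by (simp add: deg_add_unit)
        qed
        ultimately have IH: "(\<forall>h. ?k < h \<longrightarrow> lower i e h = 0) \<and> 0 \<le> lower i e ?k"
          using Cons.IH[OF J(1) C(1) J(3) ps] by blast
        have "e h = 0" if h: "deg_succ i ?k < h" for h
        proof -
          have "lower i e (deg_pred i h) = 0" using IH deg_succ_less_imp(2)[OF h] by blast
          then show ?thesis using deg_succ_pred[of h i, OF deg_succ_less_imp(1)[OF h]] by (simp add: lower_def)
        qed
        then show ?thesis using IH by (simp add: lower_def)
      qed
    qed
  qed
  have "no_chain (insert x (fst ` set ps)) N K" using Cons.prems(5) by (simp add: p)
  then show ?case unfolding p tdeg_Cons using step Cons.prems(6) by blast
qed

text \<open>The submodule \<open>N + (x\<^sub>1, \<dots>, x\<^sub>t) M\<close>, formed by adding one element of the sequence at a time.\<close>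

fun cut :: "('s \<times> 'd) list \<Rightarrow> (('d \<Rightarrow> nat) \<Rightarrow> 'm set) \<Rightarrow> ('d \<Rightarrow> nat) \<Rightarrow> 'm set" where
  "cut [] N = N"
| "cut ((x, i) # ps) N = cut ps (push i x N Mg)"

text \<open>Filter-regularity of the sequence on \<open>M / N\<close>, following the recursion of \<open>cut\<close>.\<close>

fun freg :: "('s \<times> 'd) list \<Rightarrow> (('d \<Rightarrow> nat) \<Rightarrow> 'm set) \<Rightarrow> bool" where
  "freg [] N \<longleftrightarrow> True"
| "freg ((x, i) # ps) N \<longleftrightarrow> for_all_large (\<lambda>n. colon (unit_deg i) x N Mg n = N n) \<and> freg ps (push i x N Mg)"

text \<open>Comparing coefficients in the exact sequence of multiplication by the first element \<open>x\<close> gives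
  \<open>e(M; k) = e(M / x M; k - e\<^sub>i) - e((0 : x); k - e\<^sub>i)\<close>.  The correction term is nonnegative since the rest
  of the system is a mixed multiplicity system of \<open>(0 : x)\<close>, and it vanishes when \<open>x\<close> is filter-regular.\<close>

lemma mixed_multiplicity_le:
  assumes "gfam N" "typed ps" "no_chain (fst ` set ps) N Mg" "ev_poly (hilb N Mg) e"
  shows "for_all_large (\<lambda>n. e (tdeg ps) \<le> hilb (cut ps N) Mg n) \<and>
    (freg ps N \<longrightarrow> for_all_large (\<lambda>n. e (tdeg ps) = hilb (cut ps N) Mg n))"
  using assms
proof (induction ps arbitrary: N e)
  case Nil
  obtain c where c: "for_all_large (\<lambda>n. hilb N Mg n = c)"
    using zero_dim_imp_constant[OF Nil(1) gfam_Mg gfam_le_Mg[OF Nil(1)]] Nil(3) by auto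
  have "e = (\<lambda>k. if k = (\<lambda>_. 0) then c else 0)"
    by (rule ev_poly_unique[OF Nil(4) ev_poly_const[OF c]])
  then have "e (tdeg []) = c" by simp
  then have "for_all_large (\<lambda>n. e (tdeg []) = hilb (cut [] N) Mg n)"
    by (intro for_all_large_mono[OF c]) simp
  moreover from this have "for_all_large (\<lambda>n. e (tdeg []) \<le> hilb (cut [] N) Mg n)"
    by (rule for_all_large_mono) simp
  ultimately show ?case by blast
next
  case (Cons p ps)
  obtain x i where p: "p = (x, i)" by (cases p)
  have x: "x \<in> Sg (unit_deg i)" and ps: "typed ps" using Cons.prems(2) by (auto simp: typed_def p)
  note N = Cons.prems(1)
  have le: "N \<le> Mg" by (rule gfam_le_Mg[OF N])
  let ?k = "tdeg ps" and ?C = "push i x N Mg" and ?Q = "colon (unit_deg i) x N Mg"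
  note C = gfam_push[OF N gfam_Mg x le] and Q = gfam_colon[OF N gfam_Mg x le]
  have nc: "no_chain (insert x (fst ` set ps)) N Mg" using Cons.prems(3) by (simp add: p)
  have ncC: "no_chain (fst ` set ps) ?C Mg"
  proof (rule no_chain_killed[OF no_chain_mono[OF nc C(2) order_refl] x])
    show "x \<odot> v \<in> ?C (deg_add (unit_deg i) n)" if "v \<in> Mg n" for v n
      using C(4)[OF that] by (simp add: deg_add_unit)
  qed
  have ncQ: "no_chain (fst ` set ps) N ?Q"
    by (rule no_chain_killed[OF no_chain_mono[OF nc order_refl Q(3)] x]) (simp add: colon_def)
  obtain eC where eC: "ev_poly (hilb ?C Mg) eC" using exists_hilbert_poly[OF C(1) gfam_Mg C(3)] by blast
  obtain eQ where eQ: "ev_poly (hilb N ?Q) eQ" using exists_hilbert_poly[OF N Q(1,2)] by blast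
  have "ev_poly (\<lambda>n. hilb ?C Mg n - hilb N ?Q (deg_pred i n)) (\<lambda>h. eC h - (eQ h - lower i eQ h))"
    by (rule ev_poly_diff[OF eC ev_poly_pred[OF eQ]])
  moreover have "for_all_large (\<lambda>n. hilb N Mg n - hilb N Mg (deg_pred i n) =
      hilb ?C Mg n - hilb N ?Q (deg_pred i n))"
    by (rule for_all_large_mono[OF for_all_large_nonzero[of i]]) (rule hilb_exact[OF N gfam_Mg x le])
  ultimately have "ev_poly (\<lambda>n. hilb N Mg n - hilb N Mg (deg_pred i n)) (\<lambda>h. eC h - (eQ h - lower i eQ h))"
    by (rule ev_poly_cong)
  then have eq: "lower i e = (\<lambda>h. eC h - (eQ h - lower i eQ h))"
    by (rule ev_poly_unique[OF ev_poly_backward[OF Cons.prems(4)]])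
  have Qpos: "(\<forall>h. ?k < h \<longrightarrow> eQ h = 0) \<and> 0 \<le> eQ ?k"
    by (rule maximal_coeff_nonneg[OF N Q(1,2) ps ncQ eQ])
  have "eQ (deg_succ i ?k) = 0"
    using conjunct1[OF Qpos] deg_less_succ[where k = ?k and i = i] by (elim allE impE)
  then have rel: "e (deg_succ i ?k) = eC ?k - eQ ?k"
    using fun_cong[OF eq, of ?k] by (simp add: lower_def)
  note IH = Cons.IH[OF C(1) ps ncC eC]
  have "for_all_large (\<lambda>n. e (deg_succ i ?k) \<le> hilb (cut ps ?C) Mg n)"
    by (rule for_all_large_mono[OF conjunct1[OF IH]]) (use rel Qpos in simp)
  moreover have "for_all_large (\<lambda>n. e (deg_succ i ?k) = hilb (cut ps ?C) Mg n)"
    if fr: "for_all_large (\<lambda>n. ?Q n = N n)" "freg ps ?C"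
  proof -
    have "for_all_large (\<lambda>n. hilb N ?Q n = 0)"
      by (rule for_all_large_mono[OF fr(1)]) (simp add: hilb_eq_0)
    from ev_poly_unique[OF eQ ev_poly_const[OF this]] have "eQ ?k = 0" by simp
    then show ?thesis using rel IH fr(2) by simp
  qed
  ultimately show ?case unfolding p tdeg_Cons cut.simps freg.simps by blast
qed

end


section \<open>Quotient modules, their lengths and supports\<close>

context standard_module
begin

abbreviation cos :: "'m set \<Rightarrow> 'm \<Rightarrow> 'm set" where
  "cos N x \<equiv> N +> x"

lemma submoduleD:
  assumes "submodule N S M"
  shows "x \<in> N \<Longrightarrow> x \<in> carrier M" "\<zero> \<in> N" "x \<in> N \<Longrightarrow> y \<in> N \<Longrightarrow> x \<oplus> y \<in> N"
    "x \<in> N \<Longrightarrow> \<ominus> x \<in> N" "s \<in> carrier S \<Longrightarrow> x \<in> N \<Longrightarrow> s \<odot> x \<in> N"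
  using submoduleE[OF assms] submodule.axioms(1)[OF assms, THEN subgroup.one_closed] by auto

lemma abelian_subgroup_submodule: "submodule N S M \<Longrightarrow> abelian_subgroup N M"
  by (rule abelian_subgroupI3)
    (use submodule.axioms(1) M.abelian_group_axioms in \<open>auto intro: additive_subgroup.intro\<close>)

lemma cos_eq_iff:
  assumes N: "submodule N S M" and x: "x \<in> carrier M" and y: "y \<in> carrier M"
  shows "cos N x = cos N y \<longleftrightarrow> x \<ominus> y \<in> N"
proof
  note n = submoduleD[OF N]
  assume "cos N x = cos N y"
  moreover have "x \<in> cos N x" using n(2) x by (force simp: a_r_coset_def')
  ultimately obtain h where h: "h \<in> N" "x = h \<oplus> y" by (auto simp: a_r_coset_def')
  then have "x \<ominus> y = h" using n(1) y by (simp add: M.minus_eq M.a_assoc M.r_neg)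
  then show "x \<ominus> y \<in> N" using h by simp
next
  note n = submoduleD[OF N]
  assume d: "x \<ominus> y \<in> N"
  have x': "x = (x \<ominus> y) \<oplus> y" using x y by (simp add: M.minus_eq M.a_assoc M.l_neg)
  have y': "y = (\<ominus> (x \<ominus> y)) \<oplus> x" 
    using x y by (simp add: M.minus_eq M.minus_add M.a_comm[of "\<ominus> x"] M.a_assoc M.l_neg)
  have "h \<oplus> x \<in> cos N y" if "h \<in> N" for h
  proof -
    have "h \<oplus> x = (h \<oplus> (x \<ominus> y)) \<oplus> y" using x' n(1)[OF that] n(1)[OF d] x y by (metis M.a_assoc)
    then show ?thesis using n(3)[OF that d] by (auto simp: a_r_coset_def')
  qed
  moreover have "h \<oplus> y \<in> cos N x" if "h \<in> N" for h
  proof -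
    have "h \<oplus> y = (h \<oplus> (\<ominus> (x \<ominus> y))) \<oplus> x"
      using y' n(1)[OF that] n(1)[OF n(4)[OF d]] x y by (metis M.a_assoc)
    then show ?thesis using n(3)[OF that n(4)[OF d]] by (auto simp: a_r_coset_def')
  qed
  ultimately show "cos N x = cos N y" by (auto simp: a_r_coset_def')
qed

lemma cos_zero: "submodule N S M \<Longrightarrow> cos N \<zero> = N"
  using submoduleD(1) by (force simp: a_r_coset_def')

lemma cos_eq_self_iff: "submodule N S M \<Longrightarrow> x \<in> carrier M \<Longrightarrow> cos N x = N \<longleftrightarrow> x \<in> N"
proof -
  assume N: "submodule N S M" and x: "x \<in> carrier M"
  have z: "\<ominus> \<zero> = \<zero>" by (rule M.minus_equality) simp_all
  have "x \<ominus> \<zero> = x" unfolding M.minus_eq z using x by simp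
  then show ?thesis using cos_eq_iff[OF N x M.zero_closed] cos_zero[OF N] by simp
qed

lemma cos_add:
  assumes "submodule N S M" "x \<in> carrier M" "y \<in> carrier M"
  shows "cos N x <+> cos N y = cos N (x \<oplus> y)"
  by (rule abelian_subgroup.a_rcos_sum[OF abelian_subgroup_submodule[OF assms(1)] assms(2,3)])

lemma quot_smult:
  assumes N: "submodule N S M" and r: "r \<in> carrier S" and x: "x \<in> carrier M"
  shows "r \<odot>\<^bsub>quot_module M N\<^esub> cos N x = cos N (r \<odot> x)"
proof -
  note n = submoduleD[OF N]
  have "cos N (r \<odot> c) = cos N (r \<odot> x)" if c: "c \<in> cos N x" for c
  proof -
    obtain h where h: "h \<in> N" "c = h \<oplus> x" using c by (auto simp: a_r_coset_def')
    have "r \<odot> c \<ominus> r \<odot> x = r \<odot> h"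
      using h n(1)[OF h(1)] r x by (simp add: smult_r_distr M.minus_eq M.a_assoc M.r_neg)
    then show ?thesis using cos_eq_iff[OF N, of "r \<odot> c" "r \<odot> x"] n h r x by simp
  qed
  then have "(\<Union>c\<in>cos N x. cos N (r \<odot> c)) = (\<Union>c\<in>cos N x. cos N (r \<odot> x))"
    by (intro SUP_cong refl)
  moreover have "x \<in> cos N x" using n(2) x by (force simp: a_r_coset_def')
  then have "cos N x \<noteq> {}" by blast
  ultimately show ?thesis by (simp add: quot_module_def)
qed

lemma carrier_quot: "carrier (quot_module M N) = cos N ` carrier M"
  by (auto simp: quot_module_def A_RCOSETS_def')

lemma quot_simps: "zero (quot_module M N) = N" "add (quot_module M N) = set_add M"
  by (simp_all add: quot_module_def)

text \<open>Inverses in the additive group of a graded piece are formed within the piece, so they have to be identified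
  before submodules of the piece can be compared with stable subgroups of \<open>M\<close>.\<close>

lemma submodule_piece_iff:
  assumes X: "X \<subseteq> carrier M'"
    and inv: "\<And>x. x \<in> X \<Longrightarrow> inv\<^bsub>add_monoid (graded_piece S M' X)\<^esub> x = neg x"
  shows "submodule W A (graded_piece S M' X) \<longleftrightarrow> W \<subseteq> X \<and> \<zero>\<^bsub>M'\<^esub> \<in> W \<and>
    (\<forall>x\<in>W. \<forall>y\<in>W. x \<oplus>\<^bsub>M'\<^esub> y \<in> W) \<and> (\<forall>x\<in>W. neg x \<in> W) \<and> (\<forall>a\<in>carrier A. \<forall>x\<in>W. sc a \<odot>\<^bsub>M'\<^esub> x \<in> W)"
  (is "?L \<longleftrightarrow> ?R")
proof
  assume L: ?L
  then interpret W: submodule W A "graded_piece S M' X" .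
  have "W \<subseteq> X" using W.subset by (simp add: graded_piece_def)
  then show ?R
    using W.one_closed W.m_closed W.m_inv_closed W.smult_closed inv
    by (auto simp: graded_piece_def sc_def subset_iff)
next
  assume R: ?R
  then have W: "W \<subseteq> X" by blast
  show ?L
    unfolding submodule_def submodule_axioms_def subgroup_def
    using R inv W by (auto simp: graded_piece_def sc_def subset_iff)
qed

lemma inv_piece_quot:
  assumes N: "submodule N S M" and u: "u \<in> Mg n"
  shows "inv\<^bsub>add_monoid (graded_piece S (quot_module M N) (cos N ` Mg n))\<^esub> (cos N u) = cos N (\<ominus> u)"
proof -
  let ?G = "add_monoid (graded_piece S (quot_module M N) (cos N ` Mg n))"
  show ?thesis
    unfolding m_inv_def
  proof (rule the_equality)
    have uc: "u \<in> carrier M" using M.Mg_closed(1)[OF u] .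
    have e: "cos N u <+> cos N (\<ominus> u) = N" "cos N (\<ominus> u) <+> cos N u = N"
      using uc by (simp_all add: cos_add[OF N] M.r_neg M.l_neg cos_zero[OF N])
    show "cos N (\<ominus> u) \<in> carrier (?G) \<and>
        cos N u \<otimes>\<^bsub>?G\<^esub> cos N (\<ominus> u) =
          \<one>\<^bsub>?G\<^esub> \<and>
        cos N (\<ominus> u) \<otimes>\<^bsub>?G\<^esub> cos N u =
          \<one>\<^bsub>?G\<^esub>"
      using e M.Mg_closed(4)[OF u] by (simp add: graded_piece_def quot_simps)
    fix y assume y: "y \<in> carrier (?G) \<and>
        cos N u \<otimes>\<^bsub>?G\<^esub> y =
          \<one>\<^bsub>?G\<^esub> \<and>
        y \<otimes>\<^bsub>?G\<^esub> cos N u =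
          \<one>\<^bsub>?G\<^esub>"
    then obtain w where w: "w \<in> Mg n" "y = cos N w" by (auto simp: graded_piece_def)
    have wc: "w \<in> carrier M" using M.Mg_closed(1)[OF w(1)] .
    have "cos N w <+> cos N u = N" using y w(2) by (simp add: graded_piece_def quot_simps)
    then have "w \<oplus> u \<in> N" using uc wc by (simp add: cos_add[OF N] cos_eq_self_iff[OF N])
    then have "w \<ominus> (\<ominus> u) \<in> N" using uc wc by (simp add: M.minus_eq)
    then show "y = cos N (\<ominus> u)" using cos_eq_iff[OF N wc, of "\<ominus> u"] uc w(2) by simp
  qed
qed

lemma inv_piece:
  assumes u: "u \<in> Mg n"
  shows "inv\<^bsub>add_monoid (graded_piece S M (Mg n))\<^esub> u = \<ominus> u"
proof -
  let ?G = "add_monoid (graded_piece S M (Mg n))"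
  show ?thesis
    unfolding m_inv_def
  proof (rule the_equality)
    have uc: "u \<in> carrier M" using M.Mg_closed(1)[OF u] .
    show "\<ominus> u \<in> carrier (?G) \<and>
        u \<otimes>\<^bsub>?G\<^esub> \<ominus> u = \<one>\<^bsub>?G\<^esub> \<and>
        \<ominus> u \<otimes>\<^bsub>?G\<^esub> u = \<one>\<^bsub>?G\<^esub>"
      using uc M.Mg_closed(4)[OF u] by (simp add: graded_piece_def M.r_neg M.l_neg)
    fix y assume y: "y \<in> carrier (?G) \<and>
        u \<otimes>\<^bsub>?G\<^esub> y = \<one>\<^bsub>?G\<^esub> \<and>
        y \<otimes>\<^bsub>?G\<^esub> u = \<one>\<^bsub>?G\<^esub>"
    then have "y \<in> Mg n" "y \<oplus> u = \<zero>" by (simp_all add: graded_piece_def)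
    then show "y = \<ominus> u" using uc M.Mg_closed(1) by (metis M.minus_equality)
  qed
qed

lemma piece_length_eq: "piece_length A S M (Mg n) = L.len {\<zero>} (Mg n)"
proof -
  have "submodule W A (graded_piece S M (Mg n)) \<longleftrightarrow> W \<in> L.ival {\<zero>} (Mg n)" for W
  proof -
    have "submodule W A (graded_piece S M (Mg n)) \<longleftrightarrow> W \<subseteq> Mg n \<and> \<zero> \<in> W \<and> (\<forall>x\<in>W. \<forall>y\<in>W. x \<oplus> y \<in> W) \<and>
        (\<forall>x\<in>W. \<ominus> x \<in> W) \<and> (\<forall>a\<in>carrier A. \<forall>x\<in>W. sc a \<odot> x \<in> W)"
      by (rule submodule_piece_iff[OF _ inv_piece]) (use M.Mg_closed(1) in auto)
    also have "\<dots> \<longleftrightarrow> L.opsub W \<and> W \<subseteq> Mg n"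
      unfolding L.opsub_def using M.Mg_closed(1) by (auto simp: A_ops_def)
    also have "\<dots> \<longleftrightarrow> W \<in> L.ival {\<zero>} (Mg n)"
      using L.opsubD(2) by (auto simp: L.ival_def)
    finally show ?thesis .
  qed
  then show ?thesis by (simp add: piece_length_def module_length_def L.len_def)
qed

text \<open>Submodules of a piece of \<open>M / N\<close> correspond to submodules of \<open>M\<^sub>n\<close> containing \<open>N \<inter> M\<^sub>n\<close>.\<close>

lemma quot_piece_length_eq:
  assumes N: "submodule N S M"
  shows "piece_length A S (quot_module M N) (quot_grading M N Mg n) = L.len (N \<inter> Mg n) (Mg n)"
proof -
  note nn = submoduleD[OF N]
  let ?X = "cos N ` Mg n"
  let ?piece = "graded_piece S (quot_module M N) ?X"
  have Xc: "?X \<subseteq> carrier (quot_module M N)" using M.Mg_closed(1) by (auto simp: carrier_quot)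
  define neg where "neg c = inv\<^bsub>add_monoid ?piece\<^esub> c" for c
  have neg: "neg (cos N u) = cos N (\<ominus> u)" if "u \<in> Mg n" for u
    unfolding neg_def by (rule inv_piece_quot[OF N that])
  note sub = submodule_piece_iff[OF Xc, of neg, unfolded neg_def[symmetric], OF refl, unfolded quot_simps]
  have sm: "sc a \<odot>\<^bsub>quot_module M N\<^esub> cos N u = cos N (sc a \<odot> u)" if "a \<in> carrier A" "u \<in> Mg n" for a u
    using that by (intro quot_smult[OF N]) (auto simp: sc_closed M.Mg_closed(1))
  have scM: "sc a \<odot> u \<in> Mg n" if "a \<in> carrier A" "u \<in> Mg n" for a u
    using smult_hom[OF sc_closed(1)[OF that(1)] that(2)] by simp
  have 1: "chain_lengths {W. submodule W A ?piece} \<subseteq> chain_lengths (L.ival (N \<inter> Mg n) (Mg n))"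
  proof (rule chain_lengths_image_subset[where \<phi> = "\<lambda>W. {u \<in> Mg n. cos N u \<in> W}"])
    fix W assume "W \<in> {W. submodule W A ?piece}"
    then have "submodule W A ?piece" by simp
    note w = this[unfolded sub]
    have "L.opsub {u \<in> Mg n. cos N u \<in> W}"
    proof (rule L.opsubI)
      show "\<zero> \<in> {u \<in> Mg n. cos N u \<in> W}" using w cos_zero[OF N] M.Mg_closed(2) by simp
      show "x \<oplus> y \<in> {u \<in> Mg n. cos N u \<in> W}"
        if xy: "x \<in> {u \<in> Mg n. cos N u \<in> W}" "y \<in> {u \<in> Mg n. cos N u \<in> W}" for x y
      proof -
        have "cos N x <+> cos N y \<in> W" using xy w by blast
        moreover have "cos N x <+> cos N y = cos N (x \<oplus> y)"
          using xy M.Mg_closed(1) by (intro cos_add[OF N]) auto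
        ultimately show ?thesis using xy M.Mg_closed(3) by simp
      qed
      show "\<ominus> x \<in> {u \<in> Mg n. cos N u \<in> W}" if "x \<in> {u \<in> Mg n. cos N u \<in> W}" for x
        using that w neg[of x] M.Mg_closed(4) by auto
      show "\<theta> x \<in> {u \<in> Mg n. cos N u \<in> W}" if th: "\<theta> \<in> A_ops" and x: "x \<in> {u \<in> Mg n. cos N u \<in> W}" for \<theta> x
      proof -
        obtain a where a: "a \<in> carrier A" "\<theta> = (\<lambda>m. sc a \<odot> m)" using th by (auto simp: A_ops_def)
        have "sc a \<odot>\<^bsub>quot_module M N\<^esub> cos N x \<in> W" using a(1) x w by blast
        then show ?thesis using a x sm[OF a(1), of x] scM[OF a(1), of x] by simp
      qed
    qed (use M.Mg_closed(1) in auto)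
    moreover have "N \<inter> Mg n \<subseteq> {u \<in> Mg n. cos N u \<in> W}"
    proof
      fix u assume u: "u \<in> N \<inter> Mg n"
      then have "cos N u = N" using cos_eq_self_iff[OF N] nn(1) by blast
      then show "u \<in> {u \<in> Mg n. cos N u \<in> W}" using u w by simp
    qed
    ultimately show "{u \<in> Mg n. cos N u \<in> W} \<in> L.ival (N \<inter> Mg n) (Mg n)" by (auto simp: L.ival_def)
  next
    fix V W assume VW: "V \<in> {W. submodule W A ?piece}" "W \<in> {W. submodule W A ?piece}" "V \<subset> W"
    then obtain c where c: "c \<in> W" "c \<notin> V" by blast
    have "W \<subseteq> ?X" using VW(2) unfolding mem_Collect_eq sub by blast
    then obtain u where "u \<in> Mg n" "c = cos N u" using c by blast
    then have "u \<in> {u \<in> Mg n. cos N u \<in> W}" "u \<notin> {u \<in> Mg n. cos N u \<in> V}" using c by auto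
    then show "{u \<in> Mg n. cos N u \<in> V} \<subset> {u \<in> Mg n. cos N u \<in> W}" using VW(3) by blast
  qed
  have 2: "chain_lengths (L.ival (N \<inter> Mg n) (Mg n)) \<subseteq> chain_lengths {W. submodule W A ?piece}"
  proof (rule chain_lengths_image_subset[where \<phi> = "\<lambda>U. cos N ` U"])
    fix U assume "U \<in> L.ival (N \<inter> Mg n) (Mg n)"
    then have U: "L.opsub U" "U \<subseteq> Mg n" by (auto simp: L.ival_def)
    note u = L.opsubD[OF U(1)]
    show "cos N ` U \<in> {W. submodule W A ?piece}"
      unfolding mem_Collect_eq sub
    proof (intro conjI ballI)
      show "cos N ` U \<subseteq> ?X" using U(2) by blast
      show "N \<in> cos N ` U" using u(2) cos_zero[OF N] by (metis imageI)
      fix x assume "x \<in> cos N ` U"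
      then obtain v where v: "v \<in> U" "x = cos N v" by blast
      show "neg x \<in> cos N ` U" using v neg[of v] U(2) u(4)[OF v(1)] by auto
      show "sc a \<odot>\<^bsub>quot_module M N\<^esub> x \<in> cos N ` U" if "a \<in> carrier A" for a
        using v sm[OF that, of v] U(2) L_opsub_smult[OF U(1) that v(1)] by auto
      fix y assume "y \<in> cos N ` U"
      then obtain w where w: "w \<in> U" "y = cos N w" by blast
      show "x <+> y \<in> cos N ` U" using v w cos_add[OF N, of v w] u(1,3) by auto
    qed
  next
    fix U V assume UV: "U \<in> L.ival (N \<inter> Mg n) (Mg n)" "V \<in> L.ival (N \<inter> Mg n) (Mg n)" "U \<subset> V"
    then obtain v where v: "v \<in> V" "v \<notin> U" by blast
    have ops: "L.opsub U" "N \<inter> Mg n \<subseteq> U" "U \<subseteq> Mg n" "V \<subseteq> Mg n" using UV by (auto simp: L.ival_def)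
    have "cos N v \<notin> cos N ` U"
    proof
      assume "cos N v \<in> cos N ` U"
      then obtain u where u: "u \<in> U" "cos N v = cos N u" by blast
      have M: "u \<in> Mg n" "v \<in> Mg n" using u v ops by auto
      then have c: "u \<in> carrier M" "v \<in> carrier M" using M.Mg_closed(1) by auto
      then have "v \<ominus> u \<in> N" using cos_eq_iff[OF N] u(2) by simp
      moreover have "v \<ominus> u \<in> Mg n" using M M.Mg_closed(3,4) by (simp add: M.minus_eq)
      ultimately have "v \<ominus> u \<in> U" using ops(2) by blast
      then have "v \<ominus> u \<oplus> u \<in> U" using L.opsubD(3)[OF ops(1)] u(1) by blast
      then show False using c v(2) by (simp add: M.minus_eq M.a_assoc M.l_neg)
    qed
    then show "cos N ` U \<subset> cos N ` V" using v(1) UV(3) by blast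
  qed
  have "chain_lengths {W. submodule W A ?piece} = chain_lengths (L.ival (N \<inter> Mg n) (Mg n))"
    using 1 2 by (rule subset_antisym)
  then show ?thesis
    by (simp add: piece_length_def module_length_def L.len_def quot_grading_def)
qed

lemma submodule_submodule_gen:
  assumes "X \<subseteq> carrier M"
  shows "submodule (submodule_gen S M X) S M" "X \<subseteq> submodule_gen S M X"
    "submodule N S M \<Longrightarrow> X \<subseteq> N \<Longrightarrow> submodule_gen S M X \<subseteq> N"
proof -
  show "X \<subseteq> submodule_gen S M X" by (auto simp: submodule_gen_def)
  show "submodule N S M \<Longrightarrow> X \<subseteq> N \<Longrightarrow> submodule_gen S M X \<subseteq> N" by (auto simp: submodule_gen_def)
  show "submodule (submodule_gen S M X) S M"
  proof (rule submoduleI)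
    show "submodule_gen S M X \<subseteq> carrier M"
      using carrier_is_submodule assms by (auto simp: submodule_gen_def)
  qed (use submoduleD in \<open>auto simp: submodule_gen_def\<close>)
qed

lemma submodule_seq:
  assumes "set xs \<subseteq> carrier S"
  shows "submodule (seq_submodule S M xs) S M"
    "x \<in> set xs \<Longrightarrow> m \<in> carrier M \<Longrightarrow> x \<odot> m \<in> seq_submodule S M xs"
    "submodule N S M \<Longrightarrow> (\<And>x m. x \<in> set xs \<Longrightarrow> m \<in> carrier M \<Longrightarrow> x \<odot> m \<in> N) \<Longrightarrow> seq_submodule S M xs \<subseteq> N"
proof -
  let ?X = "{x \<odot> m |x m. x \<in> set xs \<and> m \<in> carrier M}"
  have X: "?X \<subseteq> carrier M" using assms by auto
  show "submodule (seq_submodule S M xs) S M"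
    unfolding seq_submodule_def by (rule submodule_submodule_gen(1)[OF X])
  show "x \<odot> m \<in> seq_submodule S M xs" if "x \<in> set xs" "m \<in> carrier M"
    using submodule_submodule_gen(2)[OF X] that unfolding seq_submodule_def by blast
  show "seq_submodule S M xs \<subseteq> N"
    if "submodule N S M" "\<And>x m. x \<in> set xs \<Longrightarrow> m \<in> carrier M \<Longrightarrow> x \<odot> m \<in> N"
    unfolding seq_submodule_def using that by (intro submodule_submodule_gen(3)[OF X]) auto
qed

lemma typed_closed: "typed ps \<Longrightarrow> set (map fst ps) \<subseteq> carrier S"
  using S.Mg_closed(1) by (fastforce simp: typed_def)

lemma gfam_cut:
  assumes "typed ps" "gfam N"
  shows "gfam (cut ps N) \<and> N \<le> cut ps N"
  using assms
proof (induction ps arbitrary: N)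
  case (Cons p ps)
  obtain x i where p: "p = (x, i)" by (cases p)
  have x: "x \<in> Sg (unit_deg i)" "typed ps" using Cons.prems by (auto simp: typed_def p)
  note C = gfam_push[OF Cons.prems(2) gfam_Mg x(1) gfam_le_Mg[OF Cons.prems(2)]]
  show ?case using Cons.IH[OF x(2) C(1)] C(2) order_trans by (auto simp: p)
qed simp

lemma smult_mem_cut:
  assumes "typed ps" "gfam N" "(x, i) \<in> set ps" "v \<in> Mg n"
  shows "x \<odot> v \<in> cut ps N (deg_succ i n)"
  using assms
proof (induction ps arbitrary: N)
  case (Cons p ps)
  obtain y j where p: "p = (y, j)" by (cases p)
  have y: "y \<in> Sg (unit_deg j)" "typed ps" using Cons.prems(1) by (auto simp: typed_def p)
  note C = gfam_push[OF Cons.prems(2) gfam_Mg y(1) gfam_le_Mg[OF Cons.prems(2)]]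
  show ?case
  proof (cases "(x, i) \<in> set ps")
    case True
    then show ?thesis using Cons.IH[OF y(2) C(1)] Cons.prems(4) by (simp add: p)
  next
    case False
    then have "x = y" "i = j" using Cons.prems(3) by (auto simp: p)
    then have "x \<odot> v \<in> push j y N Mg (deg_succ i n)" using C(4)[OF Cons.prems(4)] by simp
    then have "x \<odot> v \<in> cut ps (push j y N Mg) (deg_succ i n)"
      using conjunct2[OF gfam_cut[OF y(2) C(1)]] by (rule gfam_leD[rotated])
    then show ?thesis by (simp only: p cut.simps)
  qed
qed simp

lemma cut_subset:
  assumes "typed ps" "submodule Q S M" "\<And>n. N n \<subseteq> Q"
    "\<And>x m. x \<in> fst ` set ps \<Longrightarrow> m \<in> carrier M \<Longrightarrow> x \<odot> m \<in> Q"
  shows "cut ps N n \<subseteq> Q"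
  using assms
proof (induction ps arbitrary: N)
  case (Cons p ps)
  obtain y j where p: "p = (y, j)" by (cases p)
  have y: "typed ps" using Cons.prems(1) by (auto simp: typed_def p)
  have "push j y N Mg n \<subseteq> Q" for n
    using Cons.prems(3) Cons.prems(4)[of y] submoduleD(3)[OF Cons.prems(2)] M.Mg_closed(1)
    by (auto simp: push_def L.ssum_def p subset_iff)
  then show ?case using Cons.IH[OF y Cons.prems(2)] Cons.prems(4) by (simp add: p)
qed simp

text \<open>The submodule generated by all products \<open>x m\<close> is graded, and its pieces are those built step by step.\<close>

lemma cut_eq_seq:
  assumes ps: "typed ps"
  shows "cut ps (\<lambda>_. {\<zero>}) n = seq_submodule S M (map fst ps) \<inter> Mg n"
proof -
  let ?C = "cut ps (\<lambda>_. {\<zero>})" and ?Q = "seq_submodule S M (map fst ps)"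
  note Q = submodule_seq[OF typed_closed[OF ps]]
  have C: "gfam ?C" using gfam_cut[OF ps gfam_zero] by blast
  have sub: "?C n \<subseteq> ?Q"
    using cut_subset[OF ps Q(1), of "\<lambda>_. {\<zero>}"] Q(2) submoduleD(2)[OF Q(1)] by auto
  have "?Q \<subseteq> tot ?C"
  proof (rule Q(3)[OF submodule_tot[OF C]])
    fix x m assume "x \<in> set (map fst ps)" and m: "m \<in> carrier M"
    then obtain i where xi: "(x, i) \<in> set ps" by auto
    have x: "x \<in> Sg (unit_deg i)" using ps xi by (auto simp: typed_def)
    show "x \<odot> m \<in> tot ?C"
      using m
    proof (induction rule: M.graded_induct)
      case zero
      then show ?case using submoduleD(2)[OF submodule_tot[OF C]] S.Mg_closed(1)[OF x] by simp
    next
      case (add u v)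
      then show ?case using submoduleD(3)[OF submodule_tot[OF C]] S.Mg_closed(1)[OF x] by (simp add: smult_r_distr)
    next
      case (hom n v)
      have "x \<odot> v \<in> Mg (deg_succ i n)" using smult_hom[OF x hom] by (simp add: deg_add_unit)
      from tot_hom_iff[OF C this] show ?case using smult_mem_cut[OF ps gfam_zero xi hom] by simp
    qed
  qed
  then have "?Q \<inter> Mg n \<subseteq> ?C n" using tot_hom_iff[OF C] by blast
  then show ?thesis using sub gfamD(1)[OF C] by blast
qed

lemma freg_iff:
  "freg ps N \<longleftrightarrow> (\<forall>j<length ps. for_all_large (\<lambda>n. colon (unit_deg (snd (ps ! j))) (fst (ps ! j)) (cut (take j ps) N) Mg n =
     cut (take j ps) N n))"
proof (induction ps arbitrary: N)
  case (Cons p ps)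
  then show ?case by (cases p) (simp add: All_less_Suc2)
qed simp

lemma filter_regular_imp_colon:
  assumes ps: "typed ps" and x: "x \<in> Sg (unit_deg i)"
    and fr: "filter_regular Sg (quot_seq S M (map fst ps)) (quot_seq_grading S M Mg (map fst ps)) x"
  shows "for_all_large (\<lambda>n. colon (unit_deg i) x (cut ps (\<lambda>_. {\<zero>})) Mg n = cut ps (\<lambda>_. {\<zero>}) n)"
proof -
  let ?N = "seq_submodule S M (map fst ps)" and ?C = "cut ps (\<lambda>_. {\<zero>})"
  have N: "submodule ?N S M" by (rule submodule_seq(1)[OF typed_closed[OF ps]])
  have C: "gfam ?C" using gfam_cut[OF ps gfam_zero] by blast
  have xc: "x \<in> carrier S" using S.Mg_closed(1)[OF x] .
  have "for_all_large (\<lambda>n. {m \<in> carrier (quot_module M ?N). x \<odot>\<^bsub>quot_module M ?N\<^esub> m = \<zero>\<^bsub>quot_module M ?N\<^esub>} \<inter>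
      quot_grading M ?N Mg n = {\<zero>\<^bsub>quot_module M ?N\<^esub>})"
    using fr unfolding filter_regular_def quot_seq_def quot_seq_grading_def by blast
  then show ?thesis
  proof (rule for_all_large_mono)
    fix n assume *: "{m \<in> carrier (quot_module M ?N). x \<odot>\<^bsub>quot_module M ?N\<^esub> m = \<zero>\<^bsub>quot_module M ?N\<^esub>} \<inter>
      quot_grading M ?N Mg n = {\<zero>\<^bsub>quot_module M ?N\<^esub>}"
    have "v \<in> ?C n" if "v \<in> colon (unit_deg i) x ?C Mg n" for v
    proof -
      have v: "v \<in> Mg n" "x \<odot> v \<in> ?N" using that cut_eq_seq[OF ps] by (auto simp: colon_def)
      have vc: "v \<in> carrier M" using M.Mg_closed(1)[OF v(1)] .
      have "x \<odot>\<^bsub>quot_module M ?N\<^esub> cos ?N v = ?N"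
        using quot_smult[OF N xc vc] cos_eq_self_iff[OF N] v(2) xc vc by simp
      then have "cos ?N v \<in> {m \<in> carrier (quot_module M ?N). x \<odot>\<^bsub>quot_module M ?N\<^esub> m = \<zero>\<^bsub>quot_module M ?N\<^esub>} \<inter>
          quot_grading M ?N Mg n"
        using v vc by (simp add: carrier_quot quot_simps quot_grading_def)
      then have "cos ?N v = ?N" unfolding * by (simp add: quot_simps)
      then show ?thesis using cos_eq_self_iff[OF N vc] cut_eq_seq[OF ps] v(1) by simp
    qed
    moreover have "?C \<le> colon (unit_deg i) x ?C Mg" by (rule gfam_colon(2)[OF C gfam_Mg x gfam_le_Mg[OF C]])
    ultimately show "colon (unit_deg i) x ?C Mg n = ?C n" using gfam_leD by blast
  qed
qed

lemma filter_regular_seq_imp_freg: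
  assumes ps: "typed ps" and fr: "filter_regular_seq S Sg M Mg (map fst ps)"
  shows "freg ps (\<lambda>_. {\<zero>})"
  unfolding freg_iff
proof (intro allI impI)
  fix j assume j: "j < length ps"
  have t: "typed (take j ps)" using ps set_take_subset[of j ps] unfolding typed_def by blast
  have "ps ! j \<in> set ps" using j by simp
  then have x: "fst (ps ! j) \<in> Sg (unit_deg (snd (ps ! j)))" using ps by (auto simp: typed_def split: prod.splits)
  show "for_all_large (\<lambda>n. colon (unit_deg (snd (ps ! j))) (fst (ps ! j)) (cut (take j ps) (\<lambda>_. {\<zero>})) Mg n =
     cut (take j ps) (\<lambda>_. {\<zero>}) n)"
    using fr j by (intro filter_regular_imp_colon[OF t x]) (auto simp: filter_regular_seq_def take_map)
qed

section \<open>Support of the quotient by a sequence\<close>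

text \<open>The linear combinations of a list of elements with coefficients in \<open>I\<close>; for a list of generators of \<open>M\<close> this is \<open>I M\<close>.\<close>

fun lin :: "'s set \<Rightarrow> 'm list \<Rightarrow> 'm set" where
  "lin I [] = {\<zero>}"
| "lin I (b # bs) = {c \<odot> b \<oplus> v | c v. c \<in> I \<and> v \<in> lin I bs}"

lemma lin_ConsI: "c \<in> I \<Longrightarrow> v \<in> lin I bs \<Longrightarrow> c \<odot> b \<oplus> v \<in> lin I (b # bs)"
  by auto

lemma lin_submodule:
  assumes I: "ideal I S" and "set bs \<subseteq> carrier M"
  shows "submodule (lin I bs) S M"
  using assms(2)
proof (induction bs)
  case Nil
  show ?case by (rule submoduleI) auto
next
  case (Cons b bs)
  interpret I: ideal I S by (rule I)
  have b: "b \<in> carrier M" and IH: "submodule (lin I bs) S M" using Cons by auto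
  note l = submoduleD[OF IH]
  have Ic: "c \<in> carrier S" if "c \<in> I" for c using that I.a_subset by blast
  show ?case
  proof (rule submoduleI)
    show "lin I (b # bs) \<subseteq> carrier M" using b l(1) Ic by auto
    have "\<zero>\<^bsub>S\<^esub> \<in> I" by (rule additive_subgroup.zero_closed[OF ideal.axioms(1)[OF I]])
    from lin_ConsI[OF this l(2), of b] show "\<zero> \<in> lin I (b # bs)" using b by simp
    fix u assume "u \<in> lin I (b # bs)"
    then obtain c v where u: "c \<in> I" "v \<in> lin I bs" "u = c \<odot> b \<oplus> v" by auto
    have "\<ominus> u = (\<ominus>\<^bsub>S\<^esub> c) \<odot> b \<oplus> \<ominus> v"
      using u Ic l(1) b by (simp add: smult_l_minus M.minus_add)
    then show "\<ominus> u \<in> lin I (b # bs)" using u l(4) I.a_inv_closed by auto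
    show "s \<odot> u \<in> lin I (b # bs)" if s: "s \<in> carrier S" for s
    proof -
      have "s \<odot> u = (s \<otimes>\<^bsub>S\<^esub> c) \<odot> b \<oplus> s \<odot> v" using u Ic l(1) b s by (simp add: smult_r_distr smult_assoc1)
      then show ?thesis using lin_ConsI[OF I.I_l_closed[OF u(1) s] l(5)[OF s u(2)]] u(3) by (simp only:)
    qed
    fix w assume "w \<in> lin I (b # bs)"
    then obtain d z where w: "d \<in> I" "z \<in> lin I bs" "w = d \<odot> b \<oplus> z" by auto
    have "u \<oplus> w = (c \<oplus>\<^bsub>S\<^esub> d) \<odot> b \<oplus> (v \<oplus> z)"
      using u w Ic l(1) b by (simp add: smult_l_distr M.a_ac)
    then show "u \<oplus> w \<in> lin I (b # bs)" using u(1,2) w(1,2) l(3) by auto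
  qed
qed

lemma lin_mono: "I \<subseteq> J \<Longrightarrow> lin I bs \<subseteq> lin J bs"
  by (induction bs) auto

lemma lin_gen:
  assumes "set bs \<subseteq> carrier M"
  shows "set bs \<subseteq> lin (carrier S) bs"
  using assms
proof (induction bs)
  case (Cons b bs)
  note l = submoduleD[OF lin_submodule[OF S.oneideal, of bs]]
  have b: "b \<in> carrier M" "set bs \<subseteq> carrier M" using Cons.prems by auto
  have "b \<in> lin (carrier S) (b # bs)" using lin_ConsI[OF S.one_closed l(2)[OF b(2)], of b] b by simp
  moreover have "v \<in> lin (carrier S) (b # bs)" if "v \<in> lin (carrier S) bs" for v
    using lin_ConsI[OF S.zero_closed that, of b] l(1)[OF b(2) that] b by simp
  ultimately show ?case using Cons.IH[OF b(2)] by auto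
qed simp

lemma lin_mult:
  assumes I: "ideal I S" and x: "x \<in> I" and bs: "set bs \<subseteq> carrier M" and v: "v \<in> lin (carrier S) bs"
  shows "x \<odot> v \<in> lin I bs"
  using bs v
proof (induction bs arbitrary: v)
  case Nil
  then show ?case using x ideal.Icarr[OF I] by simp
next
  case (Cons b bs)
  interpret I: ideal I S by (rule I)
  obtain c w where v: "c \<in> carrier S" "w \<in> lin (carrier S) bs" "v = c \<odot> b \<oplus> w" using Cons.prems by auto
  have w: "w \<in> carrier M" using submoduleD(1)[OF lin_submodule[OF S.oneideal, of bs]] v(2) Cons.prems by simp
  have "x \<odot> v = (x \<otimes>\<^bsub>S\<^esub> c) \<odot> b \<oplus> x \<odot> w"
    using v w x I.Icarr Cons.prems by (simp add: smult_r_distr smult_assoc1)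
  then show ?case using Cons.IH[OF _ v(2)] Cons.prems v(1) x I.I_r_closed by auto
qed

text \<open>Nakayama's lemma at a prime \<open>P\<close>, with the denominators cleared: if \<open>M\<^sub>P = P M\<^sub>P\<close> then \<open>M\<^sub>P = 0\<close>.
  The generators are eliminated one after the other.\<close>

lemma nakayama_at_prime:
  assumes P: "primeideal P S" and bs: "set bs \<subseteq> carrier M" and s: "s \<in> carrier S" "s \<notin> P"
    and sub: "\<And>v. v \<in> lin (carrier S) bs \<Longrightarrow> s \<odot> v \<in> lin P bs"
  obtains t where "t \<in> carrier S" "t \<notin> P" "\<And>v. v \<in> lin (carrier S) bs \<Longrightarrow> t \<odot> v = \<zero>"
proof -
  interpret P: primeideal P S by (rule P)
  have "\<exists>t\<in>carrier S - P. \<forall>v\<in>lin (carrier S) bs. t \<odot> v = \<zero>"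
    using bs s sub
  proof (induction bs arbitrary: s)
    case Nil
    then show ?case by auto
  next
    case (Cons b bs)
    have b: "b \<in> carrier M" "set bs \<subseteq> carrier M" using Cons.prems(1) by auto
    note lP = submoduleD[OF lin_submodule[OF P.is_ideal b(2)]]
    note lS = submoduleD[OF lin_submodule[OF S.oneideal b(2)]]
    have "b \<in> lin (carrier S) (b # bs)" using lin_gen[OF Cons.prems(1)] by simp
    from Cons.prems(4)[OF this] obtain p w where p: "p \<in> P" "w \<in> lin P bs" "s \<odot> b = p \<odot> b \<oplus> w" by auto
    define u where "u = s \<ominus>\<^bsub>S\<^esub> p"
    have pc: "p \<in> carrier S" using p(1) P.Icarr by blast
    have wc: "w \<in> carrier M" using p(2) lP(1) by blast
    have uc: "u \<in> carrier S" using pc Cons.prems(2) by (simp add: u_def)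
    have uP: "u \<notin> P"
    proof
      assume "u \<in> P"
      then have "u \<oplus>\<^bsub>S\<^esub> p \<in> P" using p(1) by simp
      then show False using Cons.prems(2,3) pc by (simp add: u_def S.minus_eq S.a_assoc S.l_neg)
    qed
    have ub: "u \<odot> b = w"
    proof -
      have "u \<odot> b = s \<odot> b \<oplus> \<ominus> (p \<odot> b)"
        using pc Cons.prems(2) b by (simp add: u_def S.minus_eq smult_l_distr smult_l_minus)
      also have "\<dots> = w" unfolding p(3) using pc b wc by (simp add: M.a_comm[of "p \<odot> b" w] M.a_assoc M.r_neg)
      finally show ?thesis .
    qed
    have us: "u \<otimes>\<^bsub>S\<^esub> s \<in> carrier S" "u \<otimes>\<^bsub>S\<^esub> s \<notin> P" using uc uP Cons.prems(2,3) P.I_prime by auto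
    have "(u \<otimes>\<^bsub>S\<^esub> s) \<odot> v \<in> lin P bs" if v: "v \<in> lin (carrier S) bs" for v
    proof -
      have vc: "v \<in> carrier M" using lS(1) v .
      have "v = \<zero>\<^bsub>S\<^esub> \<odot> b \<oplus> v" using b vc by simp
      then have "v \<in> lin (carrier S) (b # bs)" using v by auto
      from Cons.prems(4)[OF this] obtain q z where q: "q \<in> P" "z \<in> lin P bs" "s \<odot> v = q \<odot> b \<oplus> z" by auto
      have qc: "q \<in> carrier S" "z \<in> carrier M" using q P.Icarr lP(1) by auto
      have "(u \<otimes>\<^bsub>S\<^esub> s) \<odot> v = q \<odot> (u \<odot> b) \<oplus> u \<odot> z"
        using q(3) qc uc Cons.prems(2) vc b smult_swap[OF uc qc(1) b(1)] by (simp add: smult_assoc1 smult_r_distr)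
      then show ?thesis using ub lP(3)[OF lP(5)[OF qc(1) p(2)] lP(5)[OF uc q(2)]] by simp
    qed
    from Cons.IH[OF b(2) us this] obtain t where t: "t \<in> carrier S" "t \<notin> P"
      "\<And>v. v \<in> lin (carrier S) bs \<Longrightarrow> t \<odot> v = \<zero>" by blast
    have "(t \<otimes>\<^bsub>S\<^esub> u) \<odot> v = \<zero>" if vl: "v \<in> lin (carrier S) (b # bs)" for v
    proof -
      obtain c z where v: "c \<in> carrier S" "z \<in> lin (carrier S) bs" "v = c \<odot> b \<oplus> z" using vl by auto
      have zc: "z \<in> carrier M" using lS(1) v(2) .
      have w0: "t \<odot> w = \<zero>" using t(3) p(2) lin_mono[of P "carrier S" bs] P.a_subset by blast
      have 1: "(t \<otimes>\<^bsub>S\<^esub> u) \<odot> (c \<odot> b) = c \<odot> (t \<odot> (u \<odot> b))"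
        using t(1) uc v(1) b(1) smult_swap[of "t \<otimes>\<^bsub>S\<^esub> u" c b] by (simp add: smult_assoc1)
      have 2: "(t \<otimes>\<^bsub>S\<^esub> u) \<odot> z = u \<odot> (t \<odot> z)"
        using t(1) uc zc by (simp add: smult_assoc1[symmetric] S.m_comm)
      show ?thesis
        using v t(1) uc zc b(1) 1 2 ub w0 t(3)[OF v(2)] by (simp add: smult_r_distr)
    qed
    moreover have "t \<otimes>\<^bsub>S\<^esub> u \<in> carrier S - P" using t uc uP P.I_prime by auto
    ultimately show ?case by blast
  qed
  then show thesis using that by blast
qed

lemma comp_smult_hom:
  assumes "t \<in> carrier S" "m \<in> Mg n"
  shows "M.comp (deg_add k n) (t \<odot> m) = S.comp k t \<odot> m"
  using assms(1)
proof (induction rule: S.graded_induct)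
  case zero
  then show ?case using M.Mg_closed(1)[OF assms(2)] by simp
next
  case (add s t)
  then show ?case using M.Mg_closed(1)[OF assms(2)]
    by (simp add: smult_l_distr M.comp_add S.comp_add S.comp_carrier)
next
  case (hom j s)
  have "deg_add k n = deg_add j n \<longleftrightarrow> k = j" by (metis deg_add_cancel deg_add_commute)
  then show ?case
    using M.comp_homogeneous[OF smult_hom[OF hom assms(2)]] S.comp_homogeneous[OF hom] M.Mg_closed(1)[OF assms(2)]
    by simp
qed

text \<open>If the localization of \<open>M / x M\<close> at \<open>P\<close> were zero, then so would be that of \<open>M\<close>, by Nakayama's lemma, as the \<open>x\<close> lie in
  \<open>P\<close>.  So an element outside \<open>P\<close> annihilates \<open>M\<close>.  Its homogeneous components annihilate \<open>M\<close> as well, and one of them is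
  outside \<open>P\<close>, contrary to the assumption on \<open>P\<close>.\<close>

lemma mem_Supp_pp:
  assumes P: "P \<in> Proj S Sg" and xs: "set xs \<subseteq> carrier S" "set xs \<subseteq> P"
    and supp: "supp_at (\<lambda>_. {\<zero>}) Mg P"
  shows "P \<in> Supp_pp S Sg (quot_seq S M xs)"
proof -
  let ?N = "seq_submodule S M xs"
  let ?Q = "quot_module M ?N"
  have N: "submodule ?N S M" by (rule submodule_seq(1)[OF xs(1)])
  have Pp: "primeideal P S" using P by (simp add: Proj_def)
  interpret P: primeideal P S by (rule Pp)
  have one: "\<one>\<^bsub>S\<^esub> \<in> carrier S - P" using P.I_notcarr P.one_imp_carrier by auto
  have "localization S P ?Q \<noteq> {loc_zero S P ?Q}"
  proof
    assume loc: "localization S P ?Q = {loc_zero S P ?Q}"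
    have kill: "\<exists>u\<in>carrier S - P. u \<odot> m \<in> ?N" if m: "m \<in> carrier M" for m
    proof -
      have c: "cos ?N m \<in> carrier ?Q" using m by (simp add: carrier_quot)
      have z: "?N \<in> carrier ?Q" using cos_zero[OF N] by (metis M.zero_closed carrier_quot imageI)
      have "loc_rel S P ?Q `` {(cos ?N m, \<one>\<^bsub>S\<^esub>)} \<in> localization S P ?Q"
        unfolding localization_def using c one by (intro quotientI) auto
      then have "loc_rel S P ?Q `` {(cos ?N m, \<one>\<^bsub>S\<^esub>)} = loc_rel S P ?Q `` {(?N, \<one>\<^bsub>S\<^esub>)}"
        unfolding loc by (simp add: loc_zero_def quot_simps)
      moreover have "(cos ?N m, \<one>\<^bsub>S\<^esub>) \<in> loc_rel S P ?Q `` {(cos ?N m, \<one>\<^bsub>S\<^esub>)}"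
        using c one by (auto simp: loc_rel_def)
      ultimately have "((?N, \<one>\<^bsub>S\<^esub>), (cos ?N m, \<one>\<^bsub>S\<^esub>)) \<in> loc_rel S P ?Q" by blast
      then obtain u where u: "u \<in> carrier S - P"
          "u \<odot>\<^bsub>?Q\<^esub> (\<one>\<^bsub>S\<^esub> \<odot>\<^bsub>?Q\<^esub> ?N) = u \<odot>\<^bsub>?Q\<^esub> (\<one>\<^bsub>S\<^esub> \<odot>\<^bsub>?Q\<^esub> cos ?N m)"
        by (auto simp: loc_rel_def)
      have "\<one>\<^bsub>S\<^esub> \<odot>\<^bsub>?Q\<^esub> ?N = ?N" "u \<odot>\<^bsub>?Q\<^esub> ?N = ?N"
        using quot_smult[OF N S.one_closed M.zero_closed] quot_smult[OF N _ M.zero_closed, of u] u(1)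
        by (simp_all add: cos_zero[OF N])
      moreover have "u \<odot>\<^bsub>?Q\<^esub> (\<one>\<^bsub>S\<^esub> \<odot>\<^bsub>?Q\<^esub> cos ?N m) = cos ?N (u \<odot> m)"
        using quot_smult[OF N S.one_closed m] quot_smult[OF N _ m, of u] u(1) m by simp
      ultimately have "cos ?N (u \<odot> m) = ?N" using u(2) by simp
      then show ?thesis using cos_eq_self_iff[OF N, of "u \<odot> m"] u(1) m by auto
    qed
    obtain B where B: "finite B" "B \<subseteq> carrier M" "carrier M = submodule_gen S M B"
      using fg unfolding fg_module_def by blast
    obtain bs where bs: "set bs = B" using finite_list[OF B(1)] by blast
    have bsM: "set bs \<subseteq> carrier M" using bs B(2) by simp
    have "\<exists>s\<in>carrier S - P. \<forall>b\<in>F. s \<odot> b \<in> ?N" if "finite F" "F \<subseteq> carrier M" for F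
      using that
    proof (induction F)
      case empty
      then show ?case using one by blast
    next
      case (insert b F)
      then obtain s where s: "s \<in> carrier S - P" "\<forall>b\<in>F. s \<odot> b \<in> ?N" by auto
      obtain u where u: "u \<in> carrier S - P" "u \<odot> b \<in> ?N" using kill insert.prems by blast
      have "u \<otimes>\<^bsub>S\<^esub> s \<in> carrier S - P" using s u P.I_prime by auto
      moreover have "(u \<otimes>\<^bsub>S\<^esub> s) \<odot> c \<in> ?N" if c: "c \<in> insert b F" for c
      proof -
        have cc: "c \<in> carrier M" using c insert.prems by blast
        have "(u \<otimes>\<^bsub>S\<^esub> s) \<odot> c = u \<odot> (s \<odot> c)" "(u \<otimes>\<^bsub>S\<^esub> s) \<odot> c = s \<odot> (u \<odot> c)"
          using u(1) s(1) cc smult_swap[of u s c] by (simp_all add: smult_assoc1)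
        then show ?thesis using c s u submoduleD(5)[OF N] by (metis DiffD1 insertE)
      qed
      ultimately show ?case by blast
    qed
    from this[OF B(1,2)] obtain s where s: "s \<in> carrier S - P" "\<forall>b\<in>B. s \<odot> b \<in> ?N" by blast
    have linS: "lin (carrier S) bs = carrier M"
      using submodule_submodule_gen(3)[OF B(2) lin_submodule[OF S.oneideal bsM]] lin_gen[OF bsM] bs B(3)
        submoduleD(1)[OF lin_submodule[OF S.oneideal bsM]] by blast
    have NP: "?N \<subseteq> lin P bs"
      using submodule_seq(3)[OF xs(1) lin_submodule[OF P.is_ideal bsM]] lin_mult[OF P.is_ideal _ bsM] xs(2) linS
      by blast
    have "submodule {m \<in> carrier M. s \<odot> m \<in> ?N} S M"
      using s(1) submoduleD[OF N] smult_swap[of s]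
      by (intro submoduleI) (auto simp: smult_r_distr smult_r_minus)
    moreover have "B \<subseteq> {m \<in> carrier M. s \<odot> m \<in> ?N}" using s(2) B(2) by blast
    ultimately have "carrier M \<subseteq> {m \<in> carrier M. s \<odot> m \<in> ?N}"
      using submodule_submodule_gen(3)[OF B(2)] B(3) by blast
    then have "s \<odot> v \<in> lin P bs" if "v \<in> lin (carrier S) bs" for v using that NP linS by blast
    then obtain t where t: "t \<in> carrier S" "t \<notin> P" "\<And>v. v \<in> carrier M \<Longrightarrow> t \<odot> v = \<zero>"
      using nakayama_at_prime[OF Pp bsM, of s] s(1) unfolding linS by blast
    have "S.comp k t \<in> P" for k
    proof -
      have "S.comp k t \<odot> m = \<zero>" if "m \<in> Mg n" for m n
        using comp_smult_hom[OF t(1) that, of k] t(3)[OF M.Mg_closed(1)[OF that]] by simp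
      then show ?thesis using supp S.comp_in[OF t(1), of k] unfolding supp_at_def by blast
    qed
    then have "t \<in> P" by (intro S.mem_if_comps_mem[OF t(1)]) (use P.a_subset in auto)
    then show False using t(2) by blast
  qed
  then show ?thesis using P by (simp add: Supp_pp_def quot_seq_def)
qed

lemma dim_le_0_imp_no_chain:
  assumes xs: "set xs \<subseteq> carrier S" and dim: "chain_dim (Supp_pp S Sg (quot_seq S M xs)) \<le> 0"
  shows "no_chain (set xs) (\<lambda>_. {\<zero>}) Mg"
  unfolding no_chain_def
proof
  assume "\<exists>P\<in>Proj S Sg. \<exists>Q\<in>Proj S Sg. P \<subset> Q \<and> set xs \<subseteq> P \<and> supp_at (\<lambda>_. {\<zero>}) Mg P"
  then obtain P Q where PQ: "P \<in> Proj S Sg" "Q \<in> Proj S Sg" "P \<subset> Q" "set xs \<subseteq> P" "supp_at (\<lambda>_. {\<zero>}) Mg P"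
    by blast
  let ?Z = "Supp_pp S Sg (quot_seq S M xs)"
  have P: "P \<in> ?Z" by (rule mem_Supp_pp[OF PQ(1) xs PQ(4,5)])
  have "supp_at (\<lambda>_. {\<zero>}) Mg Q" using PQ(3,5) unfolding supp_at_def by blast
  then have Q: "Q \<in> ?Z" using PQ(3,4) by (intro mem_Supp_pp[OF PQ(2) xs]) auto
  have "1 \<in> chain_lengths ?Z"
    unfolding chain_lengths_def using P Q PQ(3)
    by (intro CollectI exI[of _ "\<lambda>i. if i = 0 then P else Q"]) auto
  then have "ereal (real 1) \<le> chain_dim ?Z" unfolding chain_dim_def by (rule SUP_upper)
  with dim have "ereal (real 1) \<le> 0" by (rule order_trans[rotated])
  then show False by simp
qed

lemma of_type_imp_typed:
  assumes "of_type Sg xs k"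
  obtains ps where "typed ps" "map fst ps = xs" "tdeg ps = k"
proof -
  obtain js where js: "list_all2 (\<lambda>x i. x \<in> Sg (unit_deg i)) xs js" "\<And>i. count_list js i = k i"
    using assms unfolding of_type_def by blast
  have len: "length xs = length js" using js(1) by (rule list_all2_lengthD)
  have "typed (zip xs js)" using js(1) by (auto simp: typed_def list_all2_iff)
  moreover have "map fst (zip xs js) = xs" using len by simp
  moreover have "tdeg (zip xs js) = k" using len js(2) by (simp add: tdeg_def fun_eq_iff)
  ultimately show thesis by (rule that)
qed

lemma ereal_of_enat_enat: "ereal_of_enat (enat a) = ereal (of_int (int a))"
  by simp

lemma hilbert_coeff_eq:
  assumes "ev_poly (hilb (\<lambda>_. {\<zero>}) Mg) e"
  shows "hilbert_coeff A S M Mg = e"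
proof -
  have len: "ereal_of_enat (piece_length A S M (Mg n)) = ereal (of_int (hilb (\<lambda>_. {\<zero>}) Mg n))" for n
    using len_gfam[OF gfam_zero gfam_Mg gfam_le_Mg[OF gfam_zero], of n]
    unfolding piece_length_eq hilb_def by (metis ereal_of_enat_enat)
  have "finite {k. g k \<noteq> 0} \<and> for_all_large (\<lambda>n. ereal_of_enat (piece_length A S M (Mg n)) =
      ereal (of_int (\<Sum>k | g k \<noteq> 0. g k * int (\<Prod>i\<in>UNIV. (n i + k i) choose k i)))) \<longleftrightarrow>
      ev_poly (hilb (\<lambda>_. {\<zero>}) Mg) g" for g
    unfolding len ev_poly_def num_poly_def binom_prod_def ereal.inject of_int_eq_iff by (rule refl)
  then show ?thesis
    unfolding hilbert_coeff_def using assms ev_poly_unique by (intro the_equality) blast+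
qed

end


section \<open>The inequality between mixed multiplicities and lengths\<close>

theorem corollary1p4:
  fixes A :: "('a, 'w) ring_scheme"
    and \<mm> :: "'a set"
    and S :: "('a, 's, 'x) module_scheme"
    and Sg :: "('d::finite \<Rightarrow> nat) \<Rightarrow> 's set"
    and M :: "('s, 'm, 'y) module_scheme"
    and Mg :: "('d \<Rightarrow> nat) \<Rightarrow> 'm set"
    and xs :: "'s list"
    and k :: "'d \<Rightarrow> nat"
  assumes "artinian_ring A"
    and "local_ring A \<mm>"
    and "infinite (carrier (A Quot \<mm>))"
    and "fg_standard_graded_algebra A S Sg"
    and "graded_module S Sg M Mg"
    and "fg_module S M"
    and "mixed_mult_system S Sg M xs k"
  shows "for_all_large (\<lambda>n. ereal (of_int (hilbert_coeff A S M Mg k))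
           \<le> ereal_of_enat (piece_length A S (quot_seq S M xs) (quot_seq_grading S M Mg xs n))) \<and>
         (filter_regular_seq S Sg M Mg xs \<longrightarrow>
           for_all_large (\<lambda>n. ereal (of_int (hilbert_coeff A S M Mg k))
             = ereal_of_enat (piece_length A S (quot_seq S M xs) (quot_seq_grading S M Mg xs n))))"
proof -
  have alg: "graded_algebra A S Sg"
    using assms(4) by (simp add: fg_standard_graded_algebra_def)
  interpret AS: algebra A S using alg by (simp add: graded_algebra_def)
  interpret standard_module A S Sg M Mg
  proof (intro standard_module.intro standard_module_axioms.intro)
    show "graded_ring S Sg"
      using alg AS.M_cring cring.axioms(1)[OF AS.M_cring, THEN ring.is_abelian_group]
      by (auto intro!: graded_ring.intro graded_group.intro graded_group_axioms.intro
          graded_ring_axioms.intro simp: graded_algebra_def)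
    show MS: "module S M" using assms(5) by (simp add: graded_module_def)
    show "graded_group M Mg"
      using assms(5) module.axioms(2)[OF MS]
      by (auto intro!: graded_group.intro graded_group_axioms.intro simp: graded_module_def)
  qed (rule assms)+
  let ?z = "\<lambda>_::'d \<Rightarrow> nat. {\<zero>\<^bsub>M\<^esub>}"
  have type: "of_type Sg xs k" and dim: "chain_dim (Supp_pp S Sg (quot_seq S M xs)) \<le> 0"
    using assms(7) by (simp_all add: mixed_mult_system_def)
  obtain ps where ps: "typed ps" "map fst ps = xs" "tdeg ps = k"
    using of_type_imp_typed[OF type] .
  have xs: "set xs \<subseteq> carrier S" using typed_closed[OF ps(1)] ps(2) by simp
  have chain: "no_chain (fst ` set ps) ?z Mg"
    using dim_le_0_imp_no_chain[OF xs dim] ps(2) by auto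
  obtain e where e: "ev_poly (hilb ?z Mg) e"
    using exists_hilbert_poly[OF gfam_zero gfam_Mg gfam_le_Mg[OF gfam_zero]] by blast
  have C: "gfam (cut ps ?z)" using gfam_cut[OF ps(1) gfam_zero] by blast
  have len: "ereal_of_enat (piece_length A S (quot_seq S M xs) (quot_seq_grading S M Mg xs n)) =
      ereal (of_int (hilb (cut ps ?z) Mg n))" for n
  proof -
    have "piece_length A S (quot_seq S M xs) (quot_seq_grading S M Mg xs n) = L.len (cut ps ?z n) (Mg n)"
      using quot_piece_length_eq[OF submodule_seq(1)[OF xs]] cut_eq_seq[OF ps(1)] ps(2)
      by (simp add: quot_seq_def quot_seq_grading_def)
    then show ?thesis
      using len_gfam[OF C gfam_Mg gfam_le_Mg[OF C], of n] unfolding hilb_def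
      by (metis ereal_of_enat_enat)
  qed
  have "for_all_large (\<lambda>n. e k \<le> hilb (cut ps ?z) Mg n) \<and>
      (freg ps ?z \<longrightarrow> for_all_large (\<lambda>n. e k = hilb (cut ps ?z) Mg n))"
    using mixed_multiplicity_le[OF gfam_zero ps(1) chain e] ps(3) by simp
  then show ?thesis
    using filter_regular_seq_imp_freg[OF ps(1)] ps(2)
    unfolding hilbert_coeff_eq[OF e] len ereal_less_eq ereal.inject of_int_le_iff of_int_eq_iff by blast
qed

end
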